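(* Let $\mathsf{F}\colon\mathcal{S}\times\mathcal{T}\to\mathcal{U}$ be a biexact functor of triangulated categories that admits a strong Verdier structure. Then \[ \operatorname{level}^{\mathsf{F}(X,X')}_{\mathcal{U}}\bigl(\mathsf{F}(Y,Y')\bigr)\le\operatorname{level}^X_{\mathcal{S}}(Y)+\operatorname{level}^{X'}_{\mathcal{T}}(Y')-1 \] for all objects $X,Y$ of $\mathcal{S}$ and $X',Y'$ of $\mathcal{T}$.
   Context: Biexact: $\mathsf{F}$ is a bifunctor with natural isomorphisms $\theta\colon\mathsf{F}(\Sigma-,-)\to\Sigma\mathsf{F}(-,-)$, $\zeta\colon\mathsf{F}(-,\Sigma-)\to\Sigma\mathsf{F}(-,-)$ such that for every $X$, $\mathsf{F}(X,-)$ with $\zeta(X,-)$ is exact (i.e. sends an exact triangle $A\xrightarrow{a}B\xrightarrow{b}C\xrightarrow{c}\Sigma A$ to the exact triangle $\mathsf{F}(X,A)\to\mathsf{F}(X,B)\to\mathsf{F}(X,C)\xrightarrow{\zeta\circ\mathsf{F}(X,c)}\Sigma\mathsf{F}(X,A)$), likewise $\mathsf{F}(-,X')$ with $\theta(-,X')$, and $(\Sigma\zeta)\circ\theta=-(\Sigma\theta)\circ\zeta$ as maps $\mathsf{F}(\Sigma X,\Sigma X')\to\Sigma^2\mathsf{F}(X,X')$. A commutative square $T\to V$, $T\to U$, $V\to P$, $U\to P$ (maps $g,f,f',g'$) is homotopy cartesian if there is an exact triangle $T\xrightarrow{\binom{f}{-g}}U\oplus V\xrightarrow{(g'\ f')}P\to\Sigma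 T$. Strong Verdier structure: for all exact triangles $X\xrightarrow{f}Y\xrightarrow{g}Z\xrightarrow{h}\Sigma X$ in $\mathcal{S}$ and $X'\xrightarrow{f'}Y'\xrightarrow{g'}Z'\xrightarrow{h'}\Sigma X'$ in $\mathcal{T}$ there exist an object $W$ of $\mathcal{U}$ and exact triangles $\mathsf{F}(X,Y')\xrightarrow{j}W\xrightarrow{q}\mathsf{F}(Z,X')\xrightarrow{\theta\mathsf{F}(h,f')}\Sigma\mathsf{F}(X,Y')$, $W\xrightarrow{i}\mathsf{F}(Y,Y')\xrightarrow{\mathsf{F}(g,g')}\mathsf{F}(Z,Z')\xrightarrow{p}\Sigma W$, $\mathsf{F}(Y,X')\xrightarrow{j'}W\xrightarrow{q'}\mathsf{F}(X,Z')\xrightarrow{\zeta\mathsf{F}(f,h')}\Sigma\mathsf{F}(Y,X')$, such that $q'j=\mathsf{F}(X,g')$, $ij=\mathsf{F}(f,Y')$, $ij'=\mathsf{F}(Y,f')$, $qj'=\mathsf{F}(g,X')$, $(\Sigma q)p=\zeta\mathsf{F}(Z,h')$, $(\Sigma q')p=\theta\mathsf{F}(h,Z')$, and the following squares commute and are homotopy cartesian: (I) $j'\mathsf{F}(f,X')=j\mathsf{F}(X,f')$ from $\mathsf{F}(X,X')$ to $W$; (II) $\mathsf{F}(g,Y')i=\mathsf{F}(Z,f')q$ from $W$ to $\mathsf{F}(Z,Y')$; (III) $\mathsf{F}(Y,g')i=\mathsf{F}(f,Z')q'$ from $W$ to $\mathsf{F}(Y,Z')$; (IV) $p\,\mathsf{F}(Z,g')=(\Sigma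 j)\theta\mathsf{F}(h,Y')$ from $\mathsf{F}(Z,Y')$ to $\Sigma W$; (V) $p\,\mathsf{F}(g,Z')=(\Sigma j')\zeta\mathsf{F}(Y,h')$ from $\mathsf{F}(Y,Z')$ to $\Sigma W$; and (VI) the square from $\Sigma W$ to $\Sigma^2\mathsf{F}(X,X')$ formed by $\Sigma(\zeta\mathsf{F}(X,h'))\circ\Sigma q'$ and $\Sigma(\theta\mathsf{F}(h,X'))\circ\Sigma q$ anti-commutes and becomes homotopy cartesian after replacing one of its morphisms by its negative. Level: $\operatorname{thick}^0(X)$ = zero objects; $\operatorname{thick}^1(X)$ = smallest full subcategory containing $X$ closed under (de)suspension, finite coproducts and retracts; for $n\ge2$, $Y\in\operatorname{thick}^n(X)$ iff there is an exact triangle $Y'\to Y\oplus\tilde Y\to Y''\to\Sigma Y'$ with $Y'\in\operatorname{thick}^1(X)$, $Y''\in\operatorname{thick}^{n-1}(X)$; $\operatorname{level}^X(Y)=\inf\{n\ge0:Y\in\operatorname{thick}^n(X)\}$.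
   Formalization: If Y and Y' are both zero objects, both levels are 0 and the stated bound reads 0 ≤ −1, which is false; the formal statement truncates the subtraction at 0, so the bound is 0 in that case and is unchanged in all others. *)

theory Defs
  imports Main "HOL-Library.Extended_Nat"
begin

text \<open>cmp C g f is the composite g after f.  Morphisms are only constrained on the
hom-sets between objects of ob C.  A triangle X -f-> Y -g-> Z -h-> Sigma X is a tuple
(X,Y,Z,f,g,h).\<close>

record ('o, 'm) tcat =
  ob   :: "'o set"
  hom  :: "'o \<Rightarrow> 'o \<Rightarrow> 'm set"
  cmp  :: "'m \<Rightarrow> 'm \<Rightarrow> 'm"
  idt  :: "'o \<Rightarrow> 'm"
  add  :: "'m \<Rightarrow> 'm \<Rightarrow> 'm"
  neg  :: "'m \<Rightarrow> 'm"
  zer  :: "'o \<Rightarrow> 'o \<Rightarrow> 'm"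
  sobj :: "'o \<Rightarrow> 'o"
  smor :: "'m \<Rightarrow> 'm"
  tri  :: "('o \<times> 'o \<times> 'o \<times> 'm \<times> 'm \<times> 'm) set"

definition iso_mor :: "('o,'m) tcat \<Rightarrow> 'o \<Rightarrow> 'o \<Rightarrow> 'm \<Rightarrow> bool" where
  "iso_mor C X Y f \<longleftrightarrow> f \<in> hom C X Y \<and>
     (\<exists>g\<in>hom C Y X. cmp C g f = idt C X \<and> cmp C f g = idt C Y)"

definition zero_obj :: "('o,'m) tcat \<Rightarrow> 'o \<Rightarrow> bool" where
  "zero_obj C Z \<longleftrightarrow> Z \<in> ob C \<and>
     (\<forall>Y\<in>ob C. (\<exists>!f. f \<in> hom C Z Y) \<and> (\<exists>!f. f \<in> hom C Y Z))"

definition is_biprod :: "('o,'m) tcat \<Rightarrow> 'o \<Rightarrow> 'o \<Rightarrow> 'o \<Rightarrow> 'm \<Rightarrow> 'm \<Rightarrow> 'm \<Rightarrow> 'm \<Rightarrow> bool" where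
  "is_biprod C A B S i1 i2 p1 p2 \<longleftrightarrow> S \<in> ob C \<and>
     i1 \<in> hom C A S \<and> i2 \<in> hom C B S \<and> p1 \<in> hom C S A \<and> p2 \<in> hom C S B \<and>
     cmp C p1 i1 = idt C A \<and> cmp C p2 i2 = idt C B \<and>
     cmp C p1 i2 = zer C B A \<and> cmp C p2 i1 = zer C A B \<and>
     add C (cmp C i1 p1) (cmp C i2 p2) = idt C S"

definition category :: "('o,'m) tcat \<Rightarrow> bool" where
  "category C \<longleftrightarrow>
     (\<forall>X\<in>ob C. idt C X \<in> hom C X X) \<and>
     (\<forall>X\<in>ob C. \<forall>Y\<in>ob C. \<forall>Z\<in>ob C. \<forall>f g. f \<in> hom C X Y \<and> g \<in> hom C Y Z
          \<longrightarrow> cmp C g f \<in> hom C X Z) \<and>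
     (\<forall>X\<in>ob C. \<forall>Y\<in>ob C. \<forall>f\<in>hom C X Y. cmp C f (idt C X) = f \<and> cmp C (idt C Y) f = f) \<and>
     (\<forall>W\<in>ob C. \<forall>X\<in>ob C. \<forall>Y\<in>ob C. \<forall>Z\<in>ob C. \<forall>f g h.
          f \<in> hom C W X \<and> g \<in> hom C X Y \<and> h \<in> hom C Y Z
          \<longrightarrow> cmp C h (cmp C g f) = cmp C (cmp C h g) f)"

definition additive :: "('o,'m) tcat \<Rightarrow> bool" where
  "additive C \<longleftrightarrow> category C \<and>
     (\<forall>X\<in>ob C. \<forall>Y\<in>ob C. zer C X Y \<in> hom C X Y \<and>
        (\<forall>f\<in>hom C X Y. neg C f \<in> hom C X Y \<and> add C f (neg C f) = zer C X Y \<and>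
            add C (zer C X Y) f = f \<and>
            (\<forall>g\<in>hom C X Y. add C f g \<in> hom C X Y \<and> add C f g = add C g f \<and>
               (\<forall>h\<in>hom C X Y. add C (add C f g) h = add C f (add C g h))))) \<and>
     (\<forall>X\<in>ob C. \<forall>Y\<in>ob C. \<forall>Z\<in>ob C. \<forall>f g h.
          f \<in> hom C X Y \<and> g \<in> hom C X Y \<and> h \<in> hom C Y Z
          \<longrightarrow> cmp C h (add C f g) = add C (cmp C h f) (cmp C h g)) \<and>
     (\<forall>X\<in>ob C. \<forall>Y\<in>ob C. \<forall>Z\<in>ob C. \<forall>f g h.
          f \<in> hom C X Y \<and> g \<in> hom C Y Z \<and> h \<in> hom C Y Z
          \<longrightarrow> cmp C (add C g h) f = add C (cmp C g f) (cmp C h f)) \<and>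
     (\<exists>Z. zero_obj C Z) \<and>
     (\<forall>A\<in>ob C. \<forall>B\<in>ob C. \<exists>S i1 i2 p1 p2. is_biprod C A B S i1 i2 p1 p2)"

definition suspension_ok :: "('o,'m) tcat \<Rightarrow> bool" where
  "suspension_ok C \<longleftrightarrow>
     (\<forall>X\<in>ob C. sobj C X \<in> ob C \<and> smor C (idt C X) = idt C (sobj C X)) \<and>
     (\<forall>X\<in>ob C. \<forall>Y\<in>ob C. \<forall>f\<in>hom C X Y. smor C f \<in> hom C (sobj C X) (sobj C Y)) \<and>
     (\<forall>X\<in>ob C. \<forall>Y\<in>ob C. \<forall>Z\<in>ob C. \<forall>f g. f \<in> hom C X Y \<and> g \<in> hom C Y Z
          \<longrightarrow> smor C (cmp C g f) = cmp C (smor C g) (smor C f)) \<and>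
     (\<forall>X\<in>ob C. \<forall>Y\<in>ob C. \<forall>f\<in>hom C X Y. \<forall>g\<in>hom C X Y.
          smor C (add C f g) = add C (smor C f) (smor C g)) \<and>
     (\<forall>X\<in>ob C. \<forall>Y\<in>ob C. bij_betw (smor C) (hom C X Y) (hom C (sobj C X) (sobj C Y))) \<and>
     (\<forall>Y\<in>ob C. \<exists>X\<in>ob C. \<exists>f. iso_mor C (sobj C X) Y f)"

definition triangulated :: "('o,'m) tcat \<Rightarrow> bool" where
  "triangulated C \<longleftrightarrow> additive C \<and> suspension_ok C \<and>
     \<comment> \<open>triangles are well typed\<close>
     (\<forall>X Y Z f g h. (X,Y,Z,f,g,h) \<in> tri C \<longrightarrow>
        X \<in> ob C \<and> Y \<in> ob C \<and> Z \<in> ob C \<and>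
        f \<in> hom C X Y \<and> g \<in> hom C Y Z \<and> h \<in> hom C Z (sobj C X)) \<and>
     \<comment> \<open>TR1: closure under isomorphism of triangles\<close>
     (\<forall>X Y Z f g h X' Y' Z' f' g' h' a b c.
        (X,Y,Z,f,g,h) \<in> tri C \<and> X' \<in> ob C \<and> Y' \<in> ob C \<and> Z' \<in> ob C \<and>
        f' \<in> hom C X' Y' \<and> g' \<in> hom C Y' Z' \<and> h' \<in> hom C Z' (sobj C X') \<and>
        iso_mor C X X' a \<and> iso_mor C Y Y' b \<and> iso_mor C Z Z' c \<and>
        cmp C b f = cmp C f' a \<and> cmp C c g = cmp C g' b \<and>
        cmp C (smor C a) h = cmp C h' c
        \<longrightarrow> (X',Y',Z',f',g',h') \<in> tri C) \<and>
     \<comment> \<open>TR1: X -id-> X -> 0 -> Sigma X is exact\<close>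
     (\<forall>X\<in>ob C. \<forall>Z. zero_obj C Z \<longrightarrow>
        (X, X, Z, idt C X, zer C X Z, zer C Z (sobj C X)) \<in> tri C) \<and>
     \<comment> \<open>TR1: every morphism extends to an exact triangle\<close>
     (\<forall>X\<in>ob C. \<forall>Y\<in>ob C. \<forall>f\<in>hom C X Y. \<exists>Z g h. (X,Y,Z,f,g,h) \<in> tri C) \<and>
     \<comment> \<open>TR2: rotation\<close>
     (\<forall>X Y Z f g h. (X,Y,Z,f,g,h) \<in> tri C \<longleftrightarrow>
        (Y, Z, sobj C X, g, h, neg C (smor C f)) \<in> tri C) \<and>
     \<comment> \<open>TR3: completion of morphisms of triangles\<close>
     (\<forall>X Y Z f g h X' Y' Z' f' g' h' a b.
        (X,Y,Z,f,g,h) \<in> tri C \<and> (X',Y',Z',f',g',h') \<in> tri C \<and>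
        a \<in> hom C X X' \<and> b \<in> hom C Y Y' \<and> cmp C b f = cmp C f' a
        \<longrightarrow> (\<exists>c\<in>hom C Z Z'. cmp C c g = cmp C g' b \<and>
                 cmp C (smor C a) h = cmp C h' c)) \<and>
     \<comment> \<open>TR4: octahedral axiom\<close>
     (\<forall>X Y Z Z' X' Y' f g f1 f2 g1 g2 h1 h2.
        (X,Y,Z',f,f1,f2) \<in> tri C \<and> (Y,Z,X',g,g1,g2) \<in> tri C \<and>
        (X,Z,Y',cmp C g f,h1,h2) \<in> tri C
        \<longrightarrow> (\<exists>u v. (Z',Y',X',u,v,cmp C (smor C f1) g2) \<in> tri C \<and>
                cmp C u f1 = cmp C h1 g \<and> cmp C h2 u = f2 \<and>
                cmp C v h1 = g1 \<and> cmp C g2 v = cmp C (smor C f) h2))"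

text \<open>The commutative square with T -f-> U, T -g-> V, V -f'-> P, U -g'-> P is homotopy
cartesian if T -(f,-g)-> U+V -(g' f')-> P -> Sigma T is an exact triangle.\<close>
definition hcart :: "('o,'m) tcat \<Rightarrow> 'o \<Rightarrow> 'o \<Rightarrow> 'o \<Rightarrow> 'o \<Rightarrow> 'm \<Rightarrow> 'm \<Rightarrow> 'm \<Rightarrow> 'm \<Rightarrow> bool" where
  "hcart C T U V P f g f' g' \<longleftrightarrow>
     (\<exists>S i1 i2 p1 p2 h. is_biprod C U V S i1 i2 p1 p2 \<and>
        (T, S, P, add C (cmp C i1 f) (cmp C i2 (neg C g)),
                  add C (cmp C g' p1) (cmp C f' p2), h) \<in> tri C)"

definition biexact ::
  "('a,'b) tcat \<Rightarrow> ('c,'d) tcat \<Rightarrow> ('e,'f) tcat \<Rightarrow>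
   ('a \<Rightarrow> 'c \<Rightarrow> 'e) \<Rightarrow> ('b \<Rightarrow> 'd \<Rightarrow> 'f) \<Rightarrow>
   ('a \<Rightarrow> 'c \<Rightarrow> 'f) \<Rightarrow> ('a \<Rightarrow> 'c \<Rightarrow> 'f) \<Rightarrow> bool" where
  "biexact S T U Fo Fm th ze \<longleftrightarrow>
     \<comment> \<open>bifunctor\<close>
     (\<forall>X\<in>ob S. \<forall>X'\<in>ob T. Fo X X' \<in> ob U \<and>
         Fm (idt S X) (idt T X') = idt U (Fo X X')) \<and>
     (\<forall>X\<in>ob S. \<forall>Y\<in>ob S. \<forall>X'\<in>ob T. \<forall>Y'\<in>ob T. \<forall>f\<in>hom S X Y. \<forall>f'\<in>hom T X' Y'.
         Fm f f' \<in> hom U (Fo X X') (Fo Y Y')) \<and>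
     (\<forall>X\<in>ob S. \<forall>Y\<in>ob S. \<forall>Z\<in>ob S. \<forall>X'\<in>ob T. \<forall>Y'\<in>ob T. \<forall>Z'\<in>ob T. \<forall>f g f' g'.
         f \<in> hom S X Y \<and> g \<in> hom S Y Z \<and> f' \<in> hom T X' Y' \<and> g' \<in> hom T Y' Z'
         \<longrightarrow> Fm (cmp S g f) (cmp T g' f') = cmp U (Fm g g') (Fm f f')) \<and>
     \<comment> \<open>theta : F(Sigma -, -) -> Sigma F(-,-), natural isomorphism\<close>
     (\<forall>X\<in>ob S. \<forall>X'\<in>ob T. iso_mor U (Fo (sobj S X) X') (sobj U (Fo X X')) (th X X')) \<and>
     (\<forall>X\<in>ob S. \<forall>Y\<in>ob S. \<forall>X'\<in>ob T. \<forall>Y'\<in>ob T. \<forall>f\<in>hom S X Y. \<forall>f'\<in>hom T X' Y'.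
         cmp U (th Y Y') (Fm (smor S f) f') = cmp U (smor U (Fm f f')) (th X X')) \<and>
     \<comment> \<open>zeta : F(-, Sigma -) -> Sigma F(-,-), natural isomorphism\<close>
     (\<forall>X\<in>ob S. \<forall>X'\<in>ob T. iso_mor U (Fo X (sobj T X')) (sobj U (Fo X X')) (ze X X')) \<and>
     (\<forall>X\<in>ob S. \<forall>Y\<in>ob S. \<forall>X'\<in>ob T. \<forall>Y'\<in>ob T. \<forall>f\<in>hom S X Y. \<forall>f'\<in>hom T X' Y'.
         cmp U (ze Y Y') (Fm f (smor T f')) = cmp U (smor U (Fm f f')) (ze X X')) \<and>
     \<comment> \<open>F(X,-) with zeta(X,-) is exact\<close>
     (\<forall>X\<in>ob S. \<forall>A B C a b c. (A,B,C,a,b,c) \<in> tri T \<longrightarrow>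
        (Fo X A, Fo X B, Fo X C, Fm (idt S X) a, Fm (idt S X) b,
         cmp U (ze X A) (Fm (idt S X) c)) \<in> tri U) \<and>
     \<comment> \<open>F(-,X') with theta(-,X') is exact\<close>
     (\<forall>X'\<in>ob T. \<forall>A B C a b c. (A,B,C,a,b,c) \<in> tri S \<longrightarrow>
        (Fo A X', Fo B X', Fo C X', Fm a (idt T X'), Fm b (idt T X'),
         cmp U (th A X') (Fm c (idt T X'))) \<in> tri U) \<and>
     \<comment> \<open>(Sigma zeta) o theta = - (Sigma theta) o zeta on F(Sigma X, Sigma X')\<close>
     (\<forall>X\<in>ob S. \<forall>X'\<in>ob T.
        cmp U (smor U (ze X X')) (th X (sobj T X')) =
        neg U (cmp U (smor U (th X X')) (ze (sobj S X) X')))"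

definition strong_verdier ::
  "('a,'b) tcat \<Rightarrow> ('c,'d) tcat \<Rightarrow> ('e,'f) tcat \<Rightarrow>
   ('a \<Rightarrow> 'c \<Rightarrow> 'e) \<Rightarrow> ('b \<Rightarrow> 'd \<Rightarrow> 'f) \<Rightarrow>
   ('a \<Rightarrow> 'c \<Rightarrow> 'f) \<Rightarrow> ('a \<Rightarrow> 'c \<Rightarrow> 'f) \<Rightarrow> bool" where
  "strong_verdier S T U Fo Fm th ze \<longleftrightarrow>
   (\<forall>X Y Z f g h X' Y' Z' f' g' h'.
     (X,Y,Z,f,g,h) \<in> tri S \<and> (X',Y',Z',f',g',h') \<in> tri T \<longrightarrow>
     (\<exists>W j q i p j' q'. W \<in> ob U \<and>
       (Fo X Y', W, Fo Z X', j, q, cmp U (th X Y') (Fm h f')) \<in> tri U \<and>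
       (W, Fo Y Y', Fo Z Z', i, Fm g g', p) \<in> tri U \<and>
       (Fo Y X', W, Fo X Z', j', q', cmp U (ze Y X') (Fm f h')) \<in> tri U \<and>
       cmp U q' j = Fm (idt S X) g' \<and>
       cmp U i j = Fm f (idt T Y') \<and>
       cmp U i j' = Fm (idt S Y) f' \<and>
       cmp U q j' = Fm g (idt T X') \<and>
       cmp U (smor U q) p = cmp U (ze Z X') (Fm (idt S Z) h') \<and>
       cmp U (smor U q') p = cmp U (th X Z') (Fm h (idt T Z')) \<and>
       \<comment> \<open>(I)\<close>
       cmp U j' (Fm f (idt T X')) = cmp U j (Fm (idt S X) f') \<and>
       hcart U (Fo X X') (Fo Y X') (Fo X Y') W
             (Fm f (idt T X')) (Fm (idt S X) f') j j' \<and>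
       \<comment> \<open>(II)\<close>
       cmp U (Fm g (idt T Y')) i = cmp U (Fm (idt S Z) f') q \<and>
       hcart U W (Fo Y Y') (Fo Z X') (Fo Z Y')
             i q (Fm (idt S Z) f') (Fm g (idt T Y')) \<and>
       \<comment> \<open>(III)\<close>
       cmp U (Fm (idt S Y) g') i = cmp U (Fm f (idt T Z')) q' \<and>
       hcart U W (Fo Y Y') (Fo X Z') (Fo Y Z')
             i q' (Fm f (idt T Z')) (Fm (idt S Y) g') \<and>
       \<comment> \<open>(IV)\<close>
       cmp U p (Fm (idt S Z) g') = cmp U (smor U j) (cmp U (th X Y') (Fm h (idt T Y'))) \<and>
       hcart U (Fo Z Y') (Fo Z Z') (sobj U (Fo X Y')) (sobj U W)
             (Fm (idt S Z) g') (cmp U (th X Y') (Fm h (idt T Y'))) (smor U j) p \<and>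
       \<comment> \<open>(V)\<close>
       cmp U p (Fm g (idt T Z')) = cmp U (smor U j') (cmp U (ze Y X') (Fm (idt S Y) h')) \<and>
       hcart U (Fo Y Z') (Fo Z Z') (sobj U (Fo Y X')) (sobj U W)
             (Fm g (idt T Z')) (cmp U (ze Y X') (Fm (idt S Y) h')) (smor U j') p \<and>
       \<comment> \<open>(VI): anti-commutes, and is homotopy cartesian after negating the map Sigma q\<close>
       cmp U (smor U (cmp U (ze X X') (Fm (idt S X) h'))) (smor U q') =
         neg U (cmp U (smor U (cmp U (th X X') (Fm h (idt T X')))) (smor U q)) \<and>
       hcart U (sobj U W) (sobj U (Fo X Z')) (sobj U (Fo Z X')) (sobj U (sobj U (Fo X X')))
             (smor U q') (neg U (smor U q))
             (smor U (cmp U (th X X') (Fm h (idt T X'))))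
             (smor U (cmp U (ze X X') (Fm (idt S X) h')))))"

inductive_set thick1 :: "('o,'m) tcat \<Rightarrow> 'o \<Rightarrow> 'o set" for C :: "('o,'m) tcat" and X :: 'o where
  base: "X \<in> ob C \<Longrightarrow> X \<in> thick1 C X"
| susp: "Y \<in> thick1 C X \<Longrightarrow> sobj C Y \<in> thick1 C X"
| desusp: "Z \<in> ob C \<Longrightarrow> sobj C Z \<in> thick1 C X \<Longrightarrow> Z \<in> thick1 C X"
| zero: "zero_obj C Z \<Longrightarrow> Z \<in> thick1 C X"
| sum: "A \<in> thick1 C X \<Longrightarrow> B \<in> thick1 C X \<Longrightarrow> is_biprod C A B S i1 i2 p1 p2 \<Longrightarrow>
         S \<in> thick1 C X"
| retract: "Z \<in> ob C \<Longrightarrow> Y \<in> thick1 C X \<Longrightarrow> r \<in> hom C Y Z \<Longrightarrow> s \<in> hom C Z Y \<Longrightarrow>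
         cmp C r s = idt C Z \<Longrightarrow> Z \<in> thick1 C X"

fun thick :: "('o,'m) tcat \<Rightarrow> nat \<Rightarrow> 'o \<Rightarrow> 'o set" where
  "thick C 0 X = {Z. zero_obj C Z}"
| "thick C (Suc 0) X = thick1 C X"
| "thick C (Suc (Suc n)) X =
     {Y. Y \<in> ob C \<and> (\<exists>Yt S i1 i2 p1 p2 A B a b c.
            Yt \<in> ob C \<and> is_biprod C Y Yt S i1 i2 p1 p2 \<and>
            (A, S, B, a, b, c) \<in> tri C \<and>
            A \<in> thick1 C X \<and> B \<in> thick C (Suc n) X)}"

text \<open>level^X(Y) = inf of n with Y in thick^n(X); infinity if there is none.\<close>
definition level :: "('o,'m) tcat \<Rightarrow> 'o \<Rightarrow> 'o \<Rightarrow> enat" where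
  "level C X Y = (INF n \<in> {n. Y \<in> thick C n X}. enat n)"

end

theory Submission
  imports Defs
begin

text \<open>
  Up to retracts, \<open>Y\<close> starts a tower \<open>Y = Z\<^sub>0 \<rightarrow> Z\<^sub>1 \<rightarrow> \<dots> \<rightarrow> Z\<^sub>m = 0\<close> whose cones lie in
  \<open>thick\<^sup>1\<close>, and likewise \<open>Z'\<^sub>0 \<rightarrow> \<dots> \<rightarrow> Z'\<^sub>n = 0\<close> for \<open>Y'\<close>. The homotopy limits \<open>W\<^sub>k\<close> of the zigzags
  \<open>F(Z\<^sub>i, Z'\<^sub>j) \<rightarrow> F(Z\<^sub>i\<^sub>+\<^sub>1, Z'\<^sub>j) \<leftarrow> F(Z\<^sub>i\<^sub>+\<^sub>1, Z'\<^sub>j\<^sub>-\<^sub>1)\<close> with \<open>i + j = k\<close> form a tower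
  from \<open>W\<^sub>0 = F(Z\<^sub>0, Z'\<^sub>0)\<close> to \<open>W\<^sub>m\<^sub>+\<^sub>n\<^sub>-\<^sub>1 = 0\<close> whose cones are sums of objects \<open>F(A, A')\<close> with
  \<open>A, A'\<close> in \<open>thick\<^sup>1\<close>. They are built by induction on \<open>m\<close> as iterated homotopy pullbacks. Square (III)
  of the Verdier structure identifies the pullback of one square with the Verdier object, whose
  triangle with third vertex \<open>F(\<Sigma>A, A')\<close> controls the cone of one step; pasting of homotopy
  cartesian squares propagates this through the zigzag.
\<close>

section \<open>Arrows with source and target\<close>

text \<open>Homotopy limits in a triangulated category are not functorial, so the maps from
  \<open>W k\<close> to \<open>W (Suc k)\<close> cannot be read off from a map of zigzags. They are
  chosen stage by stage, together with their cones. The choices fit because homotopy cartesian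
  squares paste and parallel sides share a cone, both consequences of the octahedral axiom. The
  induction therefore has to remember only one face of each homotopy limit, its projection to the
  end of the zigzag, and how that face commutes with the steps. A second obstacle is that
  \<open>thick1\<close> is not closed under extensions, while a step of the new tower is a composite
  of two maps, whose cone is a priori only an extension of their cones. The cone projection of the
  first map factors through the second map, which splits this extension. The constant -1 is a count
  on diagonals: if \<open>i + j = m + n - 1\<close> and \<open>i < m\<close>, then
  \<open>j \<ge> n\<close>. So every vertex of that zigzag has a zero argument.\<close>

text \<open>The hom-sets of a \<open>tcat\<close> need not be disjoint. Recording source and target in the arrow makes
  the typing conditions of the category axioms ground equations, which the simplifier can discharge.\<close>

datatype ('o, 'm) arw = Arw (dm: 'o) (mr: 'm) (cd: 'o)

locale tricat =
  fixes C :: "('o, 'm) tcat"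
  assumes triang: "triangulated C"
begin

definition arr :: "('o, 'm) arw \<Rightarrow> bool" where
  "arr a \<longleftrightarrow> dm a \<in> ob C \<and> cd a \<in> ob C \<and> mr a \<in> hom C (dm a) (cd a)"

definition cp :: "('o, 'm) arw \<Rightarrow> ('o, 'm) arw \<Rightarrow> ('o, 'm) arw" (infixl "\<cdot>" 70) where
  "a \<cdot> b = Arw (dm b) (cmp C (mr a) (mr b)) (cd a)"

definition ad :: "('o, 'm) arw \<Rightarrow> ('o, 'm) arw \<Rightarrow> ('o, 'm) arw" (infixl "\<oplus>" 65) where
  "a \<oplus> b = Arw (dm a) (add C (mr a) (mr b)) (cd a)"

definition ng :: "('o, 'm) arw \<Rightarrow> ('o, 'm) arw" where
  "ng a = Arw (dm a) (neg C (mr a)) (cd a)"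

definition zr :: "'o \<Rightarrow> 'o \<Rightarrow> ('o, 'm) arw" where
  "zr X Y = Arw X (zer C X Y) Y"

definition one :: "'o \<Rightarrow> ('o, 'm) arw" where
  "one X = Arw X (idt C X) X"

definition sg :: "('o, 'm) arw \<Rightarrow> ('o, 'm) arw" where
  "sg a = Arw (sobj C (dm a)) (smor C (mr a)) (sobj C (cd a))"

definition exact :: "('o, 'm) arw \<Rightarrow> ('o, 'm) arw \<Rightarrow> ('o, 'm) arw \<Rightarrow> bool" where
  "exact f g h \<longleftrightarrow> (dm f, cd f, cd g, mr f, mr g, mr h) \<in> tri C \<and>
     dm g = cd f \<and> dm h = cd g \<and> cd h = sobj C (dm f)"

definition inverses :: "('o, 'm) arw \<Rightarrow> ('o, 'm) arw \<Rightarrow> bool" where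
  "inverses a b \<longleftrightarrow> arr a \<and> arr b \<and> dm b = cd a \<and> cd b = dm a \<and>
     b \<cdot> a = one (dm a) \<and> a \<cdot> b = one (cd a)"

lemma dm_cd_simps [simp]:
  "dm (a \<cdot> b) = dm b" "cd (a \<cdot> b) = cd a"
  "dm (a \<oplus> b) = dm a" "cd (a \<oplus> b) = cd a"
  "dm (ng a) = dm a" "cd (ng a) = cd a"
  "dm (zr X Y) = X" "cd (zr X Y) = Y"
  "dm (one X) = X" "cd (one X) = X"
  "dm (sg a) = sobj C (dm a)" "cd (sg a) = sobj C (cd a)"
  by (simp_all add: cp_def ad_def ng_def zr_def one_def sg_def)

lemma arw_eqI: "dm a = dm b \<Longrightarrow> cd a = cd b \<Longrightarrow> mr a = mr b \<Longrightarrow> a = b"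
  by (cases a; cases b) simp

lemma additiveC: "additive C" and suspC: "suspension_ok C"
  using triang by (simp_all add: triangulated_def)

lemma categoryC: "category C"
  using additiveC by (simp add: additive_def)

lemma arr_ob [simp]: "arr a \<Longrightarrow> dm a \<in> ob C" "arr a \<Longrightarrow> cd a \<in> ob C"
  by (simp_all add: arr_def)

lemma arr_mr: "arr a \<Longrightarrow> mr a \<in> hom C (dm a) (cd a)"
  unfolding arr_def by blast

lemma arr_Arw: "X \<in> ob C \<Longrightarrow> Y \<in> ob C \<Longrightarrow> f \<in> hom C X Y \<Longrightarrow> arr (Arw X f Y)"
  unfolding arr_def by simp

lemma sobj_ob [simp]: "X \<in> ob C \<Longrightarrow> sobj C X \<in> ob C"
  using suspC by (simp add: suspension_ok_def)

lemma arr_cp [simp]: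
  assumes "arr a" "arr b" "dm a = cd b" shows "arr (a \<cdot> b)"
proof -
  have "\<forall>X\<in>ob C. \<forall>Y\<in>ob C. \<forall>Z\<in>ob C. \<forall>f g. f \<in> hom C X Y \<and> g \<in> hom C Y Z
          \<longrightarrow> cmp C g f \<in> hom C X Z"
    using categoryC unfolding category_def by (elim conjE) assumption
  from this[rule_format, of "dm b" "cd b" "cd a" "mr b" "mr a"]
  show ?thesis using assms unfolding arr_def cp_def by simp
qed

lemma arr_one [simp]: "X \<in> ob C \<Longrightarrow> arr (one X)"
  using categoryC unfolding category_def arr_def one_def by simp

lemma cp_one [simp]:
  "arr a \<Longrightarrow> dm a = X \<Longrightarrow> a \<cdot> one X = a"
  "arr a \<Longrightarrow> cd a = X \<Longrightarrow> one X \<cdot> a = a"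
  using categoryC unfolding category_def arr_def cp_def one_def
  by (auto intro!: arw_eqI)

lemma cp_assoc [simp]:
  assumes "arr a" "arr b" "arr c" "dm a = cd b" "dm b = cd c"
  shows "a \<cdot> b \<cdot> c = a \<cdot> (b \<cdot> c)"
proof -
  have "\<forall>W\<in>ob C. \<forall>X\<in>ob C. \<forall>Y\<in>ob C. \<forall>Z\<in>ob C. \<forall>f g h.
          f \<in> hom C W X \<and> g \<in> hom C X Y \<and> h \<in> hom C Y Z
          \<longrightarrow> cmp C h (cmp C g f) = cmp C (cmp C h g) f"
    using categoryC unfolding category_def by (elim conjE) assumption
  from this[rule_format, of "dm c" "cd c" "cd b" "cd a" "mr c" "mr b" "mr a"]
  have "cmp C (mr a) (cmp C (mr b) (mr c)) = cmp C (cmp C (mr a) (mr b)) (mr c)"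
    using assms unfolding arr_def by simp
  then show ?thesis by (simp add: cp_def)
qed

lemma hom_group:
  "\<forall>X\<in>ob C. \<forall>Y\<in>ob C. zer C X Y \<in> hom C X Y \<and>
        (\<forall>f\<in>hom C X Y. neg C f \<in> hom C X Y \<and> add C f (neg C f) = zer C X Y \<and>
            add C (zer C X Y) f = f \<and>
            (\<forall>g\<in>hom C X Y. add C f g \<in> hom C X Y \<and> add C f g = add C g f \<and>
               (\<forall>h\<in>hom C X Y. add C (add C f g) h = add C f (add C g h))))"
  using additiveC unfolding additive_def by (elim conjE) assumption

lemma arr_zr [simp]: "X \<in> ob C \<Longrightarrow> Y \<in> ob C \<Longrightarrow> arr (zr X Y)"
  using hom_group unfolding arr_def zr_def by simp

lemma arr_ng [simp]: "arr a \<Longrightarrow> arr (ng a)"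
  using hom_group unfolding arr_def ng_def by simp

lemma arr_ad [simp]: "arr a \<Longrightarrow> arr b \<Longrightarrow> dm a = dm b \<Longrightarrow> cd a = cd b \<Longrightarrow> arr (a \<oplus> b)"
  using hom_group unfolding arr_def ad_def by simp

lemma ad_commute:
  assumes "arr a" "arr b" "dm a = dm b" "cd a = cd b" shows "a \<oplus> b = b \<oplus> a"
  using hom_group[THEN bspec, THEN bspec, THEN conjunct2, THEN bspec, of "dm a" "cd a" "mr a"] assms
  unfolding arr_def ad_def by simp

lemma ad_assoc [simp]:
  assumes "arr a" "arr b" "arr c" "dm a = dm b" "cd a = cd b" "dm b = dm c" "cd b = cd c"
  shows "a \<oplus> b \<oplus> c = a \<oplus> (b \<oplus> c)"
proof -
  have "add C (add C (mr a) (mr b)) (mr c) = add C (mr a) (add C (mr b) (mr c))"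
    using hom_group assms unfolding arr_def by metis
  then show ?thesis by (simp add: ad_def)
qed

lemma ad_left_commute:
  assumes "arr a" "arr b" "arr c" "dm a = dm b" "cd a = cd b" "dm b = dm c" "cd b = cd c"
  shows "a \<oplus> (b \<oplus> c) = b \<oplus> (a \<oplus> c)"
  using ad_assoc[of a b c] ad_assoc[of b a c] ad_commute[of a b] assms by simp

lemma ad_zr [simp]:
  "arr a \<Longrightarrow> dm a = X \<Longrightarrow> cd a = Y \<Longrightarrow> zr X Y \<oplus> a = a"
  "arr a \<Longrightarrow> dm a = X \<Longrightarrow> cd a = Y \<Longrightarrow> a \<oplus> zr X Y = a"
proof -
  show *: "zr X Y \<oplus> a = a" if "arr a" "dm a = X" "cd a = Y"
    using hom_group that unfolding arr_def ad_def zr_def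
    by (auto intro!: arw_eqI)
  show "a \<oplus> zr X Y = a" if "arr a" "dm a = X" "cd a = Y"
    using * ad_commute[of a "zr X Y"] that by auto
qed

lemma ad_ng [simp]:
  assumes "arr a"
  shows "a \<oplus> ng a = zr (dm a) (cd a)" "ng a \<oplus> a = zr (dm a) (cd a)"
proof -
  show *: "a \<oplus> ng a = zr (dm a) (cd a)"
    using hom_group assms unfolding arr_def ad_def zr_def ng_def by simp
  show "ng a \<oplus> a = zr (dm a) (cd a)"
    using * ad_commute[of a "ng a"] assms by simp
qed

lemma ad_ng_cancel [simp]:
  assumes "arr a" "arr b" "dm a = dm b" "cd a = cd b"
  shows "a \<oplus> (ng a \<oplus> b) = b" "ng a \<oplus> (a \<oplus> b) = b"
  using ad_assoc[of a "ng a" b] ad_assoc[of "ng a" a b] assms by simp_all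

lemma ad_cancel:
  assumes "arr a" "arr b" "arr c" "dm a = dm b" "cd a = cd b" "dm b = dm c" "cd b = cd c"
    "a \<oplus> b = a \<oplus> c"
  shows "b = c"
  by (metis ad_ng_cancel(2) assms)

lemma ng_unique:
  assumes "arr a" "arr b" "dm a = dm b" "cd a = cd b" "a \<oplus> b = zr (dm a) (cd a)"
  shows "b = ng a"
  by (rule ad_cancel[of a]) (use assms in simp_all)

lemma diff_zeroD:
  assumes "arr a" "arr b" "dm a = dm b" "cd a = cd b" "a \<oplus> ng b = zr (dm a) (cd a)"
  shows "a = b"
proof -
  have "ng b \<oplus> a = ng b \<oplus> b"
    using ad_commute[of "ng b" a] assms by simp
  then show ?thesis using assms by - (rule ad_cancel[of "ng b"], simp_all)
qed

lemma ng_ng [simp]: "arr a \<Longrightarrow> ng (ng a) = a"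
  by (rule ng_unique[symmetric]) simp_all

lemma ng_zr [simp]: "X \<in> ob C \<Longrightarrow> Y \<in> ob C \<Longrightarrow> ng (zr X Y) = zr X Y"
  by (rule ng_unique[symmetric]) simp_all

lemma ng_ad [simp]:
  assumes "arr a" "arr b" "dm a = dm b" "cd a = cd b"
  shows "ng (a \<oplus> b) = ng a \<oplus> ng b"
proof -
  have "b \<oplus> (ng a \<oplus> ng b) = ng a"
    using ad_left_commute[of b "ng a" "ng b"] assms by simp
  then show ?thesis using ng_unique[of "a \<oplus> b" "ng a \<oplus> ng b"] assms by simp
qed

lemma cp_ad [simp]:
  assumes "arr a" "arr b" "arr c" "dm a = cd b" "dm b = dm c" "cd b = cd c"
  shows "a \<cdot> (b \<oplus> c) = a \<cdot> b \<oplus> a \<cdot> c"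
proof -
  have "\<forall>X\<in>ob C. \<forall>Y\<in>ob C. \<forall>Z\<in>ob C. \<forall>f g h.
          f \<in> hom C X Y \<and> g \<in> hom C X Y \<and> h \<in> hom C Y Z
          \<longrightarrow> cmp C h (add C f g) = add C (cmp C h f) (cmp C h g)"
    using additiveC unfolding additive_def by (elim conjE) assumption
  from this[rule_format, of "dm b" "cd b" "cd a" "mr b" "mr c" "mr a"]
  have "cmp C (mr a) (add C (mr b) (mr c)) = add C (cmp C (mr a) (mr b)) (cmp C (mr a) (mr c))"
    using assms unfolding arr_def by simp
  then show ?thesis by (simp add: cp_def ad_def)
qed

lemma ad_cp [simp]:
  assumes "arr a" "arr b" "arr c" "dm a = dm b" "cd a = cd b" "dm b = cd c"
  shows "(a \<oplus> b) \<cdot> c = a \<cdot> c \<oplus> b \<cdot> c"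
proof -
  have "\<forall>X\<in>ob C. \<forall>Y\<in>ob C. \<forall>Z\<in>ob C. \<forall>f g h.
          f \<in> hom C X Y \<and> g \<in> hom C Y Z \<and> h \<in> hom C Y Z
          \<longrightarrow> cmp C (add C g h) f = add C (cmp C g f) (cmp C h f)"
    using additiveC unfolding additive_def by (elim conjE) assumption
  from this[rule_format, of "dm c" "cd c" "cd a" "mr c" "mr a" "mr b"]
  have "cmp C (add C (mr a) (mr b)) (mr c) = add C (cmp C (mr a) (mr c)) (cmp C (mr b) (mr c))"
    using assms unfolding arr_def by simp
  then show ?thesis by (simp add: cp_def ad_def)
qed

lemma cp_zr [simp]:
  assumes "arr a"
  shows "dm a = Y \<Longrightarrow> X \<in> ob C \<Longrightarrow> a \<cdot> zr X Y = zr X (cd a)"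
    and "cd a = Y \<Longrightarrow> X \<in> ob C \<Longrightarrow> zr Y X \<cdot> a = zr (dm a) X"
proof -
  show "a \<cdot> zr X Y = zr X (cd a)" if *: "dm a = Y" "X \<in> ob C"
  proof -
    have o: "Y \<in> ob C" using assms * by auto
    have "a \<cdot> zr X Y \<oplus> a \<cdot> zr X Y = a \<cdot> zr X Y \<oplus> zr X (cd a)"
      using cp_ad[of a "zr X Y" "zr X Y"] assms * o by simp
    then show ?thesis using assms * o by - (rule ad_cancel[of "a \<cdot> zr X Y"], simp_all)
  qed
  show "zr Y X \<cdot> a = zr (dm a) X" if *: "cd a = Y" "X \<in> ob C"
  proof -
    have o: "Y \<in> ob C" using assms * by auto
    have "zr Y X \<cdot> a \<oplus> zr Y X \<cdot> a = zr Y X \<cdot> a \<oplus> zr (dm a) X"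
      using ad_cp[of "zr Y X" "zr Y X" a] assms * o by simp
    then show ?thesis using assms * o by - (rule ad_cancel[of "zr Y X \<cdot> a"], simp_all)
  qed
qed

lemma cp_ng [simp]:
  assumes "arr a" "arr b" "dm a = cd b"
  shows "a \<cdot> ng b = ng (a \<cdot> b)" "ng a \<cdot> b = ng (a \<cdot> b)"
proof -
  have "a \<cdot> b \<oplus> a \<cdot> ng b = a \<cdot> (b \<oplus> ng b)"
    by (rule cp_ad[symmetric]) (simp_all add: assms)
  also have "\<dots> = zr (dm b) (cd a)" by (simp add: assms del: cp_ad)
  finally have "a \<cdot> b \<oplus> a \<cdot> ng b = zr (dm b) (cd a)" .
  then show "a \<cdot> ng b = ng (a \<cdot> b)" using assms by - (rule ng_unique, simp_all)
  have "a \<cdot> b \<oplus> ng a \<cdot> b = (a \<oplus> ng a) \<cdot> b"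
    by (rule ad_cp[symmetric]) (simp_all add: assms)
  also have "\<dots> = zr (dm b) (cd a)" by (simp add: assms del: ad_cp)
  finally have "a \<cdot> b \<oplus> ng a \<cdot> b = zr (dm b) (cd a)" .
  then show "ng a \<cdot> b = ng (a \<cdot> b)" using assms by - (rule ng_unique, simp_all)
qed

text \<open>Composites are normalised to the right, so a relation for two arrows must also be
  available in front of a further factor.\<close>

lemma cp_reduce:
  assumes "a \<cdot> b = c" "arr a" "arr b" "dm a = cd b" "arr x" "dm b = cd x"
  shows "a \<cdot> (b \<cdot> x) = c \<cdot> x"
  unfolding assms(1)[symmetric] by (rule cp_assoc[symmetric]) (simp_all add: assms)

section \<open>Suspension as an additive, fully faithful, essentially surjective functor\<close>

lemma susp_ob: "\<forall>X\<in>ob C. sobj C X \<in> ob C \<and> smor C (idt C X) = idt C (sobj C X)"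
  using suspC unfolding suspension_ok_def by (elim conjE) assumption

lemma susp_mor: "\<forall>X\<in>ob C. \<forall>Y\<in>ob C. \<forall>f\<in>hom C X Y. smor C f \<in> hom C (sobj C X) (sobj C Y)"
  using suspC unfolding suspension_ok_def by (elim conjE) assumption

lemma susp_add: "\<forall>X\<in>ob C. \<forall>Y\<in>ob C. \<forall>f\<in>hom C X Y. \<forall>g\<in>hom C X Y.
          smor C (add C f g) = add C (smor C f) (smor C g)"
  using suspC unfolding suspension_ok_def by (elim conjE) assumption

lemma susp_bij: "\<forall>X\<in>ob C. \<forall>Y\<in>ob C. bij_betw (smor C) (hom C X Y) (hom C (sobj C X) (sobj C Y))"
  using suspC unfolding suspension_ok_def by (elim conjE) assumption

lemma susp_ess_surj: "\<forall>Y\<in>ob C. \<exists>X\<in>ob C. \<exists>f. iso_mor C (sobj C X) Y f"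
  using suspC unfolding suspension_ok_def by (elim conjE) assumption

lemma arr_sg [simp]: "arr a \<Longrightarrow> arr (sg a)"
  using susp_mor unfolding arr_def sg_def by simp

lemma sg_one [simp]: "X \<in> ob C \<Longrightarrow> sg (one X) = one (sobj C X)"
  using susp_ob unfolding one_def sg_def by simp

lemma sg_cp [simp]:
  assumes "arr a" "arr b" "dm a = cd b" shows "sg (a \<cdot> b) = sg a \<cdot> sg b"
proof -
  have "\<forall>X\<in>ob C. \<forall>Y\<in>ob C. \<forall>Z\<in>ob C. \<forall>f g. f \<in> hom C X Y \<and> g \<in> hom C Y Z
          \<longrightarrow> smor C (cmp C g f) = cmp C (smor C g) (smor C f)"
    using suspC unfolding suspension_ok_def by (elim conjE) assumption
  from this[rule_format, of "dm b" "cd b" "cd a" "mr b" "mr a"]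
  have "smor C (cmp C (mr a) (mr b)) = cmp C (smor C (mr a)) (smor C (mr b))"
    using assms unfolding arr_def by simp
  then show ?thesis by (simp add: cp_def sg_def)
qed

lemma sg_ad [simp]:
  "arr a \<Longrightarrow> arr b \<Longrightarrow> dm a = dm b \<Longrightarrow> cd a = cd b \<Longrightarrow> sg (a \<oplus> b) = sg a \<oplus> sg b"
  using susp_add[rule_format, of "dm a" "cd a" "mr a" "mr b"] unfolding arr_def ad_def sg_def by simp

lemma sg_zr [simp]:
  assumes "X \<in> ob C" "Y \<in> ob C" shows "sg (zr X Y) = zr (sobj C X) (sobj C Y)"
proof -
  have "sg (zr X Y) \<oplus> sg (zr X Y) = sg (zr X Y \<oplus> zr X Y)"
    by (rule sg_ad[symmetric]) (simp_all add: assms)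
  also have "\<dots> = sg (zr X Y) \<oplus> zr (sobj C X) (sobj C Y)"
    by (simp add: assms del: sg_ad)
  finally have "sg (zr X Y) \<oplus> sg (zr X Y) = sg (zr X Y) \<oplus> zr (sobj C X) (sobj C Y)" .
  then show ?thesis using assms by - (rule ad_cancel[of "sg (zr X Y)"], simp_all)
qed

lemma sg_ng [simp]:
  assumes "arr a" shows "sg (ng a) = ng (sg a)"
proof (rule ng_unique)
  have "sg a \<oplus> sg (ng a) = sg (a \<oplus> ng a)"
    by (rule sg_ad[symmetric]) (simp_all add: assms)
  then show "sg a \<oplus> sg (ng a) = zr (dm (sg a)) (cd (sg a))"
    using sg_zr[of "dm a" "cd a"] assms by simp
qed (simp_all add: assms)

lemma sg_inj:
  assumes "sg a = sg b" "arr a" "arr b" "dm a = dm b" "cd a = cd b"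
  shows "a = b"
proof -
  have "inj_on (smor C) (hom C (dm a) (cd a))"
    using susp_bij assms unfolding bij_betw_def by simp
  then show ?thesis
    using assms unfolding arr_def sg_def by (intro arw_eqI) (auto dest: inj_onD)
qed

lemma sg_surj:
  assumes "arr b" "dm b = sobj C X" "cd b = sobj C Y" "X \<in> ob C" "Y \<in> ob C"
  obtains a where "arr a" "dm a = X" "cd a = Y" "b = sg a"
proof -
  have "smor C ` hom C X Y = hom C (sobj C X) (sobj C Y)"
    using susp_bij assms unfolding bij_betw_def by simp
  then obtain f where "f \<in> hom C X Y" "mr b = smor C f"
    using assms unfolding arr_def by (metis image_iff)
  moreover from this have "b = sg (Arw X f Y)"
    using assms by (intro arw_eqI) (simp_all add: sg_def)
  ultimately show ?thesis
    using assms(4,5) by (intro that[of "Arw X f Y"]) (simp_all add: arr_Arw)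
qed

section \<open>Zero objects and isomorphisms\<close>

lemma zero_obj_ex: "\<exists>Z. zero_obj C Z"
  using additiveC unfolding additive_def by (elim conjE) assumption

lemma zero_obj_ob [simp]: "zero_obj C Z \<Longrightarrow> Z \<in> ob C"
  by (simp add: zero_obj_def)

lemma zero_obj_arr:
  assumes Z: "zero_obj C Z" and a: "arr a"
  shows "dm a = Z \<Longrightarrow> a = zr Z (cd a)" "cd a = Z \<Longrightarrow> a = zr (dm a) Z"
proof -
  show "a = zr Z (cd a)" if *: "dm a = Z"
  proof -
    have "\<exists>!f. f \<in> hom C Z (cd a)" 
      by (rule Z[unfolded zero_obj_def, THEN conjunct2, THEN bspec, OF arr_ob(2)[OF a], THEN conjunct1])
    moreover have "mr a \<in> hom C Z (cd a)" "mr (zr Z (cd a)) \<in> hom C Z (cd a)"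
      using arr_mr[OF a] arr_mr[OF arr_zr, of Z "cd a"] * Z a by simp_all
    ultimately have "mr a = mr (zr Z (cd a))" by blast
    then show ?thesis using * by (intro arw_eqI) simp_all
  qed
  show "a = zr (dm a) Z" if *: "cd a = Z"
  proof -
    have "\<exists>!f. f \<in> hom C (dm a) Z" 
      by (rule Z[unfolded zero_obj_def, THEN conjunct2, THEN bspec, OF arr_ob(1)[OF a], THEN conjunct2])
    moreover have "mr a \<in> hom C (dm a) Z" "mr (zr (dm a) Z) \<in> hom C (dm a) Z"
      using arr_mr[OF a] arr_mr[OF arr_zr, of "dm a" Z] * Z a by simp_all
    ultimately have "mr a = mr (zr (dm a) Z)" by blast
    then show ?thesis using * by (intro arw_eqI) simp_all
  qed
qed

lemma zero_objI:
  assumes Z: "Z \<in> ob C" and "one Z = zr Z Z" shows "zero_obj C Z"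
proof -
  have 1: "a = zr Z (cd a)" if "arr a" "dm a = Z" for a
    using cp_one(1)[OF that] cp_zr(1)[of a Z Z] that assms by metis
  have 2: "a = zr (dm a) Z" if "arr a" "cd a = Z" for a
    using cp_one(2)[OF that] cp_zr(2)[of a Z Z] that assms by metis
  show ?thesis unfolding zero_obj_def
  proof (intro conjI ballI)
    fix Y assume Y: "Y \<in> ob C"
    show "\<exists>!f. f \<in> hom C Z Y"
    proof (rule ex1I)
      show "mr (zr Z Y) \<in> hom C Z Y" using arr_mr[OF arr_zr[OF Z Y]] by simp
      fix f assume "f \<in> hom C Z Y"
      then have "Arw Z f Y = zr Z Y" using 1[of "Arw Z f Y"] Y Z by (simp add: arr_Arw)
      then show "f = mr (zr Z Y)" by (metis arw.sel(2))
    qed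
    show "\<exists>!f. f \<in> hom C Y Z"
    proof (rule ex1I)
      show "mr (zr Y Z) \<in> hom C Y Z" using arr_mr[OF arr_zr[OF Y Z]] by simp
      fix f assume "f \<in> hom C Y Z"
      then have "Arw Y f Z = zr Y Z" using 2[of "Arw Y f Z"] Y Z by (simp add: arr_Arw)
      then show "f = mr (zr Y Z)" by (metis arw.sel(2))
    qed
  qed (rule Z)
qed

lemma zero_obj_one: "zero_obj C Z \<Longrightarrow> one Z = zr Z Z"
  using zero_obj_arr(1)[of Z "one Z"] by simp

lemma zero_obj_sobj: "zero_obj C Z \<Longrightarrow> zero_obj C (sobj C Z)"
  by (metis zero_objI zero_obj_one sg_one sg_zr zero_obj_ob sobj_ob)

lemma inverses_iso_mor:
  "inverses a b \<Longrightarrow> iso_mor C (dm a) (cd a) (mr a)"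
  unfolding inverses_def iso_mor_def arr_def cp_def one_def by auto

lemma inverses_sym: "inverses a b \<Longrightarrow> inverses b a"
  by (auto simp: inverses_def)

lemma iso_mor_inverses:
  assumes "iso_mor C X Y f" "X \<in> ob C" "Y \<in> ob C"
  obtains b where "inverses (Arw X f Y) b"
proof -
  obtain g where "g \<in> hom C Y X" "cmp C g f = idt C X" "cmp C f g = idt C Y" "f \<in> hom C X Y"
    using assms unfolding iso_mor_def by blast
  then show ?thesis
    using that[of "Arw Y g X"] assms by (simp add: inverses_def arr_Arw cp_def one_def)
qed

lemma sobj_essentially_surj:
  assumes "Y \<in> ob C"
  obtains X a b where "X \<in> ob C" "inverses a b" "dm a = sobj C X" "cd a = Y"
proof -
  obtain X f where *: "X \<in> ob C" "iso_mor C (sobj C X) Y f"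
    using susp_ess_surj assms by blast
  obtain b where "inverses (Arw (sobj C X) f Y) b"
    using iso_mor_inverses[OF *(2)] * assms by auto
  then show ?thesis using that[of X "Arw (sobj C X) f Y" b] * by simp
qed


section \<open>Exact triangles\<close>

lemma exactD:
  assumes "exact f g h"
  shows "arr f" "arr g" "arr h" "dm g = cd f" "dm h = cd g" "cd h = sobj C (dm f)"
proof -
  have "\<forall>X Y Z f g h. (X,Y,Z,f,g,h) \<in> tri C \<longrightarrow>
        X \<in> ob C \<and> Y \<in> ob C \<and> Z \<in> ob C \<and>
        f \<in> hom C X Y \<and> g \<in> hom C Y Z \<and> h \<in> hom C Z (sobj C X)"
    using triang unfolding triangulated_def by (elim conjE) assumption
  from this[rule_format, of "dm f" "cd f" "cd g" "mr f" "mr g" "mr h"]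
  show "arr f" "arr g" "arr h" "dm g = cd f" "dm h = cd g" "cd h = sobj C (dm f)"
    using assms unfolding exact_def arr_def by auto
qed

lemma mr_simps: "mr (a \<cdot> b) = cmp C (mr a) (mr b)" "mr (zr X Y) = zer C X Y" "mr (one X) = idt C X"
  "mr (ng a) = neg C (mr a)" "mr (sg a) = smor C (mr a)" "mr (a \<oplus> b) = add C (mr a) (mr b)"
  by (simp_all add: cp_def zr_def one_def ng_def sg_def ad_def)

lemma exact_iso:
  assumes e: "exact f g h" and i: "inverses a a'" "inverses b b'" "inverses c c'"
    and d: "dm a = dm f" "dm b = cd f" "dm c = cd g"
    and r: "arr f'" "arr g'" "arr h'"
    and t: "dm f' = cd a" "cd f' = cd b" "dm g' = cd b" "cd g' = cd c" "dm h' = cd c"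
      "cd h' = sobj C (cd a)"
    and q: "b \<cdot> f = f' \<cdot> a" "c \<cdot> g = g' \<cdot> b" "sg a \<cdot> h = h' \<cdot> c"
  shows "exact f' g' h'"
proof -
  have *: "\<forall>X Y Z f g h X' Y' Z' f' g' h' a b c.
        (X,Y,Z,f,g,h) \<in> tri C \<and> X' \<in> ob C \<and> Y' \<in> ob C \<and> Z' \<in> ob C \<and>
        f' \<in> hom C X' Y' \<and> g' \<in> hom C Y' Z' \<and> h' \<in> hom C Z' (sobj C X') \<and>
        iso_mor C X X' a \<and> iso_mor C Y Y' b \<and> iso_mor C Z Z' c \<and>
        cmp C b f = cmp C f' a \<and> cmp C c g = cmp C g' b \<and>
        cmp C (smor C a) h = cmp C h' c
        \<longrightarrow> (X',Y',Z',f',g',h') \<in> tri C"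
    using triang unfolding triangulated_def by (elim conjE) assumption
  have "(dm f', cd f', cd g', mr f', mr g', mr h') \<in> tri C"
  proof (rule *[rule_format, of "dm f" "cd f" "cd g" "mr f" "mr g" "mr h" _ _ _ _ _ _ "mr a" "mr b" "mr c"],
         intro conjI)
    show "(dm f, cd f, cd g, mr f, mr g, mr h) \<in> tri C" using e by (simp add: exact_def)
    show "iso_mor C (dm f) (dm f') (mr a)" "iso_mor C (cd f) (cd f') (mr b)"
      "iso_mor C (cd g) (cd g') (mr c)"
      using i[THEN inverses_iso_mor] d t by simp_all
    show "cmp C (mr b) (mr f) = cmp C (mr f') (mr a)" "cmp C (mr c) (mr g) = cmp C (mr g') (mr b)"
      "cmp C (smor C (mr a)) (mr h) = cmp C (mr h') (mr c)"
      using q[THEN arg_cong[of _ _ mr]] by (simp_all add: mr_simps)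
    show "mr f' \<in> hom C (dm f') (cd f')" "mr g' \<in> hom C (cd f') (cd g')"
      "mr h' \<in> hom C (cd g') (sobj C (dm f'))"
      using r[THEN arr_mr] t by simp_all
  qed (simp_all add: r)
  then show ?thesis using t by (simp add: exact_def)
qed

lemma exact_triv:
  assumes "X \<in> ob C" "zero_obj C Z"
  shows "exact (one X) (zr X Z) (zr Z (sobj C X))"
proof -
  have "\<forall>X\<in>ob C. \<forall>Z. zero_obj C Z \<longrightarrow>
        (X, X, Z, idt C X, zer C X Z, zer C Z (sobj C X)) \<in> tri C"
    using triang unfolding triangulated_def by (elim conjE) assumption
  then show ?thesis using assms by (simp add: exact_def mr_simps)
qed

lemma exact_ex:
  assumes "arr f" obtains g h where "exact f g h"
proof -
  have "\<forall>X\<in>ob C. \<forall>Y\<in>ob C. \<forall>f\<in>hom C X Y. \<exists>Z g h. (X,Y,Z,f,g,h) \<in> tri C"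
    using triang unfolding triangulated_def by (elim conjE) assumption
  from this[rule_format, OF arr_ob[OF assms] arr_mr[OF assms]]
  obtain Z g h where "(dm f,cd f,Z,mr f,g,h) \<in> tri C" by blast
  then show ?thesis
    using that[of "Arw (cd f) g Z" "Arw Z h (sobj C (dm f))"] by (simp add: exact_def)
qed

lemma TR2:
  "(X,Y,Z,f,g,h) \<in> tri C \<longleftrightarrow> (Y, Z, sobj C X, g, h, neg C (smor C f)) \<in> tri C"
proof -
  have "\<forall>X Y Z f g h. (X,Y,Z,f,g,h) \<in> tri C \<longleftrightarrow>
        (Y, Z, sobj C X, g, h, neg C (smor C f)) \<in> tri C"
    using triang unfolding triangulated_def by (elim conjE) assumption
  then show ?thesis by blast
qed

lemma exact_rot: "exact f g h \<Longrightarrow> exact g h (ng (sg f))"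
  unfolding exact_def using TR2[of "dm f" "cd f" "cd g" "mr f" "mr g" "mr h"] by (simp add: mr_simps)

lemma exact_unrot:
  assumes "exact g h (ng (sg f))" "cd f = dm g" "cd h = sobj C (dm f)"
  shows "exact f g h"
  using assms TR2[of "dm f" "cd f" "cd g" "mr f" "mr g" "mr h"]
  unfolding exact_def by (simp add: mr_simps)

lemma exact_fill:
  assumes e: "exact f g h" "exact f' g' h'" and r: "arr a" "arr b"
    and t: "dm a = dm f" "cd a = dm f'" "dm b = cd f" "cd b = cd f'" and q: "b \<cdot> f = f' \<cdot> a"
  obtains c where "arr c" "dm c = cd g" "cd c = cd g'" "c \<cdot> g = g' \<cdot> b" "sg a \<cdot> h = h' \<cdot> c"
proof -
  have *: "\<forall>X Y Z f g h X' Y' Z' f' g' h' a b.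
        (X,Y,Z,f,g,h) \<in> tri C \<and> (X',Y',Z',f',g',h') \<in> tri C \<and>
        a \<in> hom C X X' \<and> b \<in> hom C Y Y' \<and> cmp C b f = cmp C f' a
        \<longrightarrow> (\<exists>c\<in>hom C Z Z'. cmp C c g = cmp C g' b \<and>
                 cmp C (smor C a) h = cmp C h' c)"
    using triang unfolding triangulated_def by (elim conjE) assumption
  have "\<exists>c\<in>hom C (cd g) (cd g'). cmp C c (mr g) = cmp C (mr g') (mr b) \<and>
                 cmp C (smor C (mr a)) (mr h) = cmp C (mr h') c"
    using *[rule_format, of "dm f" "cd f" "cd g" "mr f" "mr g" "mr h" "dm f'" "cd f'" "cd g'"
        "mr f'" "mr g'" "mr h'" "mr a" "mr b"] e q[THEN arg_cong[of _ _ mr]] r[THEN arr_mr] t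
    by (simp add: exact_def mr_simps)
  then obtain c where c: "c \<in> hom C (cd g) (cd g')" "cmp C c (mr g) = cmp C (mr g') (mr b)"
    "cmp C (smor C (mr a)) (mr h) = cmp C (mr h') c" by blast
  note d = exactD[OF e(1)] exactD[OF e(2)]
  show ?thesis
    by (rule that[of "Arw (cd g) c (cd g')"]; (intro arw_eqI arr_Arw)?)
      (use c t d in \<open>simp_all add: mr_simps\<close>)
qed

lemma octahedral:
  assumes e: "exact f f1 f2" "exact g g1 g2" "exact (g \<cdot> f) h1 h2" and t: "dm g = cd f"
  obtains u v where "exact u v (sg f1 \<cdot> g2)" "dm u = cd f1" "cd u = cd h1" "cd v = cd g1"
    "u \<cdot> f1 = h1 \<cdot> g" "h2 \<cdot> u = f2" "v \<cdot> h1 = g1" "g2 \<cdot> v = sg f \<cdot> h2"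
proof -
  have *: "\<forall>X Y Z Z' X' Y' f g f1 f2 g1 g2 h1 h2.
        (X,Y,Z',f,f1,f2) \<in> tri C \<and> (Y,Z,X',g,g1,g2) \<in> tri C \<and>
        (X,Z,Y',cmp C g f,h1,h2) \<in> tri C
        \<longrightarrow> (\<exists>u v. (Z',Y',X',u,v,cmp C (smor C f1) g2) \<in> tri C \<and>
                cmp C u f1 = cmp C h1 g \<and> cmp C h2 u = f2 \<and>
                cmp C v h1 = g1 \<and> cmp C g2 v = cmp C (smor C f) h2)"
    using triang unfolding triangulated_def by (elim conjE) assumption
  obtain u v where uv: "(cd f1, cd h1, cd g1, u, v, cmp C (smor C (mr f1)) (mr g2)) \<in> tri C"
    "cmp C u (mr f1) = cmp C (mr h1) (mr g)" "cmp C (mr h2) u = mr f2"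
    "cmp C v (mr h1) = mr g1" "cmp C (mr g2) v = cmp C (smor C (mr f)) (mr h2)"
    using *[rule_format, of "dm f" "cd f" "cd f1" "mr f" "mr f1" "mr f2"
       "cd g" "cd g1" "mr g" "mr g1" "mr g2" "cd h1" "mr h1" "mr h2"] e t
    by (auto simp add: exact_def mr_simps)
  note d = exactD[OF e(1)] exactD[OF e(2)] exactD[OF e(3)]
  show ?thesis
    by (rule that[of "Arw (cd f1) u (cd h1)" "Arw (cd h1) v (cd g1)"]; (intro arw_eqI)?)
      (use uv t d in \<open>simp_all add: mr_simps exact_def\<close>)
qed

text \<open>Comparison with the triangle on \<open>one (dm f)\<close>, whose third object is zero,
  makes \<open>g \<cdot> f\<close> factor through zero. The other two composites are the same fact
  for the rotated triangles.\<close>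

lemma exact_comp0:
  assumes e: "exact f g h"
  shows "g \<cdot> f = zr (dm f) (cd g)" "h \<cdot> g = zr (dm g) (cd h)" "sg f \<cdot> h = zr (dm h) (sobj C (cd f))"
proof -
  have 1: "g \<cdot> f = zr (dm f) (cd g)" if e: "exact f g h" for f g h
  proof -
    note d = exactD[OF e]
    obtain Z where Z: "zero_obj C Z" using zero_obj_ex by blast
    obtain c where c: "arr c" "dm c = Z" "cd c = cd g" "c \<cdot> zr (dm f) Z = g \<cdot> f"
      using exact_fill[OF exact_triv[OF _ Z] e, of "dm f" "one (dm f)" f] d by auto
    then show ?thesis using d by auto
  qed
  note d = exactD[OF e]
  show "g \<cdot> f = zr (dm f) (cd g)" by (rule 1[OF e])
  show "h \<cdot> g = zr (dm g) (cd h)" by (rule 1[OF exact_rot[OF e]])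
  have "ng (sg f \<cdot> h) = zr (dm h) (sobj C (cd f))"
    using 1[OF exact_rot[OF exact_rot[OF e]]] d by simp
  then have "ng (ng (sg f \<cdot> h)) = ng (zr (dm h) (sobj C (cd f)))" by simp
  then show "sg f \<cdot> h = zr (dm h) (sobj C (cd f))" using d by simp
qed

text \<open>Exactness of covariant hom functors. The rotated trivial triangle on \<open>dm u\<close>
  maps to the rotated given triangle, and the filler desuspends because the suspension is full and
  faithful.\<close>

lemma exact_lift:
  assumes e: "exact f g h" and u: "arr u" "cd u = cd f" "g \<cdot> u = zr (dm u) (cd g)"
  obtains v where "arr v" "dm v = dm u" "cd v = dm f" "f \<cdot> v = u"
proof -
  note d = exactD[OF e]
  obtain Z where Z: "zero_obj C Z" using zero_obj_ex by blast
  have t: "exact (zr (dm u) Z) (zr Z (sobj C (dm u))) (ng (sg (one (dm u))))"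
    using exact_rot[OF exact_triv[OF _ Z]] u by auto
  obtain c where c: "arr c" "dm c = sobj C (dm u)" "cd c = sobj C (dm f)"
      "sg u \<cdot> ng (sg (one (dm u))) = ng (sg f) \<cdot> c"
    using exact_fill[OF t exact_rot[OF e], of u "zr Z (cd g)"] d u Z by auto
  obtain v where v: "arr v" "dm v = dm u" "cd v = dm f" "c = sg v"
    using sg_surj[OF c(1-3)] d u by auto
  have "ng (sg u) = ng (sg (f \<cdot> v))" using c v u d by simp
  then have "ng (ng (sg u)) = ng (ng (sg (f \<cdot> v)))" by simp
  then have "sg (f \<cdot> v) = sg u" using u v d by (simp del: sg_cp)
  then have "f \<cdot> v = u" using u v d by (auto intro: sg_inj)
  then show ?thesis using that v by blast
qed

lemma exact_colift:
  assumes e: "exact f g h" and u: "arr u" "dm u = cd f" "u \<cdot> f = zr (dm f) (cd u)"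
  obtains v where "arr v" "dm v = cd g" "cd v = cd u" "v \<cdot> g = u"
proof -
  note d = exactD[OF e]
  obtain Z where Z: "zero_obj C Z" using zero_obj_ex by blast
  let ?A = "cd u"
  have "exact (one ?A) (zr ?A (sobj C Z)) (zr (sobj C Z) (sobj C ?A))"
    using exact_triv[OF _ zero_obj_sobj[OF Z]] u by auto
  then have t: "exact (zr Z ?A) (one ?A) (zr ?A (sobj C Z))"
    using u Z by - (rule exact_unrot, simp_all)
  obtain c where "arr c" "dm c = cd g" "cd c = ?A" "c \<cdot> g = one ?A \<cdot> u"
    using exact_fill[OF e t, of "zr (dm f) Z" u] d u Z by auto
  then show ?thesis using that[of c] u by auto
qed

text \<open>TR3 supplies only the third component of a map of triangles. The other positions follow
  by rotating, filling and desuspending.\<close>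

lemma exact_fill_first:
  assumes e: "exact f g h" "exact f' g' h'" and r: "arr b" "arr c"
    and t: "dm b = cd f" "cd b = cd f'" "dm c = cd g" "cd c = cd g'" and q: "c \<cdot> g = g' \<cdot> b"
  obtains a where "arr a" "dm a = dm f" "cd a = dm f'" "b \<cdot> f = f' \<cdot> a" "sg a \<cdot> h = h' \<cdot> c"
proof -
  note d = exactD[OF e(1)] exactD[OF e(2)]
  obtain x where x: "arr x" "dm x = sobj C (dm f)" "cd x = sobj C (dm f')" "x \<cdot> h = h' \<cdot> c"
     "sg b \<cdot> ng (sg f) = ng (sg f') \<cdot> x"
    using exact_fill[OF exact_rot[OF e(1)] exact_rot[OF e(2)], of b c] d r t q by auto
  obtain a where a: "arr a" "dm a = dm f" "cd a = dm f'" "x = sg a"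
    using sg_surj[OF x(1-3)] d by auto
  have "ng (sg (b \<cdot> f)) = ng (sg (f' \<cdot> a))" using x a r t d by simp
  then have "ng (ng (sg (b \<cdot> f))) = ng (ng (sg (f' \<cdot> a)))" by simp
  then have "sg (b \<cdot> f) = sg (f' \<cdot> a)" using r t d a by (simp del: sg_cp)
  then have "b \<cdot> f = f' \<cdot> a" using r t d a by (auto intro: sg_inj)
  then show ?thesis using that[of a] a x by simp
qed

lemma exact_fill_middle:
  assumes e: "exact f g h" "exact f' g' h'" and r: "arr a" "arr c"
    and t: "dm a = dm f" "cd a = dm f'" "dm c = cd g" "cd c = cd g'" and q: "sg a \<cdot> h = h' \<cdot> c"
  obtains b where "arr b" "dm b = cd f" "cd b = cd f'" "b \<cdot> f = f' \<cdot> a" "c \<cdot> g = g' \<cdot> b"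
proof -
  note d = exactD[OF e(1)] exactD[OF e(2)]
  obtain b where b: "arr b" "dm b = cd f" "cd b = cd f'" "c \<cdot> g = g' \<cdot> b"
    "sg b \<cdot> ng (sg f) = ng (sg f') \<cdot> sg a"
    using exact_fill_first[OF exact_rot[OF e(1)] exact_rot[OF e(2)], of c "sg a"] d r t q by auto
  have "ng (sg (b \<cdot> f)) = ng (sg (f' \<cdot> a))" using b r t d by simp
  then have "ng (ng (sg (b \<cdot> f))) = ng (ng (sg (f' \<cdot> a)))" by simp
  then have "sg (b \<cdot> f) = sg (f' \<cdot> a)" using r t d b by (simp del: sg_cp)
  then have "b \<cdot> f = f' \<cdot> a" using r t d b by (auto intro: sg_inj)
  then show ?thesis using that[of b] b by simp
qed


text \<open>The difference \<open>?n\<close> of \<open>b\<close> and the identity vanishes on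
  \<open>f\<close> and is killed by \<open>g\<close>, so it factors both through \<open>g\<close>
  and through \<open>f\<close>. Its square contains \<open>g \<cdot> f = 0\<close>, and 1 - n
  inverts 1 + n. This takes the place of the five lemma: a filler is shown to be invertible by
  finding a filler in the other direction and inspecting the two composites.\<close>

lemma exact_endo_iso:
  assumes e: "exact f g h" and b: "arr b" "dm b = cd f" "cd b = cd f" "b \<cdot> f = f" "g \<cdot> b = g"
  obtains b' where "inverses b b'"
proof -
  note d = exactD[OF e]
  let ?n = "b \<oplus> ng (one (cd f))"
  have n: "arr ?n" "dm ?n = cd f" "cd ?n = cd f" using b d by simp_all
  have "g \<cdot> ?n = zr (dm ?n) (cd g)" "?n \<cdot> f = zr (dm f) (cd ?n)" using b d by simp_all
  then obtain x y where x: "arr x" "dm x = cd f" "cd x = dm f" "f \<cdot> x = ?n"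
    and y: "arr y" "dm y = cd g" "cd y = cd f" "y \<cdot> g = ?n"
    using exact_lift[OF e n(1,3)] exact_colift[OF e n(1,2)] n(2,3) by metis
  have "?n \<cdot> ?n = y \<cdot> g \<cdot> (f \<cdot> x)" using x(4) y(4) by simp
  also have "\<dots> = y \<cdot> (g \<cdot> f \<cdot> x)" using x(1-3) y(1-3) d by simp
  also have "\<dots> = zr (cd f) (cd f)" using x(1-3) y(1-3) d unfolding exact_comp0(1)[OF e] by simp
  finally have nn: "?n \<cdot> ?n = zr (cd f) (cd f)" .
  have bn: "b = one (cd f) \<oplus> ?n"
    using b d ad_left_commute[of "one (cd f)" b "ng (one (cd f))"] by simp
  define m where "m = ?n"
  have m: "arr m" "dm m = cd f" "cd m = cd f" "m \<cdot> m = zr (cd f) (cd f)" "b = one (cd f) \<oplus> m"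
    using n nn bn by (simp_all add: m_def)
  let ?c = "one (cd f) \<oplus> ng m"
  have "inverses b ?c" unfolding inverses_def
    using m(1-4) d unfolding m(5) by (simp add: ad_commute[of "ng m" m])
  then show ?thesis by (rule that)
qed

lemma inverses_of_composites:
  assumes a: "arr a" "arr b" "dm b = cd a" "cd b = dm a"
    and i: "inverses (b \<cdot> a) x" "inverses (a \<cdot> b) y"
  obtains a' where "inverses a a'"
proof -
  have x: "arr x" "dm x = dm a" "cd x = dm a" "x \<cdot> (b \<cdot> a) = one (dm a)"
    and y: "arr y" "dm y = cd a" "cd y = cd a" "a \<cdot> b \<cdot> y = one (cd a)"
    using i a by (simp_all add: inverses_def)
  have "x \<cdot> b = x \<cdot> b \<cdot> (a \<cdot> b \<cdot> y)" using x(1-3) y a by simp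
  also have "\<dots> = x \<cdot> (b \<cdot> a) \<cdot> (b \<cdot> y)" using x(1-3) y(1-3) a by simp
  also have "\<dots> = b \<cdot> y" unfolding x(4) using y(1-3) a by simp
  finally have "x \<cdot> b = b \<cdot> y" .
  then have "a \<cdot> (x \<cdot> b) = one (cd a)" using y a by simp
  then have "inverses a (x \<cdot> b)"
    unfolding inverses_def using x a by simp
  then show ?thesis by (rule that)
qed

lemma cone_unique:
  assumes e: "exact f g h" "exact f g' h'"
  obtains c c' where "inverses c c'" "dm c = cd g" "cd c = cd g'" "c \<cdot> g = g'" "h' \<cdot> c = h"
proof -
  note d = exactD[OF e(1)] exactD[OF e(2)]
  obtain c where c: "arr c" "dm c = cd g" "cd c = cd g'" "c \<cdot> g = g'" "h' \<cdot> c = h"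
    using exact_fill[OF e, of "one (dm f)" "one (cd f)"] d by auto
  obtain c' where c': "arr c'" "dm c' = cd g'" "cd c' = cd g" "c' \<cdot> g' = g" "h \<cdot> c' = h'"
    using exact_fill[OF e(2,1), of "one (dm f)" "one (cd f)"] d by auto
  have 1: "c' \<cdot> c \<cdot> g = g" "c \<cdot> c' \<cdot> g' = g'" using c c' d by simp_all
  have 2: "h \<cdot> (c' \<cdot> c) = h" "h' \<cdot> (c \<cdot> c') = h'"
    using cp_reduce[OF c(5), of c'] cp_reduce[OF c'(5), of c] c c' d by simp_all
  obtain x where "inverses (c' \<cdot> c) x"
    by (rule exact_endo_iso[OF exact_rot[OF e(1)], of "c' \<cdot> c"]) (use 1 2 c c' d in simp_all)
  moreover obtain y where "inverses (c \<cdot> c') y"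
    by (rule exact_endo_iso[OF exact_rot[OF e(2)], of "c \<cdot> c'"]) (use 1 2 c c' d in simp_all)
  ultimately obtain z where "inverses c z"
    using c c' by - (rule inverses_of_composites[of c c' x y], simp_all)
  then show ?thesis using that c by blast
qed

lemma inverses_sgD:
  assumes "inverses (sg a) b" "arr a"
  obtains a' where "inverses a a'"
proof -
  have b: "arr b" "dm b = sobj C (cd a)" "cd b = sobj C (dm a)"
    using assms by (simp_all add: inverses_def)
  obtain a' where a': "arr a'" "dm a' = cd a" "cd a' = dm a" "b = sg a'"
    using sg_surj[OF b] assms(2) by auto
  have "sg (a' \<cdot> a) = sg (one (dm a))" "sg (a \<cdot> a') = sg (one (cd a))"
    using assms a' by (simp_all add: inverses_def)
  then have "a' \<cdot> a = one (dm a)" "a \<cdot> a' = one (cd a)"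
    using a' assms(2) by - (rule sg_inj, simp_all)+
  then show ?thesis using that[of a'] a' assms(2) by (simp add: inverses_def)
qed

lemma fiber_unique:
  assumes e: "exact f g h" "exact f' g h'"
  obtains a a' where "inverses a a'" "dm a = dm f" "cd a = dm f'" "f' \<cdot> a = f"
proof -
  note d = exactD[OF e(1)] exactD[OF e(2)]
  have cf: "cd f' = cd f" using d by simp
  obtain c c' where c: "inverses c c'" "dm c = cd h" "cd c = cd h'" "ng (sg f') \<cdot> c = ng (sg f)"
    using cone_unique[OF exact_rot[OF e(1)] exact_rot[OF e(2)]] by metis
  have c0: "arr c" using c by (simp add: inverses_def)
  obtain a where a: "arr a" "dm a = dm f" "cd a = dm f'" "c = sg a"
    using sg_surj[OF c0, of "dm f" "dm f'"] c d by auto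
  have "ng (sg (f' \<cdot> a)) = ng (sg f)" using c(4) a d by simp
  then have "ng (ng (sg (f' \<cdot> a))) = ng (ng (sg f))" by simp
  then have "sg (f' \<cdot> a) = sg f" using a d by (simp del: sg_cp)
  then have "f' \<cdot> a = f" using a d cf by (auto intro: sg_inj)
  moreover obtain a' where "inverses a a'" using inverses_sgD[of a c'] c(1) a by auto
  ultimately show ?thesis using that a by blast
qed

text \<open>TR1 supplies cones only. The cone is isomorphic to a suspension, and after transport
  along that isomorphism the triangle can be rotated back. Rotation carries a sign, whence
  \<open>ng u\<close>.\<close>

lemma exact_fiber_ex:
  assumes f: "arr f"
  obtains u w where "exact u f w"
proof -
  obtain g h where e: "exact f g h" using exact_ex[OF f] .
  note d = exactD[OF e]
  obtain X a b where X: "X \<in> ob C" "inverses a b" "dm a = sobj C X" "cd a = cd g"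
    using sobj_essentially_surj[of "cd g"] d by auto
  have ab: "arr a" "arr b" "dm b = cd a" "cd b = dm a" "b \<cdot> a = one (dm a)" "a \<cdot> b = one (cd a)"
    using X(2) by (simp_all add: inverses_def)
  have one: "inverses (one Y) (one Y)" if "Y \<in> ob C" for Y using that by (simp add: inverses_def)
  have e': "exact f (b \<cdot> g) (h \<cdot> a)"
    using exact_iso[OF e one one inverses_sym[OF X(2)], of "dm f" "cd f" f "b \<cdot> g" "h \<cdot> a"] d ab X
    by simp
  obtain u where u: "arr u" "dm u = X" "cd u = dm f" "h \<cdot> a = sg u"
    using sg_surj[of "h \<cdot> a" X "dm f"] d ab X by auto
  then have "exact f (b \<cdot> g) (ng (sg (ng u)))" using e' by simp
  then have "exact (ng u) f (b \<cdot> g)" using u ab X by - (rule exact_unrot, simp_all)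
  then show ?thesis by (rule that)
qed

lemma exact_ng:
  assumes e: "exact f g h"
  shows "exact (ng f) g (ng h)" "exact f (ng g) (ng h)" "exact (ng f) (ng g) h"
proof -
  note d = exactD[OF e]
  have one: "inverses (one Y) (one Y)" if "Y \<in> ob C" for Y using that by (simp add: inverses_def)
  have none: "inverses (ng (one Y)) (ng (one Y))" if "Y \<in> ob C" for Y
    using that by (simp add: inverses_def)
  show "exact (ng f) g (ng h)"
    using exact_iso[OF e none one one, of "dm f" "cd f" "cd g" "ng f" g "ng h"] d by simp
  show "exact f (ng g) (ng h)"
    using exact_iso[OF e one one none, of "dm f" "cd f" "cd g" f "ng g" "ng h"] d by simp
  show "exact (ng f) (ng g) h"
    using exact_iso[OF e one none one, of "dm f" "cd f" "cd g" "ng f" "ng g" h] d by simp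
qed

section \<open>Biproducts and split triangles\<close>

definition biprod :: "('o, 'm) arw \<Rightarrow> ('o, 'm) arw \<Rightarrow> ('o, 'm) arw \<Rightarrow> ('o, 'm) arw \<Rightarrow> bool" where
  "biprod i j p q \<longleftrightarrow> arr i \<and> arr j \<and> arr p \<and> arr q \<and> cd j = cd i \<and> dm p = cd i \<and> dm q = cd i \<and>
     cd p = dm i \<and> cd q = dm j \<and> p \<cdot> i = one (dm i) \<and> q \<cdot> j = one (dm j) \<and>
     p \<cdot> j = zr (dm j) (dm i) \<and> q \<cdot> i = zr (dm i) (dm j) \<and> i \<cdot> p \<oplus> j \<cdot> q = one (cd i)"

lemma is_biprod_iff:
  assumes "A \<in> ob C" "B \<in> ob C"
  shows "is_biprod C A B S i j p q \<longleftrightarrow> S \<in> ob C \<and> biprod (Arw A i S) (Arw B j S) (Arw S p A) (Arw S q B)"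
  using assms unfolding biprod_def is_biprod_def arr_def cp_def ad_def one_def zr_def by auto

lemma biprod_ex:
  assumes "A \<in> ob C" "B \<in> ob C"
  obtains i j p q where "biprod i j p q" "dm i = A" "dm j = B"
proof -
  have "\<forall>A\<in>ob C. \<forall>B\<in>ob C. \<exists>S i1 i2 p1 p2. is_biprod C A B S i1 i2 p1 p2"
    using additiveC unfolding additive_def by (elim conjE) assumption
  then obtain S i1 i2 p1 p2 where "is_biprod C A B S i1 i2 p1 p2" using assms by blast
  then show ?thesis using that is_biprod_iff[OF assms] by auto
qed

lemma biprodD:
  assumes "biprod i j p q"
  shows "arr i" "arr j" "arr p" "arr q" "cd j = cd i" "dm p = cd i" "dm q = cd i"
    "cd p = dm i" "cd q = dm j" "p \<cdot> i = one (dm i)" "q \<cdot> j = one (dm j)"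
    "p \<cdot> j = zr (dm j) (dm i)" "q \<cdot> i = zr (dm i) (dm j)"
    "\<And>x. arr x \<Longrightarrow> cd x = dm i \<Longrightarrow> p \<cdot> (i \<cdot> x) = x"
    "\<And>x. arr x \<Longrightarrow> cd x = dm j \<Longrightarrow> q \<cdot> (j \<cdot> x) = x"
    "\<And>x. arr x \<Longrightarrow> cd x = dm j \<Longrightarrow> p \<cdot> (j \<cdot> x) = zr (dm x) (dm i)"
    "\<And>x. arr x \<Longrightarrow> cd x = dm i \<Longrightarrow> q \<cdot> (i \<cdot> x) = zr (dm x) (dm j)"
proof -
  show d: "arr i" "arr j" "arr p" "arr q" "cd j = cd i" "dm p = cd i" "dm q = cd i"
    "cd p = dm i" "cd q = dm j" "p \<cdot> i = one (dm i)" "q \<cdot> j = one (dm j)"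
    "p \<cdot> j = zr (dm j) (dm i)" "q \<cdot> i = zr (dm i) (dm j)"
    using assms by (simp_all add: biprod_def)
  fix x assume x: "arr x"
  show "cd x = dm i \<Longrightarrow> p \<cdot> (i \<cdot> x) = x" "cd x = dm i \<Longrightarrow> q \<cdot> (i \<cdot> x) = zr (dm x) (dm j)"
    using cp_reduce[OF d(10), of x] cp_reduce[OF d(13), of x] d(1-9) x by simp_all
  show "cd x = dm j \<Longrightarrow> q \<cdot> (j \<cdot> x) = x" "cd x = dm j \<Longrightarrow> p \<cdot> (j \<cdot> x) = zr (dm x) (dm i)"
    using cp_reduce[OF d(11), of x] cp_reduce[OF d(12), of x] d(1-9) x by simp_all
qed

lemma biprod_sum:
  assumes b: "biprod i j p q"
  shows "i \<cdot> p \<oplus> j \<cdot> q = one (cd i)"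
    and "arr x \<Longrightarrow> cd x = cd i \<Longrightarrow> i \<cdot> (p \<cdot> x) \<oplus> j \<cdot> (q \<cdot> x) = x"
    and "arr x \<Longrightarrow> dm x = cd i \<Longrightarrow> x \<cdot> (i \<cdot> p) \<oplus> x \<cdot> (j \<cdot> q) = x"
proof -
  note d = biprodD(1-9)[OF b]
  show s: "i \<cdot> p \<oplus> j \<cdot> q = one (cd i)" using b by (simp add: biprod_def)
  show "i \<cdot> (p \<cdot> x) \<oplus> j \<cdot> (q \<cdot> x) = x" if x: "arr x" "cd x = cd i"
  proof -
    have "i \<cdot> (p \<cdot> x) \<oplus> j \<cdot> (q \<cdot> x) = (i \<cdot> p \<oplus> j \<cdot> q) \<cdot> x" using d x by simp
    also have "\<dots> = x" unfolding s using x by simp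
    finally show ?thesis .
  qed
  show "x \<cdot> (i \<cdot> p) \<oplus> x \<cdot> (j \<cdot> q) = x" if x: "arr x" "dm x = cd i"
  proof -
    have "x \<cdot> (i \<cdot> p) \<oplus> x \<cdot> (j \<cdot> q) = x \<cdot> (i \<cdot> p \<oplus> j \<cdot> q)" using d x by simp
    also have "\<dots> = x" unfolding s using x by simp
    finally show ?thesis .
  qed
qed

lemma exact_retract_split:
  assumes e: "exact f g h" and r: "arr r" "dm r = cd f" "r \<cdot> f = one (dm f)"
  shows "h = zr (cd g) (sobj C (dm f))"
proof -
  note d = exactD[OF e]
  have cr: "cd r = dm f" using r(3) by (metis dm_cd_simps(2,10))
  have "h = sg (r \<cdot> f) \<cdot> h" using r(3) d by simp
  also have "\<dots> = sg r \<cdot> (sg f \<cdot> h)" using r(1,2) d by simp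
  also have "\<dots> = zr (cd g) (sobj C (dm f))" unfolding exact_comp0(3)[OF e] using r cr d by simp
  finally show ?thesis .
qed

text \<open>With zero connecting map the identity of \<open>cd g\<close> lifts to a section
  \<open>s\<close>. Then 1 - \<open>s \<cdot> g\<close> is killed by \<open>g\<close> and factors
  through \<open>f\<close>, which defines the retraction \<open>r\<close>.\<close>

lemma exact_split:
  assumes e: "exact f g (zr (cd g) (sobj C (dm f)))"
  obtains s r where "biprod f s r g"
proof -
  note d = exactD[OF e]
  let ?h = "zr (cd g) (sobj C (dm f))"
  obtain s where s: "arr s" "dm s = cd g" "cd s = cd f" "g \<cdot> s = one (cd g)"
    using exact_lift[OF exact_rot[OF e], of "one (cd g)"] d by auto
  let ?n = "one (cd f) \<oplus> ng (s \<cdot> g)"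
  have gsg: "g \<cdot> (s \<cdot> g) = g" using cp_reduce[OF s(4), of g] s(1-3) d by simp
  have "g \<cdot> ?n = zr (dm ?n) (cd g)" using gsg s(1-3) d by simp
  then obtain r where r: "arr r" "dm r = cd f" "cd r = dm f" "f \<cdot> r = ?n"
    using exact_lift[OF e, of ?n] s(1-3) d by auto
  \<comment> \<open>\<open>f\<close> is monic: whatever \<open>sg f\<close> kills lifts through the
    connecting map, which is zero.\<close>
  have mono: "x = zr (dm x) (dm f)" if x: "arr x" "cd x = dm f" "f \<cdot> x = zr (dm x) (cd f)" for x
  proof -
    have "sg f \<cdot> sg x = sg (f \<cdot> x)" using x(1,2) d by simp
    also have "\<dots> = zr (sobj C (dm x)) (sobj C (cd f))" using x(1) d unfolding x(3) by simp
    finally have "ng (sg f) \<cdot> sg x = zr (dm (sg x)) (cd (ng (sg f)))" using x(1,2) d by simp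
    then obtain v where v: "arr v" "dm v = sobj C (dm x)" "cd v = cd g" "?h \<cdot> v = sg x"
      using exact_lift[OF exact_rot[OF exact_rot[OF e]], of "sg x"] x(1,2) d by auto
    have "sg x = sg (zr (dm x) (dm f))" unfolding v(4)[symmetric] using v(1-3) x(1) d by simp
    then show ?thesis using x(1,2) d by (auto intro: sg_inj)
  qed
  have fr: "f \<cdot> r \<cdot> f = f \<oplus> ng (s \<cdot> (g \<cdot> f))" unfolding r(4) using s(1-3) d by simp
  then have "f \<cdot> r \<cdot> f = f" using exact_comp0(1)[OF e] s(1-3) d by simp
  then have frf: "f \<cdot> (r \<cdot> f) = f" using r(1-3) d by simp
  have "r \<cdot> f \<oplus> ng (one (dm f)) = zr (dm f) (dm f)"
    using mono[of "r \<cdot> f \<oplus> ng (one (dm f))"] frf r(1-3) d by simp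
  then have rf: "r \<cdot> f = one (dm f)" using r(1-3) d by - (rule diff_zeroD, simp_all)
  have "f \<cdot> r \<cdot> s = s \<oplus> ng (s \<cdot> (g \<cdot> s))" unfolding r(4) using s(1-3) d by simp
  then have "f \<cdot> (r \<cdot> s) = zr (cd g) (cd f)" using s r(1-3) d by simp
  then have rs: "r \<cdot> s = zr (cd g) (dm f)" using mono[of "r \<cdot> s"] s(1-3) r(1-3) d by simp
  have "f \<cdot> r \<oplus> s \<cdot> g = one (cd f)"
    unfolding r(4) using s(1-3) d by simp
  then have "biprod f s r g"
    unfolding biprod_def using s r(1-3) rs rf d exact_comp0(1)[OF e] by simp
  then show ?thesis by (rule that)
qed

text \<open>The triangle of the split mono \<open>i\<close> splits, so its cone is a complement of
  \<open>i\<close>. Any two complements are isomorphic, here by \<open>q \<cdot> s\<close> with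
  inverse \<open>g \<cdot> j\<close>, and the triangle is transported to \<open>q\<close>.\<close>

lemma biprod_exact:
  assumes b: "biprod i j p q"
  shows "exact i q (zr (cd q) (sobj C (dm i)))"
proof -
  note d = biprodD[OF b]
  obtain g h where e: "exact i g h" using exact_ex[OF d(1)] .
  note de = exactD[OF e]
  have h: "h = zr (cd g) (sobj C (dm i))" using exact_retract_split[OF e, of p] d by simp
  obtain s r where sr: "biprod i s r g" using exact_split e unfolding h by metis
  note d' = biprodD[OF sr]
  let ?c = "q \<cdot> s" and ?c' = "g \<cdot> j"
  have qsg: "q \<cdot> (s \<cdot> g) = q" using biprod_sum(3)[OF sr, of q] d d' by simp
  have jq: "g \<cdot> (j \<cdot> q) = g" using biprod_sum(3)[OF b, of g] d d' by simp
  have "q \<cdot> (s \<cdot> (g \<cdot> j)) = one (dm j)"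
    using cp_reduce[OF qsg, of j] d d' by simp
  moreover have "g \<cdot> (j \<cdot> (q \<cdot> s)) = one (cd g)"
    using cp_reduce[OF jq, of s] d d' by simp
  ultimately have "inverses ?c ?c'" unfolding inverses_def using d d' by simp
  moreover have one: "inverses (one Y) (one Y)" if "Y \<in> ob C" for Y
    using that by (simp add: inverses_def)
  ultimately show ?thesis
    using exact_iso[OF e one one, of "dm i" "cd i" ?c ?c' i q "zr (cd q) (sobj C (dm i))"]
      qsg d d' h by simp
qed


section \<open>Homotopy cartesian squares\<close>

text \<open>Arrow form of \<open>hcart\<close>. The connecting map stays existential, so
  constructions on squares never have to match chosen connecting maps.\<close>

definition hc :: "('o, 'm) arw \<Rightarrow> ('o, 'm) arw \<Rightarrow> ('o, 'm) arw \<Rightarrow> ('o, 'm) arw \<Rightarrow> bool" where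
  "hc f g f' g' \<longleftrightarrow> arr f \<and> arr g \<and> arr f' \<and> arr g' \<and> dm g = dm f \<and> cd g' = cd f' \<and>
     dm f' = cd g \<and> dm g' = cd f \<and>
     (\<exists>i j p q h. biprod i j p q \<and> dm i = cd f \<and> dm j = cd g \<and>
        exact (i \<cdot> f \<oplus> j \<cdot> ng g) (g' \<cdot> p \<oplus> f' \<cdot> q) h)"

lemma inverses_one [simp]: "Y \<in> ob C \<Longrightarrow> inverses (one Y) (one Y)"
  by (simp add: inverses_def)

lemma inversesD:
  assumes "inverses a b"
  shows "arr a" "arr b" "dm b = cd a" "cd b = dm a" "b \<cdot> a = one (dm a)" "a \<cdot> b = one (cd a)"
  using assms by (simp_all add: inverses_def)

lemma hcD:
  assumes "hc f g f' g'"
  shows "arr f" "arr g" "arr f'" "arr g'" "dm g = dm f" "cd g' = cd f'" "dm f' = cd g" "dm g' = cd f"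
  using assms by (simp_all add: hc_def)

text \<open>Two biproducts of the same objects are isomorphic compatibly with injections and
  projections, so the triangle can be read in any of them.\<close>

lemma hc_exact:
  assumes h: "hc f g f' g'" and b: "biprod i j p q" "dm i = cd f" "dm j = cd g"
  obtains k where "exact (i \<cdot> f \<oplus> j \<cdot> ng g) (g' \<cdot> p \<oplus> f' \<cdot> q) k"
proof -
  note d = hcD[OF h]
  obtain i' j' p' q' k where b': "biprod i' j' p' q'" "dm i' = cd f" "dm j' = cd g"
    and e: "exact (i' \<cdot> f \<oplus> j' \<cdot> ng g) (g' \<cdot> p' \<oplus> f' \<cdot> q') k"
    using h unfolding hc_def by blast
  note D = biprodD[OF b(1)] and D' = biprodD[OF b'(1)]
  let ?b = "i \<cdot> p' \<oplus> j \<cdot> q'" and ?b' = "i' \<cdot> p \<oplus> j' \<cdot> q"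
  have "inverses ?b ?b'" unfolding inverses_def
    using D D' b(2,3) b'(2,3) biprod_sum(1)[OF b(1)] biprod_sum(1)[OF b'(1)] by simp
  then have "exact (i \<cdot> f \<oplus> j \<cdot> ng g) (g' \<cdot> p \<oplus> f' \<cdot> q) k"
    using exact_iso[OF e inverses_one _ inverses_one, of "dm f" ?b ?b' "cd g'"
       "i \<cdot> f \<oplus> j \<cdot> ng g" "g' \<cdot> p \<oplus> f' \<cdot> q" k] d D D' b(2,3) b'(2,3) exactD[OF e] by simp
  then show ?thesis by (rule that)
qed

lemma hcI:
  assumes "arr f" "arr g" "arr f'" "arr g'" "dm g = dm f" "cd g' = cd f'" "dm f' = cd g" "dm g' = cd f"
   "biprod i j p q" "dm i = cd f" "dm j = cd g" "exact (i \<cdot> f \<oplus> j \<cdot> ng g) (g' \<cdot> p \<oplus> f' \<cdot> q) h"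
  shows "hc f g f' g'"
  using assms unfolding hc_def by blast

lemma hc_ex_biprod:
  assumes h: "hc f g f' g'"
  obtains i j p q k where "biprod i j p q" "dm i = cd f" "dm j = cd g"
    "exact (i \<cdot> f \<oplus> j \<cdot> ng g) (g' \<cdot> p \<oplus> f' \<cdot> q) k"
  using h unfolding hc_def by blast

lemma hc_commute:
  assumes h: "hc f g f' g'" shows "g' \<cdot> f = f' \<cdot> g"
proof -
  note d = hcD[OF h]
  obtain i j p q k where b: "biprod i j p q" "dm i = cd f" "dm j = cd g"
    and e: "exact (i \<cdot> f \<oplus> j \<cdot> ng g) (g' \<cdot> p \<oplus> f' \<cdot> q) k"
    using hc_ex_biprod[OF h] .
  note D = biprodD[OF b(1)]
  have "g' \<cdot> f \<oplus> ng (f' \<cdot> g) = zr (dm f) (cd g')"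
    using exact_comp0(1)[OF e] d D b(2,3) by simp
  then show ?thesis using d by - (rule diff_zeroD, simp_all)
qed

lemma biprod_swap:
  assumes b: "biprod i j p q" shows "biprod j i q p"
  unfolding biprod_def using biprodD[OF b] biprod_sum(1)[OF b]
  by (simp add: ad_commute[of "j \<cdot> q" "i \<cdot> p"])

lemma hc_sym:
  assumes h: "hc f g f' g'" shows "hc g f g' f'"
proof -
  note d = hcD[OF h]
  obtain i j p q k where b: "biprod i j p q" "dm i = cd f" "dm j = cd g"
    and e: "exact (i \<cdot> f \<oplus> j \<cdot> ng g) (g' \<cdot> p \<oplus> f' \<cdot> q) k"
    using hc_ex_biprod[OF h] .
  note D = biprodD[OF b(1)]
  have "exact (j \<cdot> g \<oplus> i \<cdot> ng f) (f' \<cdot> q \<oplus> g' \<cdot> p) (ng k)"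
    using exact_ng(1)[OF e] d D b(2,3)
    by (simp add: ad_commute[of "j \<cdot> g" "ng (i \<cdot> f)"] ad_commute[of "f' \<cdot> q" "g' \<cdot> p"])
  then show ?thesis using d b by - (rule hcI[OF _ _ _ _ _ _ _ _ biprod_swap[OF b(1)]], simp_all)
qed

text \<open>A homotopy pullback is a fibre of the map with components \<open>g'\<close> and
  \<open>f'\<close>. The second component of the fibre map is negated because the triangle in
  \<open>hc\<close> starts with \<open>f\<close> and \<open>ng g\<close>.\<close>

lemma hc_ex:
  assumes a: "arr f'" "arr g'" "cd g' = cd f'"
  obtains f g where "hc f g f' g'"
proof -
  obtain i j p q where b: "biprod i j p q" "dm i = dm g'" "dm j = dm f'"
    using biprod_ex[OF arr_ob(1)[OF a(2)] arr_ob(1)[OF a(1)]] .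
  note D = biprodD[OF b(1)]
  let ?b = "g' \<cdot> p \<oplus> f' \<cdot> q"
  have "arr ?b" using a b D by simp
  then obtain u w where e: "exact u ?b w" by (rule exact_fiber_ex)
  note d = exactD[OF e]
  have "i \<cdot> (p \<cdot> u) \<oplus> j \<cdot> ng (ng (q \<cdot> u)) = u"
    using biprod_sum(2)[OF b(1), of u] d D a b by simp
  then have "hc (p \<cdot> u) (ng (q \<cdot> u)) f' g'"
    using d D a b e by - (rule hcI[OF _ _ _ _ _ _ _ _ b(1)], simp_all)
  then show ?thesis by (rule that)
qed

lemma hc_unique:
  assumes h: "hc f g f' g'" "hc f2 g2 f' g'"
  obtains a a' where "inverses a a'" "dm a = dm f2" "cd a = dm f" "f \<cdot> a = f2" "g \<cdot> a = g2"
proof -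
  note d = hcD[OF h(1)] hcD[OF h(2)]
  obtain i j p q k where b: "biprod i j p q" "dm i = cd f" "dm j = cd g"
    and e: "exact (i \<cdot> f \<oplus> j \<cdot> ng g) (g' \<cdot> p \<oplus> f' \<cdot> q) k"
    using hc_ex_biprod[OF h(1)] .
  note D = biprodD[OF b(1)]
  have cf: "cd f2 = cd f" "cd g2 = cd g" using d by simp_all
  obtain k2 where e2: "exact (i \<cdot> f2 \<oplus> j \<cdot> ng g2) (g' \<cdot> p \<oplus> f' \<cdot> q) k2"
    using hc_exact[OF h(2) b(1)] b(2,3) cf by auto
  obtain a a' where a: "inverses a a'" "dm a = dm (i \<cdot> f2 \<oplus> j \<cdot> ng g2)" "cd a = dm (i \<cdot> f \<oplus> j \<cdot> ng g)"
    "(i \<cdot> f \<oplus> j \<cdot> ng g) \<cdot> a = i \<cdot> f2 \<oplus> j \<cdot> ng g2"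
    using fiber_unique[OF e2 e] .
  have a0: "arr a" "dm a = dm f2" "cd a = dm f" using a by (simp_all add: inverses_def)
  have 1: "p \<cdot> ((i \<cdot> f \<oplus> j \<cdot> ng g) \<cdot> a) = f \<cdot> a"
    using a0 d(1-9) D b(2,3) by simp
  have "f \<cdot> a = f2"
    unfolding 1[symmetric] a(4) using cf d D b(2,3) by simp
  moreover
  have 2: "q \<cdot> ((i \<cdot> f \<oplus> j \<cdot> ng g) \<cdot> a) = ng (g \<cdot> a)"
    using a0 d(1-9) D b(2,3) by simp
  have "ng (g \<cdot> a) = ng g2"
    unfolding 2[symmetric] a(4) using cf d D b(2,3) by simp
  then have "ng (ng (g \<cdot> a)) = ng (ng g2)" by simp
  then have "g \<cdot> a = g2" using a0 d by simp
  ultimately show ?thesis using that[OF a(1) a0(2,3)] by simp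
qed

lemma hc_iso:
  assumes h: "hc f g f' g'" and a: "inverses a a'" "cd a = dm f"
  shows "hc (f \<cdot> a) (g \<cdot> a) f' g'"
proof -
  note d = hcD[OF h]
  obtain i j p q k where b: "biprod i j p q" "dm i = cd f" "dm j = cd g"
    and e: "exact (i \<cdot> f \<oplus> j \<cdot> ng g) (g' \<cdot> p \<oplus> f' \<cdot> q) k"
    using hc_ex_biprod[OF h] .
  note D = biprodD[OF b(1)] and A = inversesD[OF a(1)]
  have "exact (i \<cdot> (f \<cdot> a) \<oplus> j \<cdot> ng (g \<cdot> a)) (g' \<cdot> p \<oplus> f' \<cdot> q) (sg a' \<cdot> k)"
    using exact_iso[OF e inverses_sym[OF a(1)] inverses_one inverses_one, of "cd i" "cd g'"
        "i \<cdot> (f \<cdot> a) \<oplus> j \<cdot> ng (g \<cdot> a)" "g' \<cdot> p \<oplus> f' \<cdot> q" "sg a' \<cdot> k"]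
      d D A a(2) b(2,3) exactD[OF e] by simp
  then show ?thesis using d D A a(2) b by - (rule hcI[OF _ _ _ _ _ _ _ _ b(1)], simp_all)
qed

text \<open>Octahedron of \<open>i\<close> followed by the map with components \<open>g'\<close> and
  \<open>f'\<close>, whose composite is \<open>g'\<close>. The cone of \<open>i\<close> is
  \<open>cd g\<close>, so the cone of \<open>g'\<close> becomes a cone of \<open>g\<close>. The
  explicit projection \<open>u \<cdot> f'\<close> matters as well: it is what later allows cone
  projections to be factored.\<close>

lemma hc_cone:
  assumes h: "hc f g f' g'" and t: "exact g' u w"
  obtains w' where "exact g (u \<cdot> f') w'"
proof -
  note d = hcD[OF h] exactD[OF t]
  obtain i j p q k where b: "biprod i j p q" "dm i = cd f" "dm j = cd g"
    and e: "exact (i \<cdot> f \<oplus> j \<cdot> ng g) (g' \<cdot> p \<oplus> f' \<cdot> q) k"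
    using hc_ex_biprod[OF h] .
  note D = biprodD[OF b(1)]
  let ?b = "g' \<cdot> p \<oplus> f' \<cdot> q" and ?a = "i \<cdot> f \<oplus> j \<cdot> ng g"
  have bi: "?b \<cdot> i = g'" using d D b(2,3) by simp
  obtain u1 v1 where uv: "exact u1 v1 (sg q \<cdot> ng (sg ?a))" "dm u1 = cd q" "u1 \<cdot> q = u \<cdot> ?b"
  proof -
    have "exact (?b \<cdot> i) u w" "dm ?b = cd i" using bi t D d by simp_all
    from octahedral[OF biprod_exact[OF b(1)] exact_rot[OF e] this] show ?thesis
      using that by metis
  qed
  have u1: "arr u1" using exactD[OF uv(1)] by simp
  have "u1 = u1 \<cdot> q \<cdot> j" using u1 uv(2) D by simp
  also have "\<dots> = u \<cdot> f'" unfolding uv(3) using d D b(2,3) by simp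
  finally have u1f: "u1 = u \<cdot> f'" .
  have "sg q \<cdot> ng (sg ?a) = ng (sg q \<cdot> sg ?a)"
    by (rule cp_ng(1)) (use d D b(2,3) in simp_all)
  also have "sg q \<cdot> sg ?a = sg (q \<cdot> ?a)"
    by (rule sg_cp[symmetric]) (use d D b(2,3) in simp_all)
  also have "q \<cdot> ?a = ng g" using d D b(2,3) by simp
  finally have "exact (u \<cdot> f') v1 (ng (sg (ng g)))" using uv(1) u1f by simp
  moreover have "cd v1 = sobj C (dm (ng g))"
    using exactD[OF uv(1)] d by simp
  ultimately have "exact (ng g) (u \<cdot> f') v1"
    using d by - (rule exact_unrot, simp_all)
  from exact_ng(1)[OF this] have "exact g (u \<cdot> f') (ng v1)" using d by simp
  then show ?thesis by (rule that)
qed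

text \<open>The sum of a triangle with an identity triangle. Exactness of sums is not an axiom, so
  the cone of the sum is compared with \<open>cd b\<close> by fillers over the projections and over
  the injections; both composites satisfy the hypotheses of \<open>exact_endo_iso\<close>.\<close>

lemma exact_add_contractible:
  assumes e: "exact a b c"
    and B: "biprod i j p q" "dm j = dm a" and B': "biprod i' j' p' q'" "dm i' = dm i" "dm j' = cd a"
  obtains w where "exact (i' \<cdot> p \<oplus> j' \<cdot> (a \<cdot> q)) (b \<cdot> q') w"
proof -
  note d = exactD[OF e] and D = biprodD[OF B(1)] and D' = biprodD[OF B'(1)]
  let ?f = "i' \<cdot> p \<oplus> j' \<cdot> (a \<cdot> q)"
  note T = d D(1-9) D'(1-9) B(2) B'(2,3)
  have "arr ?f" using T by simp
  then obtain k1 k2 where k: "exact ?f k1 k2" by (rule exact_ex)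
  note K = exactD[OF k]
  have f1: "q' \<cdot> ?f = a \<cdot> q" "p' \<cdot> ?f = p" "?f \<cdot> j = j' \<cdot> a" "?f \<cdot> i = i'"
    using d D D' B(2) B'(2,3) by simp_all
  obtain x where x: "arr x" "dm x = cd k1" "cd x = cd b" "x \<cdot> k1 = b \<cdot> q'" "sg q \<cdot> k2 = c \<cdot> x"
    by (rule exact_fill[OF k e, of q q']) (use f1 T in simp_all)
  obtain y where y: "arr y" "dm y = cd b" "cd y = cd k1" "y \<cdot> b = k1 \<cdot> j'" "sg j \<cdot> c = k2 \<cdot> y"
    by (rule exact_fill[OF e k, of j j']) (use f1 T in simp_all)
  have K': "dm k1 = cd i'" "dm k2 = cd k1" "cd k2 = sobj C (cd i)"
    using K T by simp_all
  have xyb: "x \<cdot> (y \<cdot> b) = b"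
  proof -
    have "x \<cdot> (y \<cdot> b) = x \<cdot> k1 \<cdot> j'" unfolding y(4) using x(1-3) K(1-3) K' T by simp
    also have "\<dots> = b" unfolding x(4) using T D' by simp
    finally show ?thesis .
  qed
  have cxy: "c \<cdot> (x \<cdot> y) = c"
  proof -
    have "c \<cdot> (x \<cdot> y) = c \<cdot> x \<cdot> y" using x(1-3) y(1-3) T by simp
    also have "\<dots> = sg q \<cdot> (k2 \<cdot> y)" unfolding x(5)[symmetric] using y(1-3) K(1-3) K' T by simp
    also have "\<dots> = sg (q \<cdot> j) \<cdot> c" unfolding y(5)[symmetric] using T by simp
    also have "\<dots> = c" unfolding D(11) using T by simp
    finally show ?thesis .
  qed
  \<comment> \<open>\<open>k1\<close> sees only the second summand: \<open>i'\<close> factors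
    through \<open>?f\<close>, so \<open>k1\<close> kills it.\<close>
  have yxk: "y \<cdot> (x \<cdot> k1) = k1"
  proof -
    have "k1 \<cdot> i' = k1 \<cdot> (?f \<cdot> i)" unfolding f1(4) by simp
    also have "\<dots> = k1 \<cdot> ?f \<cdot> i" by (rule cp_assoc[symmetric]) (use K(1-3) K' T in simp_all)
    also have "\<dots> = zr (dm i) (cd k1)" unfolding exact_comp0(1)[OF k] using K(1-3) K' T by simp
    finally have ki: "k1 \<cdot> i' = zr (dm i) (cd k1)" .
    have "k1 = k1 \<cdot> (i' \<cdot> p') \<oplus> k1 \<cdot> (j' \<cdot> q')"
      using biprod_sum(3)[OF B'(1), of k1] K(1-3) K' by simp
    also have "\<dots> = k1 \<cdot> (j' \<cdot> q')"
      using cp_reduce[OF ki, of p'] K(1-3) K' T by simp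
    also have "\<dots> = y \<cdot> b \<cdot> q'" unfolding y(4) using K(1-3) K' T by simp
    also have "\<dots> = y \<cdot> (x \<cdot> k1)" unfolding x(4) using y(1-3) T by simp
    finally show ?thesis by simp
  qed
  have kyx: "k2 \<cdot> (y \<cdot> x) = k2"
  proof -
    have "sg p \<cdot> k2 = sg (p' \<cdot> ?f) \<cdot> k2" unfolding f1(2) by simp
    also have "\<dots> = sg p' \<cdot> (sg ?f \<cdot> k2)" using K(1-3) K' T by simp
    also have "\<dots> = zr (cd k1) (sobj C (dm i))" unfolding exact_comp0(3)[OF k] using K(1-3) K' T by simp
    finally have pk: "sg p \<cdot> k2 = zr (cd k1) (sobj C (dm i))" .
    have "k2 = sg (i \<cdot> p \<oplus> j \<cdot> q) \<cdot> k2" unfolding biprod_sum(1)[OF B(1)] using K(1-3) K' T by simp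
    also have "\<dots> = sg i \<cdot> (sg p \<cdot> k2) \<oplus> sg j \<cdot> (sg q \<cdot> k2)" using K(1-3) K' T by simp
    also have "\<dots> = sg j \<cdot> c \<cdot> x" unfolding pk x(5) using K(1-3) K' T x(1-3) by simp
    also have "\<dots> = k2 \<cdot> (y \<cdot> x)" unfolding y(5) using K(1-3) K' T x(1-3) y(1-3) by simp
    finally show ?thesis by simp
  qed
  obtain z1 where z1: "inverses (x \<cdot> y) z1"
    by (rule exact_endo_iso[OF exact_rot[OF e], of "x \<cdot> y"]) (use x(1-3) y(1-3) xyb cxy T in simp_all)
  obtain z2 where z2: "inverses (y \<cdot> x) z2"
    by (rule exact_endo_iso[OF exact_rot[OF k], of "y \<cdot> x"])
      (use x(1-3) y(1-3) yxk kyx K(1-3) K' T in simp_all)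
  obtain x' where X: "inverses x x'"
    by (rule inverses_of_composites[of x y z2 z1]) (use x(1-3) y(1-3) z1 z2 in simp_all)
  note X' = inversesD[OF X]
  have "exact ?f (b \<cdot> q') (k2 \<cdot> x')"
    using exact_iso[OF k inverses_one inverses_one X, of "dm ?f" "cd ?f" ?f "b \<cdot> q'" "k2 \<cdot> x'"]
      x(1-4) X' K(1-3) K' T by simp
  then show ?thesis by (rule that)
qed

text \<open>The octahedron on \<open>U' \<oplus> T \<rightarrow> U' \<oplus> (U \<oplus> V) \<rightarrow> U\<close>, whose second map is a split epimorphism
  with kernel \<open>U' \<oplus> V\<close>.\<close>

lemma hc_paste:
  assumes h: "hc f g f' g'" and l: "hc a b f s"
  shows "hc a (g \<cdot> b) f' (g' \<cdot> s)"
proof -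
  note d = hcD[OF h] hcD[OF l]
  obtain i j p q k where B: "biprod i j p q" "dm i = cd f" "dm j = cd g"
    and e: "exact (i \<cdot> f \<oplus> j \<cdot> ng g) (g' \<cdot> p \<oplus> f' \<cdot> q) k"
    using hc_ex_biprod[OF h] .
  obtain qi qj qp qq l where Q: "biprod qi qj qp qq" "dm qi = cd a" "dm qj = cd b"
    and el: "exact (qi \<cdot> a \<oplus> qj \<cdot> ng b) (s \<cdot> qp \<oplus> f \<cdot> qq) l"
    using hc_ex_biprod[OF l] .
  have ob: "cd a \<in> ob C" "cd i \<in> ob C" "cd g \<in> ob C" using d biprodD(1)[OF B(1)] by simp_all
  obtain ni nj np nq where N: "biprod ni nj np nq" "dm ni = cd a" "dm nj = cd i"
    using biprod_ex[OF ob(1,2)] .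
  obtain si sj sp sq where S: "biprod si sj sp sq" "dm si = cd a" "dm sj = cd g"
    using biprod_ex[OF ob(1,3)] .
  note DB = biprodD[OF B(1)] and DQ = biprodD[OF Q(1)] and DN = biprodD[OF N(1)] and DS = biprodD[OF S(1)]
  note T = d DB(1-9) DQ(1-9) DN(1-9) DS(1-9) B(2,3) Q(2,3) N(2,3) S(2,3)
  let ?al = "i \<cdot> f \<oplus> j \<cdot> ng g" and ?be = "g' \<cdot> p \<oplus> f' \<cdot> q"
  let ?al' = "qi \<cdot> a \<oplus> qj \<cdot> ng b" and ?be' = "s \<cdot> qp \<oplus> f \<cdot> qq"
  \<comment> \<open>In coordinates \<open>?ps\<close> is the identity plus \<open>?al\<close>, and
    \<open>?r\<close> sends (x, (u, v)) to s x + u. Its kernel is \<open>?ka\<close>, sending (x, v)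
    to (x, (- s x, - v)), with retraction \<open>?la\<close>. The sign on v is chosen so that the
    resulting triangle starts with \<open>a\<close> and \<open>ng (g \<cdot> b)\<close> and so that
    the sign of the rotation cancels in its second map.\<close>
  let ?ps = "ni \<cdot> qp \<oplus> nj \<cdot> (?al \<cdot> qq)"
  let ?r = "s \<cdot> np \<oplus> p \<cdot> nq"
  let ?ka = "ni \<cdot> sp \<oplus> ng (nj \<cdot> (i \<cdot> (s \<cdot> sp))) \<oplus> ng (nj \<cdot> (j \<cdot> sq))"
  let ?la = "si \<cdot> np \<oplus> ng (sj \<cdot> (q \<cdot> nq))"
  obtain w where psi: "exact ?ps (?be \<cdot> nq) w"
    by (rule exact_add_contractible[OF e Q(1) _ N(1)]) (use T in simp_all)
  have la_ka: "?la \<cdot> ?ka = one (cd si)"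
    using T DB DN biprod_sum(1)[OF S(1)] by simp
  have r_ka: "?r \<cdot> ?ka = zr (cd si) (cd s)"
    using T DB DN by simp
  have la_nj: "?la \<cdot> (nj \<cdot> i) = zr (dm i) (cd si)" and r_nj: "?r \<cdot> (nj \<cdot> i) = one (dm i)"
    using T DB DN by simp_all
  have sum: "?ka \<cdot> ?la \<oplus> nj \<cdot> i \<cdot> ?r = one (cd ni)"
  proof -
    have 1: "nj \<cdot> nq = nj \<cdot> (i \<cdot> (p \<cdot> nq)) \<oplus> nj \<cdot> (j \<cdot> (q \<cdot> nq))"
    proof -
      have "nj \<cdot> nq = nj \<cdot> (i \<cdot> (p \<cdot> nq) \<oplus> j \<cdot> (q \<cdot> nq))"
        unfolding biprod_sum(2)[OF B(1) DN(4), unfolded DN(9) N(3), OF refl] by simp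
      then show ?thesis using T by simp
    qed
    have "?ka \<cdot> ?la = ni \<cdot> np \<oplus> (ng (nj \<cdot> (i \<cdot> (s \<cdot> np))) \<oplus> nj \<cdot> (j \<cdot> (q \<cdot> nq)))"
      using T DS by simp
    moreover have "nj \<cdot> i \<cdot> ?r = nj \<cdot> (i \<cdot> (s \<cdot> np)) \<oplus> nj \<cdot> (i \<cdot> (p \<cdot> nq))"
      using T by simp
    moreover have "ng (nj \<cdot> (i \<cdot> (s \<cdot> np))) \<oplus> nj \<cdot> (j \<cdot> (q \<cdot> nq)) \<oplus>
        (nj \<cdot> (i \<cdot> (s \<cdot> np)) \<oplus> nj \<cdot> (i \<cdot> (p \<cdot> nq))) = nj \<cdot> nq"
      unfolding 1 using T
        ad_left_commute[of "nj \<cdot> (j \<cdot> (q \<cdot> nq))" "nj \<cdot> (i \<cdot> (s \<cdot> np))" "nj \<cdot> (i \<cdot> (p \<cdot> nq))"]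
        ad_commute[of "nj \<cdot> (j \<cdot> (q \<cdot> nq))" "nj \<cdot> (i \<cdot> (p \<cdot> nq))"] by simp
    ultimately show ?thesis using T biprod_sum(1)[OF N(1)] by simp
  qed
  have K: "biprod ?ka (nj \<cdot> i) ?la ?r"
    unfolding biprod_def using T la_ka r_ka la_nj r_nj sum by (simp del: cp_ad ad_cp cp_assoc)
  \<comment> \<open>The composite is the second map of the triangle of \<open>l\<close>, so the
    octahedron relates the triangles of both squares.\<close>
  have rps: "?r \<cdot> ?ps = ?be'" using T DB DN by simp
  have e2: "exact ?r (zr (cd ?r) (sobj C (dm ?ka))) (ng (sg ?ka))"
    using exact_rot[OF biprod_exact[OF K]] .
  have e3: "exact (?r \<cdot> ?ps) l (ng (sg ?al'))"
    using exact_rot[OF el] unfolding rps .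
  obtain u v where uv: "exact u v (sg (?be \<cdot> nq) \<cdot> ng (sg ?ka))" "cd u = cd l" "dm u = cd f'"
     "cd v = sobj C (dm ?ka)" "ng (sg ?ka) \<cdot> v = sg ?ps \<cdot> ng (sg ?al')"
  proof -
    have "dm ?r = cd ?ps" using T by simp
    from octahedral[OF psi e2 e3 this] show ?thesis
      using that d(6) by (metis dm_cd_simps(2,4,8))
  qed
  note U = exactD[OF uv(1)]
  have cl: "cd l = sobj C (dm a)" using exactD[OF el] T by simp
  obtain v' where v': "arr v'" "dm v' = dm a" "cd v' = cd si" "v = sg v'"
    using sg_surj[of v "dm a" "cd si"] U(2,4) uv(2,4) cl T by auto
  have "ng (sg (?ka \<cdot> v')) = ng (sg (?ps \<cdot> ?al'))"
    using uv(5) v' T by simp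
  then have "ng (ng (sg (?ka \<cdot> v'))) = ng (ng (sg (?ps \<cdot> ?al')))" by simp
  then have "sg (?ka \<cdot> v') = sg (?ps \<cdot> ?al')"
    using v'(1-3) T by simp
  then have kv: "?ka \<cdot> v' = ?ps \<cdot> ?al'"
    by (rule sg_inj) (use v'(1-3) T in simp_all)
  have "v' = ?la \<cdot> ?ka \<cdot> v'" unfolding la_ka using v'(1-3) by simp
  also have "\<dots> = ?la \<cdot> (?ka \<cdot> v')" by (rule cp_assoc) (use v'(1-3) T in simp_all)
  also have "\<dots> = si \<cdot> a \<oplus> sj \<cdot> ng (g \<cdot> b)"
    unfolding kv using T DB DN DQ by simp
  finally have v'_eq: "v' = si \<cdot> a \<oplus> sj \<cdot> ng (g \<cdot> b)" .
  have "?be \<cdot> nq \<cdot> ?ka = ng (g' \<cdot> s \<cdot> sp \<oplus> f' \<cdot> sq)"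
    using T DB DN by simp
  moreover have "sg (?be \<cdot> nq) \<cdot> ng (sg ?ka) = ng (sg (?be \<cdot> nq \<cdot> ?ka))"
    using T by simp
  ultimately have "sg (?be \<cdot> nq) \<cdot> ng (sg ?ka) = sg (g' \<cdot> s \<cdot> sp \<oplus> f' \<cdot> sq)"
    using T by simp
  \<comment> \<open>This is the wanted triangle rotated twice; two backward rotations
    remain.\<close>
  then have "exact u (sg v') (sg (g' \<cdot> s \<cdot> sp \<oplus> f' \<cdot> sq))" using uv(1) v'(4) by simp
  from exact_ng(2)[OF this]
  have "exact (g' \<cdot> s \<cdot> sp \<oplus> f' \<cdot> sq) u (ng (sg v'))"
    by (rule exact_unrot) (use U uv(2-4) v'(1-3) cl T in simp_all)
  then have "exact v' (g' \<cdot> s \<cdot> sp \<oplus> f' \<cdot> sq) u"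
    by (rule exact_unrot) (use v'(1-3) uv(2) cl T in simp_all)
  then show ?thesis
    unfolding v'_eq using T by - (rule hcI[OF _ _ _ _ _ _ _ _ S(1)], simp_all)
qed

text \<open>Weak universality would give some arrow \<open>b\<close> making the diagram commute, but
  not one for which the new square is homotopy cartesian. Such a \<open>b\<close> comes from the
  other end: take any homotopy pullback of \<open>f\<close> along \<open>s\<close>, paste it to the
  first square, and transport it along the isomorphism with the given outer square.\<close>

lemma hc_cancel:
  assumes h: "hc f g f' g'" and o: "hc a2 g2 f' (g' \<cdot> s)" and s: "arr s" "cd s = dm g'"
  obtains b where "hc a2 b f s" "g \<cdot> b = g2" 
proof -
  note d = hcD[OF h] hcD[OF o]
  obtain a b where l: "hc a b f s" using hc_ex[of f s] d s by auto
  note dl = hcD[OF l]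
  obtain x x' where x: "inverses x x'" "dm x = dm a2" "cd x = dm a" "a \<cdot> x = a2" "g \<cdot> b \<cdot> x = g2"
    using hc_unique[OF hc_paste[OF h l] o] .
  have "hc a2 (b \<cdot> x) f s" using hc_iso[OF l x(1,3)] x(4) by simp
  moreover have "g \<cdot> (b \<cdot> x) = g2" using x inversesD(1)[OF x(1)] d dl by simp
  ultimately show ?thesis by (rule that)
qed


section \<open>Comparison with \<open>hcart\<close>, and vanishing criteria\<close>

lemma hcart_hc:
  assumes h: "hcart C T U V P f g f' g'" and o: "T \<in> ob C" "U \<in> ob C" "V \<in> ob C" "P \<in> ob C"
    and m: "f \<in> hom C T U" "g \<in> hom C T V" "f' \<in> hom C V P" "g' \<in> hom C U P"
  shows "hc (Arw T f U) (Arw T g V) (Arw V f' P) (Arw U g' P)"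
proof -
  obtain S i1 i2 p1 p2 k where b: "is_biprod C U V S i1 i2 p1 p2"
    and e: "(T, S, P, add C (cmp C i1 f) (cmp C i2 (neg C g)),
                  add C (cmp C g' p1) (cmp C f' p2), k) \<in> tri C"
    using h unfolding hcart_def by blast
  have "biprod (Arw U i1 S) (Arw V i2 S) (Arw S p1 U) (Arw S p2 V)"
    using b is_biprod_iff[OF o(2,3)] by blast
  moreover have "exact (Arw U i1 S \<cdot> Arw T f U \<oplus> Arw V i2 S \<cdot> ng (Arw T g V))
      (Arw U g' P \<cdot> Arw S p1 U \<oplus> Arw V f' P \<cdot> Arw S p2 V) (Arw P k (sobj C T))"
    using e by (simp add: exact_def mr_simps)
  ultimately show ?thesis
    by - (rule hcI, simp_all add: arr_Arw o m)
qed

lemma exact_one_zero: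
  assumes e: "exact (one Y) g h" shows "zero_obj C (cd g)"
proof (rule zero_objI)
  note d = exactD[OF e]
  show "cd g \<in> ob C" using d by simp
  have Y: "Y \<in> ob C" using arr_ob(1)[OF d(1)] by simp
  have g: "g = zr Y (cd g)" using exact_comp0(1)[OF e] d by simp
  have h: "h = zr (cd g) (sobj C Y)" using exact_comp0(3)[OF e] d Y by simp
  have "h \<cdot> one (cd g) = zr (cd g) (cd h)" using d h by simp
  then obtain v where v: "arr v" "dm v = cd g" "cd v = Y" "g \<cdot> v = one (cd g)"
    using exact_lift[OF exact_rot[OF e], of "one (cd g)"] d by auto
  have "zr Y (cd g) \<cdot> v = one (cd g)" using v(4) g by simp
  then show "one (cd g) = zr (cd g) (cd g)" using v(1-3) d by simp
qed

lemma exact_zero_section: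
  assumes e: "exact f g h" and z: "zero_obj C (cd g)"
  obtains v where "arr v" "dm v = cd f" "cd v = dm f" "f \<cdot> v = one (cd f)"
proof -
  note d = exactD[OF e]
  have "g \<cdot> one (cd f) = zr (cd f) (cd g)"
    using zero_obj_arr(2)[OF z d(2) refl] d by simp
  then show ?thesis using exact_lift[OF e, of "one (cd f)"] d that by auto
qed

lemma exact_zero_first:
  assumes e: "exact f g h" and z: "zero_obj C (cd f)" "zero_obj C (cd g)"
  shows "zero_obj C (dm f)"
proof (rule zero_objI)
  note d = exactD[OF e]
  let ?S = "sobj C (dm f)"
  have "ng (sg f) \<cdot> one ?S = zr ?S (sobj C (cd f))"
    using zero_obj_arr(2)[OF zero_obj_sobj[OF z(1)], of "ng (sg f)"] d by simp
  then obtain v where v: "arr v" "dm v = ?S" "cd v = cd g" "h \<cdot> v = one ?S"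
    using exact_lift[OF exact_rot[OF exact_rot[OF e]], of "one ?S"] d by auto
  have "v = zr ?S (cd g)" using zero_obj_arr(2)[OF z(2) v(1,3)] v(2) by simp
  then have "one ?S = zr ?S ?S" using v(4) d by simp
  then have "sg (one (dm f)) = sg (zr (dm f) (dm f))" using d by simp
  then show "one (dm f) = zr (dm f) (dm f)" by (rule sg_inj) (use d in simp_all)
  show "dm f \<in> ob C" using d by simp
qed

lemma hc_zero:
  assumes h: "hc f g f' g'" and z: "zero_obj C (cd f)" "zero_obj C (cd g)" "zero_obj C (cd f')"
  shows "zero_obj C (dm f)"
proof -
  note d = hcD[OF h]
  obtain i j p q k where B: "biprod i j p q" "dm i = cd f" "dm j = cd g"
    and e: "exact (i \<cdot> f \<oplus> j \<cdot> ng g) (g' \<cdot> p \<oplus> f' \<cdot> q) k"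
    using hc_ex_biprod[OF h] .
  note D = biprodD[OF B(1)]
  have "p = zr (cd i) (cd f)" "q = zr (cd i) (cd g)"
    using zero_obj_arr(2)[OF z(1), of p] zero_obj_arr(2)[OF z(2), of q] D B(2,3) by simp_all
  then have "one (cd i) = zr (cd i) (cd i)" using biprod_sum(1)[OF B(1)] D(1,2,5) B(2,3) by simp
  then have "zero_obj C (cd i)" using D by (intro zero_objI) simp_all
  then show ?thesis using exact_zero_first[OF e] z d by simp
qed

text \<open>Realises \<open>k\<close> as the class of an extension: a fibre of \<open>k\<close> is
  the middle object, and the map into it desuspends.\<close>

lemma exact_connecting_ex:
  assumes "arr k" "cd k = sobj C A" "A \<in> ob C"
  obtains f g where "exact f g k" "dm f = A"
proof -
  obtain g w where e: "exact g k w" using exact_fiber_ex[OF assms(1)] .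
  note d = exactD[OF e]
  obtain w0 where w: "arr w0" "dm w0 = A" "cd w0 = dm g" "w = sg w0"
    using sg_surj[of w A "dm g"] d assms by auto
  have "exact g k (ng (sg (ng w0)))" using e w by simp
  then have "exact (ng w0) g k" by (rule exact_unrot) (use w assms in simp_all)
  then show ?thesis using that w by simp
qed

section \<open>Thick subcategories and towers\<close>

lemma thick1_ob: "Z \<in> thick1 C X \<Longrightarrow> Z \<in> ob C"
  by (induction rule: thick1.induct) (simp_all add: is_biprod_def)

lemma thick1_trans:
  assumes "Z \<in> thick1 C Y" "Y \<in> thick1 C X" shows "Z \<in> thick1 C X"
  using assms(1)
proof (induction rule: thick1.induct)
  case base
  show ?case by (rule assms(2))
next
  case (susp Z)
  show ?case by (rule thick1.susp[OF susp.IH])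
next
  case (desusp Z)
  show ?case by (rule thick1.desusp[OF desusp.hyps(1) desusp.IH])
next
  case (zero Z)
  then show ?case by (rule thick1.zero)
next
  case (sum A B S i1 i2 p1 p2)
  show ?case by (rule thick1.sum[OF sum.IH sum.hyps(3)])
next
  case (retract Z W r s)
  show ?case by (rule thick1.retract[OF retract.hyps(1) retract.IH retract.hyps(3-5)])
qed

lemma thick1_retract:
  assumes "dm r \<in> thick1 C X" "arr r" "arr s" "dm s = cd r" "cd s = dm r" "r \<cdot> s = one (cd r)"
  shows "cd r \<in> thick1 C X"
proof (rule thick1.retract[OF _ assms(1)])
  show "mr r \<in> hom C (dm r) (cd r)" "mr s \<in> hom C (cd r) (dm r)"
    using assms(2-5) arr_mr[of r] arr_mr[of s] by simp_all
  show "cmp C (mr r) (mr s) = idt C (cd r)"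
    using arg_cong[OF assms(6), of mr] by (simp add: mr_simps)
qed (use assms in simp)

lemma thick1_iso:
  assumes "inverses a b" shows "dm a \<in> thick1 C X \<longleftrightarrow> cd a \<in> thick1 C X"
  by (metis thick1_retract[of a X b] thick1_retract[of b X a] inversesD[OF assms])

lemma thick1_biprod:
  assumes b: "biprod i j p q" "dm i \<in> thick1 C X" "dm j \<in> thick1 C X"
  shows "cd i \<in> thick1 C X"
proof -
  note D = biprodD[OF b(1)]
  have "is_biprod C (dm i) (dm j) (cd i) (mr i) (mr j) (mr p) (mr q)"
    using is_biprod_iff[of "dm i" "dm j"] b(1) D
    by (metis arr_ob(1,2) arw.collapse)
  then show ?thesis using b by (auto intro: thick1.sum)
qed

text \<open>If the cone projection of \<open>f\<close> factors through \<open>g\<close>, the octahedron of \<open>g \<cdot> f\<close> splits.\<close>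

lemma thick1_cone_comp:
  assumes e: "exact f f1 f2" "exact g g1 g2" and t: "dm g = cd f"
    and x: "arr x" "dm x = cd g" "x \<cdot> g = f1"
    and c: "cd f1 \<in> thick1 C X" "cd g1 \<in> thick1 C X"
  obtains h1 h2 where "exact (g \<cdot> f) h1 h2" "cd h1 \<in> thick1 C X"
proof -
  note d = exactD[OF e(1)] exactD[OF e(2)]
  have "arr (g \<cdot> f)" using d t by simp
  then obtain h1 h2 where h: "exact (g \<cdot> f) h1 h2" by (rule exact_ex)
  obtain u v where uv: "exact u v (sg f1 \<cdot> g2)" "dm u = cd f1" "cd u = cd h1" "cd v = cd g1"
    using octahedral[OF e h t] by metis
  have cx: "cd x = cd f1" using x(3) by (metis dm_cd_simps(2))
  have "sg f1 \<cdot> g2 = sg x \<cdot> (sg g \<cdot> g2)" unfolding x(3)[symmetric] using x(1,2) d t by simp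
  also have "\<dots> = zr (cd g1) (sobj C (cd f1))"
    unfolding exact_comp0(3)[OF e(2)] using x(1,2) cx d by simp
  finally have "exact u v (zr (cd v) (sobj C (dm u)))" using uv by simp
  then obtain s r where b: "biprod u s r v" by (rule exact_split)
  have "cd h1 \<in> thick1 C X"
    using thick1_biprod[OF b] biprodD[OF b] uv c by simp
  then show ?thesis using that h by blast
qed

text \<open>A version of \<open>thick\<close> without complements at the intermediate stages.
  Retracts are taken once, at the end, so that the functor can be applied to honest
  triangles.\<close>

primrec tower :: "nat \<Rightarrow> 'o \<Rightarrow> 'o \<Rightarrow> bool" where
  "tower 0 X Y \<longleftrightarrow> zero_obj C Y"
| "tower (Suc n) X Y \<longleftrightarrow> (\<exists>f g h. exact f g h \<and> cd f = Y \<and> dm f \<in> thick1 C X \<and> tower n X (cd g))"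

lemma tower_SucI:
  "exact f g h \<Longrightarrow> dm f \<in> thick1 C X \<Longrightarrow> tower n X (cd g) \<Longrightarrow> tower (Suc n) X (cd f)"
  unfolding tower.simps by (intro exI conjI) (assumption | rule refl)+

definition retract_of :: "'o \<Rightarrow> 'o \<Rightarrow> bool" where
  "retract_of Z Y \<longleftrightarrow> (\<exists>r s. arr r \<and> arr s \<and> dm r = Y \<and> cd r = Z \<and> dm s = Z \<and> cd s = Y \<and> r \<cdot> s = one Z)"

lemma retract_of_refl: "Y \<in> ob C \<Longrightarrow> retract_of Y Y"
  unfolding retract_of_def by (rule exI[of _ "one Y"], rule exI[of _ "one Y"]) simp

lemma retract_of_ob: "retract_of Z Y \<Longrightarrow> Z \<in> ob C" "retract_of Z Y \<Longrightarrow> Y \<in> ob C"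
  unfolding retract_of_def by auto

lemma retract_of_trans:
  assumes "retract_of X Y" "retract_of Y Z" shows "retract_of X Z"
proof -
  obtain r s where r: "arr r" "arr s" "dm r = Y" "cd r = X" "dm s = X" "cd s = Y" "r \<cdot> s = one X"
    using assms(1) unfolding retract_of_def by blast
  obtain r' s' where r': "arr r'" "arr s'" "dm r' = Z" "cd r' = Y" "dm s' = Y" "cd s' = Z" "r' \<cdot> s' = one Y"
    using assms(2) unfolding retract_of_def by blast
  have "r \<cdot> r' \<cdot> (s' \<cdot> s) = one X"
    using r r' cp_reduce[OF r'(7), of s] by simp
  then show ?thesis unfolding retract_of_def using r r'
    by (intro exI[of _ "r \<cdot> r'"] exI[of _ "s' \<cdot> s"]) simp
qed

lemma tower_of_thick1:
  assumes "Y \<in> thick1 C X" shows "tower (Suc 0) X Y"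
proof -
  obtain Z where Z: "zero_obj C Z" using zero_obj_ex by blast
  show ?thesis using tower_SucI[OF exact_triv[OF thick1_ob[OF assms] Z], of X 0] Z assms by simp
qed

text \<open>Retracts move outward: a retract of the third object of a triangle can be exchanged for
  a retract of the middle object.\<close>

lemma thick_retract_of_tower:
  "Y \<in> thick C n X \<Longrightarrow> \<exists>Y'. tower n X Y' \<and> retract_of Y Y'"
proof (induction n arbitrary: Y rule: induct_nat_012)
  case 0
  then show ?case using retract_of_refl[of Y] by auto
next
  case 1
  then have "Y \<in> thick1 C X" by simp
  then show ?case using tower_of_thick1 retract_of_refl thick1_ob by blast
next
  case (ge2 n)
  obtain Yt S i1 i2 p1 p2 A B a b c where
    Y: "Y \<in> ob C" "Yt \<in> ob C" "is_biprod C Y Yt S i1 i2 p1 p2" "(A, S, B, a, b, c) \<in> tri C"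
      "A \<in> thick1 C X" "B \<in> thick C (Suc n) X"
    using ge2.prems by auto
  have bp: "biprod (Arw Y i1 S) (Arw Yt i2 S) (Arw S p1 Y) (Arw S p2 Yt)"
    using Y is_biprod_iff by blast
  have YS: "retract_of Y S" unfolding retract_of_def
    using biprodD[OF bp] by (intro exI[of _ "Arw S p1 Y"] exI[of _ "Arw Y i1 S"]) simp
  define f g h where "f = Arw A a S" and "g = Arw S b B" and "h = Arw B c (sobj C A)"
  have e: "exact f g h" and fgh: "dm f = A" "cd f = S" "cd g = B"
    using Y by (simp_all add: exact_def f_def g_def h_def)
  note d = exactD[OF e]
  obtain B' where B': "tower (Suc n) X B'" "retract_of B B'" using ge2.IH(2)[OF Y(6)] by blast
  obtain r s where r: "arr r" "arr s" "dm r = B'" "cd r = B" "dm s = B" "cd s = B'" "r \<cdot> s = one B"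
    using B'(2) unfolding retract_of_def by blast
  have A: "A \<in> ob C" "S \<in> ob C" "B \<in> ob C"
    using d(1,2) fgh arr_ob by metis+
  \<comment> \<open>The extension class \<open>h\<close> is pulled back along the retraction from
    \<open>B'\<close> to \<open>B\<close>; its middle object \<open>cd f'\<close> replaces
    \<open>S\<close>.\<close>
  have hr: "arr (h \<cdot> r)" "cd (h \<cdot> r) = sobj C A" using d r fgh by simp_all
  obtain f' g' where e': "exact f' g' (h \<cdot> r)" "dm f' = A"
    using exact_connecting_ex[OF hr A(1)] .
  note d' = exactD[OF e'(1)]
  have cg': "cd g' = B'" using d' r by simp
  \<comment> \<open>\<open>x\<close> lies over \<open>s\<close> and \<open>y\<close> over
    \<open>r\<close>, both over the identity of \<open>A\<close>. As \<open>r \<cdot> s\<close> is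
    an identity, \<open>y \<cdot> x\<close> induces identities at both ends and is
    invertible.\<close>
  obtain x where x: "arr x" "dm x = S" "cd x = cd f'" "x \<cdot> f = f'" "s \<cdot> g = g' \<cdot> x"
    using exact_fill_middle[OF e e'(1), of "one A" s] d d' r fgh cg' e'(2) A by auto
  obtain y where y: "arr y" "dm y = cd f'" "cd y = S" "y \<cdot> f' = f" "r \<cdot> g' = g \<cdot> y"
    using exact_fill_middle[OF e'(1) e, of "one A" r] d d' r fgh cg' e'(2) A by auto
  have "g \<cdot> (y \<cdot> x) = g \<cdot> y \<cdot> x" using x(1-3) y(1-3) d fgh by simp
  also have "\<dots> = r \<cdot> (g' \<cdot> x)" unfolding y(5)[symmetric] using x(1-3) r(1-6) d' cg' by simp
  also have "\<dots> = r \<cdot> s \<cdot> g" unfolding x(5)[symmetric] using r(1-6) d fgh by simp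
  also have "\<dots> = g" unfolding r(7) using d fgh by simp
  finally have gyx: "g \<cdot> (y \<cdot> x) = g" .
  obtain z where z: "inverses (y \<cdot> x) z"
    by (rule exact_endo_iso[OF e, of "y \<cdot> x"]) (use gyx x y d fgh in simp_all)
  have "retract_of S (cd f')" unfolding retract_of_def
    using inversesD[OF z] x(1-3) y(1-3) by (intro exI[of _ "z \<cdot> y"] exI[of _ x]) simp
  then have "retract_of Y (cd f')" using retract_of_trans[OF YS] by blast
  moreover have "tower (Suc (Suc n)) X (cd f')"
    using tower_SucI[OF e'(1), of X "Suc n"] e'(2) Y(5) B'(1) cg' by simp
  ultimately show ?case by blast
qed

lemma thick_SucI:
  assumes "Y \<in> ob C" "Yt \<in> ob C" "is_biprod C Y Yt S i1 i2 p1 p2" "(A, S, B, a, b, c) \<in> tri C"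
    "A \<in> thick1 C X" "B \<in> thick C (Suc n) X"
  shows "Y \<in> thick C (Suc (Suc n)) X"
  unfolding thick.simps
  by (rule CollectI, rule conjI, rule assms(1), rule exI[of _ Yt], rule exI[of _ S],
      rule exI[of _ i1], rule exI[of _ i2], rule exI[of _ p1], rule exI[of _ p2], rule exI[of _ A],
      rule exI[of _ B], rule exI[of _ a], rule exI[of _ b], rule exI[of _ c])
    (use assms in simp)

text \<open>\<open>thick\<close> asks for an actual complement, not just a retraction. The cone of
  the section \<open>i\<close> provides one, since a triangle on a split mono splits.\<close>

lemma thick_retract_closed:
  assumes Y: "Y \<in> thick C (Suc n) X" and ZY: "retract_of Z Y"
  shows "Z \<in> thick C (Suc n) X"
proof -
  obtain r s where r: "arr r" "arr s" "dm r = Y" "cd r = Z" "dm s = Z" "cd s = Y" "r \<cdot> s = one Z"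
    using ZY unfolding retract_of_def by blast
  show ?thesis
  proof (cases n)
    case 0
    then show ?thesis using Y thick1_retract[of r X s] r by simp
  next
    case (Suc m)
    obtain Yt S i1 i2 p1 p2 A B a b c where
      Y: "Y \<in> ob C" "Yt \<in> ob C" "is_biprod C Y Yt S i1 i2 p1 p2" "(A, S, B, a, b, c) \<in> tri C"
        "A \<in> thick1 C X" "B \<in> thick C n X"
      using Y Suc by auto
    have bp: "biprod (Arw Y i1 S) (Arw Yt i2 S) (Arw S p1 Y) (Arw S p2 Yt)"
      using Y is_biprod_iff by blast
    have "retract_of Y S" unfolding retract_of_def
      using biprodD[OF bp] by (intro exI[of _ "Arw S p1 Y"] exI[of _ "Arw Y i1 S"]) simp
    then have "retract_of Z S" using retract_of_trans[OF ZY] by blast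
    then obtain p i where p: "arr p" "arr i" "dm p = S" "cd p = Z" "dm i = Z" "cd i = S" "p \<cdot> i = one Z"
      unfolding retract_of_def by blast
    obtain g h where e: "exact i g h" using exact_ex[OF p(2)] .
    have "exact i g (zr (cd g) (sobj C (dm i)))"
      using exact_retract_split[OF e, of p] p e by simp
    then obtain s' r' where b: "biprod i s' r' g" by (rule exact_split)
    note D = biprodD[OF b]
    have "biprod (Arw Z (mr i) S) (Arw (cd g) (mr s') S) (Arw S (mr r') Z) (Arw S (mr g) (cd g))"
      using b D(5-9) p(5,6) arw.collapse[of i] arw.collapse[of s'] arw.collapse[of r'] arw.collapse[of g]
      by simp
    moreover have o: "Z \<in> ob C" "S \<in> ob C" "cd g \<in> ob C" using p(2,5,6) D(4) arr_ob by metis+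
    ultimately have "is_biprod C Z (cd g) S (mr i) (mr s') (mr r') (mr g)"
      using is_biprod_iff by blast
    from thick_SucI[OF o(1,3) this Y(4,5)] show ?thesis using Y(6) Suc by simp
  qed
qed

text \<open>In the last step the cone is zero, so \<open>Y\<close> is a retract of an object of
  \<open>thick1\<close>. In the other steps a zero object serves as the complement.\<close>

lemma tower_thick: "tower (Suc n) X Y \<Longrightarrow> Y \<in> thick C (Suc n) X"
proof (induction n arbitrary: Y)
  case 0
  then obtain f g h where e: "exact f g h" "cd f = Y" "dm f \<in> thick1 C X" "zero_obj C (cd g)"
    by auto
  obtain v where "arr v" "dm v = cd f" "cd v = dm f" "f \<cdot> v = one (cd f)"
    using exact_zero_section[OF e(1,4)] .
  then show ?case using thick1_retract[OF e(3), of v] exactD(1)[OF e(1)] e(2) by simp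
next
  case (Suc n)
  then obtain f g h where e: "exact f g h" "cd f = Y" "dm f \<in> thick1 C X" "tower (Suc n) X (cd g)"
    by (subst (asm) tower.simps) blast
  note d = exactD[OF e(1)]
  obtain Z where Z: "zero_obj C Z" using zero_obj_ex by blast
  have Y: "Y \<in> ob C" using d(1) e(2) by auto
  have "biprod (one Y) (zr Z Y) (one Y) (zr Y Z)"
    unfolding biprod_def using Y Z zero_obj_one[OF Z] by simp
  then have "is_biprod C Y Z Y (idt C Y) (zer C Z Y) (idt C Y) (zer C Y Z)"
    using Y Z is_biprod_iff by (simp add: one_def zr_def)
  moreover have "(dm f, Y, cd g, mr f, mr g, mr h) \<in> tri C" using e by (simp add: exact_def)
  ultimately show ?case
    using thick_SucI[OF Y zero_obj_ob[OF Z] _ _ e(3) Suc.IH[OF e(4)]] by blast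
qed

text \<open>The tower is padded with zero triangles to all indices, so diagonals may run past its
  end without case distinctions.\<close>

lemma tower_sequence:
  "tower n X Y \<Longrightarrow> \<exists>Z f g h. Z 0 = Y \<and>
     (\<forall>k. exact (f k) (g k) (h k) \<and> cd (f k) = Z k \<and> cd (g k) = Z (Suc k) \<and> dm (f k) \<in> thick1 C X) \<and>
     (\<forall>k\<ge>n. zero_obj C (Z k))"
proof (induction n arbitrary: Y)
  case 0
  then have "zero_obj C Y" by simp
  then show ?case
    using exact_triv[of Y Y] thick1.zero[of C Y X]
    by (intro exI[of _ "\<lambda>_. Y"] exI[of _ "\<lambda>_. one Y"] exI[of _ "\<lambda>_. zr Y Y"] exI[of _ "\<lambda>_. zr Y (sobj C Y)"])
      simp
next
  case (Suc n)
  then obtain f0 g0 h0 where e: "exact f0 g0 h0" "cd f0 = Y" "dm f0 \<in> thick1 C X" "tower n X (cd g0)"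
    by auto
  obtain Z f g h where Z: "Z 0 = cd g0"
     "\<forall>k. exact (f k) (g k) (h k) \<and> cd (f k) = Z k \<and> cd (g k) = Z (Suc k) \<and> dm (f k) \<in> thick1 C X"
     "\<forall>k\<ge>n. zero_obj C (Z k)"
    using Suc.IH[OF e(4)] by metis
  show ?case
    by (rule exI[of _ "case_nat Y Z"], rule exI[of _ "case_nat f0 f"], rule exI[of _ "case_nat g0 g"],
        rule exI[of _ "case_nat h0 h"]) (use Z e in \<open>auto split: nat.splits simp: Suc_le_eq\<close>)
qed

text \<open>The diagonal construction controls cones, while \<open>tower\<close> records fibres.
  They differ by a suspension, under which \<open>thick1\<close> is closed in both
  directions.\<close>

lemma sequence_tower:
  assumes "\<And>k. \<exists>g h. exact (s k) g h \<and> dm (s k) = W k \<and> cd (s k) = W (Suc k) \<and> cd g \<in> thick1 C X"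
    and "zero_obj C (W n)"
  shows "tower n X (W 0)"
  using assms
proof (induction n arbitrary: s W)
  case 0
  then show ?case by simp
next
  case (Suc n)
  have "tower n X (W (Suc 0))"
    using Suc.IH[of "\<lambda>k. s (Suc k)" "\<lambda>k. W (Suc k)"] Suc.prems by blast
  moreover
  obtain g h where e: "exact (s 0) g h" "dm (s 0) = W 0" "cd (s 0) = W (Suc 0)" "cd g \<in> thick1 C X"
    using Suc.prems(1)[of 0] by auto
  obtain u w where u: "exact u (s 0) w" using exact_fiber_ex exactD(1)[OF e(1)] .
  note du = exactD[OF u]
  obtain c c' where c: "inverses c c'" "dm c = cd w" "cd c = cd g"
    using cone_unique[OF exact_rot[OF u] e(1)] by metis
  have "sobj C (dm u) \<in> thick1 C X" using thick1_iso[OF c(1)] c(2,3) e(4) du by simp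
  then have "dm u \<in> thick1 C X" using du by - (rule thick1.desusp, simp_all)
  ultimately show ?case using tower_SucI[OF u, of X n] e du by simp
qed

end


section \<open>Exact and biexact functors\<close>

text \<open>A biexact functor with one argument fixed, so that facts about \<open>thick1\<close>
  serve both variables. Additivity is not among the assumptions and has to be replaced by
  exactness.\<close>

locale exact_functor = S: tricat S + U: tricat U
  for S :: "('a, 'b) tcat" and U :: "('e, 'f) tcat" +
  fixes Go :: "'a \<Rightarrow> 'e" and Gm :: "'b \<Rightarrow> 'f" and et :: "'a \<Rightarrow> 'f"
  assumes Go_ob: "X \<in> ob S \<Longrightarrow> Go X \<in> ob U"
    and Gm_idt: "X \<in> ob S \<Longrightarrow> Gm (idt S X) = idt U (Go X)"
    and Gm_hom: "X \<in> ob S \<Longrightarrow> Y \<in> ob S \<Longrightarrow> f \<in> hom S X Y \<Longrightarrow> Gm f \<in> hom U (Go X) (Go Y)"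
    and Gm_cmp: "X \<in> ob S \<Longrightarrow> Y \<in> ob S \<Longrightarrow> Z \<in> ob S \<Longrightarrow> f \<in> hom S X Y \<Longrightarrow> g \<in> hom S Y Z \<Longrightarrow>
      Gm (cmp S g f) = cmp U (Gm g) (Gm f)"
    and et_iso: "X \<in> ob S \<Longrightarrow> iso_mor U (Go (sobj S X)) (sobj U (Go X)) (et X)"
    and G_tri: "(A, B, D, a, b, c) \<in> tri S \<Longrightarrow>
      (Go A, Go B, Go D, Gm a, Gm b, cmp U (et A) (Gm c)) \<in> tri U"
begin

definition Ga :: "('a, 'b) arw \<Rightarrow> ('e, 'f) arw" where
  "Ga a = Arw (Go (dm a)) (Gm (mr a)) (Go (cd a))"

lemma dm_cd_Ga [simp]: "dm (Ga a) = Go (dm a)" "cd (Ga a) = Go (cd a)"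
  by (simp_all add: Ga_def)

lemma arr_Ga: "S.arr a \<Longrightarrow> U.arr (Ga a)"
  using Gm_hom[OF S.arr_ob S.arr_mr] Go_ob[OF S.arr_ob(1)] Go_ob[OF S.arr_ob(2)]
  by (auto simp: Ga_def intro: U.arr_Arw)

lemma Ga_one: "X \<in> ob S \<Longrightarrow> Ga (S.one X) = U.one (Go X)"
  by (simp add: Ga_def S.mr_simps Gm_idt U.one_def)

lemma Ga_cp:
  assumes "S.arr a" "S.arr b" "dm a = cd b" shows "Ga (S.cp a b) = U.cp (Ga a) (Ga b)"
  using Gm_cmp[of "dm b" "cd b" "cd a" "mr b" "mr a"] assms S.arr_mr[of a] S.arr_mr[of b]
  by (simp add: Ga_def S.mr_simps U.cp_def)

lemma Ga_exact:
  assumes e: "S.exact f g h"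
  shows "U.exact (Ga f) (Ga g) (U.cp (Arw (Go (sobj S (dm f))) (et (dm f)) (sobj U (Go (dm f)))) (Ga h))"
  using e G_tri[of "dm f" "cd f" "cd g" "mr f" "mr g" "mr h"] S.exactD[OF e]
  by (simp add: S.exact_def U.exact_def Ga_def U.cp_def)

lemma et_inverses:
  assumes X: "X \<in> ob S"
  obtains b where "U.inverses (Arw (Go (sobj S X)) (et X) (sobj U (Go X))) b"
  by (rule U.iso_mor_inverses[OF et_iso[OF X]]) (simp_all add: X Go_ob)

text \<open>\<open>Z\<close> is a cone of its own identity. Its image is then a cone of an identity,
  and such a cone is zero.\<close>

lemma Go_zero:
  assumes Z: "zero_obj S Z" shows "zero_obj U (Go Z)"
proof -
  have "Z \<in> ob S" using Z by simp
  from Ga_exact[OF S.exact_triv[OF this Z]] show ?thesis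
    using U.exact_one_zero Ga_one[OF \<open>Z \<in> ob S\<close>] by (metis dm_cd_Ga(2) S.dm_cd_simps(8))
qed

lemma Go_thick1:
  assumes "A \<in> thick1 S X" "X \<in> ob S" shows "Go A \<in> thick1 U (Go X)"
  using assms(1)
proof (induction rule: thick1.induct)
  case base
  then show ?case by (intro thick1.base Go_ob)
next
  case (susp Y)
  have Y: "Y \<in> ob S" by (rule S.thick1_ob[OF susp.hyps])
  obtain b where "U.inverses (Arw (Go (sobj S Y)) (et Y) (sobj U (Go Y))) b"
    by (rule et_inverses[OF Y])
  from U.thick1_iso[OF this, of "Go X"] show ?case using thick1.susp[OF susp.IH] by simp
next
  case (desusp Z)
  obtain b where "U.inverses (Arw (Go (sobj S Z)) (et Z) (sobj U (Go Z))) b"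
    by (rule et_inverses[OF desusp.hyps(1)])
  from U.thick1_iso[OF this, of "Go X"] have "sobj U (Go Z) \<in> thick1 U (Go X)"
    using desusp.IH by simp
  then show ?case by (rule thick1.desusp[OF Go_ob[OF desusp.hyps(1)]])
next
  case (zero Z)
  then show ?case by (intro thick1.zero Go_zero)
next
  case (sum A B Q i1 i2 p1 p2)
  have ob: "A \<in> ob S" "B \<in> ob S" using sum.hyps S.thick1_ob by blast+
  let ?i = "Arw A i1 Q" and ?j = "Arw B i2 Q" and ?p = "Arw Q p1 A" and ?q = "Arw Q p2 B"
  have b: "S.biprod ?i ?j ?p ?q" using S.is_biprod_iff[OF ob] sum.hyps(3) by blast
  note D = S.biprodD[OF b]
  \<comment> \<open>Without additivity the image of a biproduct is recognised through its triangle: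
    the image of \<open>?p\<close> retracts the image of \<open>?i\<close>, so the image triangle
    splits.\<close>
  have e: "U.exact (Ga ?i) (Ga ?q) (U.cp (Arw (Go (sobj S A)) (et A) (sobj U (Go A)))
      (Ga (S.zr (cd ?q) (sobj S (dm ?i)))))" (is "U.exact _ _ ?h")
    using Ga_exact[OF S.biprod_exact[OF b]] by simp
  have "U.cp (Ga ?p) (Ga ?i) = U.one (dm (Ga ?i))"
    using Ga_cp[OF D(3,1)] D(10) Ga_one[OF ob(1)] by simp
  then have "?h = U.zr (cd (Ga ?q)) (sobj U (dm (Ga ?i)))"
    using U.exact_retract_split[OF e arr_Ga[OF D(3)]] by simp
  with e obtain s r where b': "U.biprod (Ga ?i) s r (Ga ?q)" using U.exact_split by metis
  have "cd (Ga ?i) \<in> thick1 U (Go X)"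
    using U.thick1_biprod[OF b'] U.biprodD(9)[OF b'] sum.IH by simp
  then show ?case by simp
next
  case (retract Z Y r s)
  have Y: "Y \<in> ob S" using retract.hyps S.thick1_ob by blast
  let ?r = "Arw Y r Z" and ?s = "Arw Z s Y"
  have a: "S.arr ?r" "S.arr ?s" using retract.hyps Y by (simp_all add: S.arr_Arw)
  have "S.cp ?r ?s = S.one Z" using retract.hyps by (simp add: S.cp_def S.one_def)
  then have "U.cp (Ga ?r) (Ga ?s) = U.one (Go Z)"
    using Ga_cp[OF a] Ga_one[OF retract.hyps(1)] by simp
  then show ?case using U.thick1_retract[of "Ga ?r" "Go X" "Ga ?s"] arr_Ga[OF a(1)] arr_Ga[OF a(2)]
      retract.IH by simp
qed

end

section \<open>Biexact functors with a strong Verdier structure\<close>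

locale verdier = S: tricat S + T: tricat T + U: tricat U
  for S :: "('a, 'b) tcat" and T :: "('c, 'd) tcat" and U :: "('e, 'f) tcat" +
  fixes Fo :: "'a \<Rightarrow> 'c \<Rightarrow> 'e" and Fm :: "'b \<Rightarrow> 'd \<Rightarrow> 'f"
    and th :: "'a \<Rightarrow> 'c \<Rightarrow> 'f" and ze :: "'a \<Rightarrow> 'c \<Rightarrow> 'f"
  assumes biex: "biexact S T U Fo Fm th ze"
    and sv: "strong_verdier S T U Fo Fm th ze"
begin

lemma F_ob: "X \<in> ob S \<Longrightarrow> X' \<in> ob T \<Longrightarrow> Fo X X' \<in> ob U"
  and F_idt: "X \<in> ob S \<Longrightarrow> X' \<in> ob T \<Longrightarrow> Fm (idt S X) (idt T X') = idt U (Fo X X')"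
proof -
  have "\<forall>X\<in>ob S. \<forall>X'\<in>ob T. Fo X X' \<in> ob U \<and> Fm (idt S X) (idt T X') = idt U (Fo X X')"
    using biex unfolding biexact_def by (elim conjE) assumption
  then show "X \<in> ob S \<Longrightarrow> X' \<in> ob T \<Longrightarrow> Fo X X' \<in> ob U"
    "X \<in> ob S \<Longrightarrow> X' \<in> ob T \<Longrightarrow> Fm (idt S X) (idt T X') = idt U (Fo X X')" by blast+
qed

lemma F_hom:
  assumes "X \<in> ob S" "Y \<in> ob S" "X' \<in> ob T" "Y' \<in> ob T" "f \<in> hom S X Y" "f' \<in> hom T X' Y'"
  shows "Fm f f' \<in> hom U (Fo X X') (Fo Y Y')"
proof -
  have "\<forall>X\<in>ob S. \<forall>Y\<in>ob S. \<forall>X'\<in>ob T. \<forall>Y'\<in>ob T. \<forall>f\<in>hom S X Y. \<forall>f'\<in>hom T X' Y'.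
         Fm f f' \<in> hom U (Fo X X') (Fo Y Y')"
    using biex unfolding biexact_def by (elim conjE) assumption
  then show ?thesis using assms by blast
qed

lemma F_cmp:
  assumes "X \<in> ob S" "Y \<in> ob S" "Z \<in> ob S" "X' \<in> ob T" "Y' \<in> ob T" "Z' \<in> ob T"
    "f \<in> hom S X Y" "g \<in> hom S Y Z" "f' \<in> hom T X' Y'" "g' \<in> hom T Y' Z'"
  shows "Fm (cmp S g f) (cmp T g' f') = cmp U (Fm g g') (Fm f f')"
proof -
  have "\<forall>X\<in>ob S. \<forall>Y\<in>ob S. \<forall>Z\<in>ob S. \<forall>X'\<in>ob T. \<forall>Y'\<in>ob T. \<forall>Z'\<in>ob T. \<forall>f g f' g'.
         f \<in> hom S X Y \<and> g \<in> hom S Y Z \<and> f' \<in> hom T X' Y' \<and> g' \<in> hom T Y' Z'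
         \<longrightarrow> Fm (cmp S g f) (cmp T g' f') = cmp U (Fm g g') (Fm f f')"
    using biex unfolding biexact_def by (elim conjE) assumption
  then show ?thesis using assms by blast
qed

definition Fa :: "('a, 'b) arw \<Rightarrow> ('c, 'd) arw \<Rightarrow> ('e, 'f) arw" where
  "Fa a b = Arw (Fo (dm a) (dm b)) (Fm (mr a) (mr b)) (Fo (cd a) (cd b))"

lemma dm_cd_Fa [simp]: "dm (Fa a b) = Fo (dm a) (dm b)" "cd (Fa a b) = Fo (cd a) (cd b)"
  by (simp_all add: Fa_def)

lemma arr_Fa [simp]:
  assumes "S.arr a" "T.arr b" shows "U.arr (Fa a b)"
  unfolding Fa_def using assms
  by (intro U.arr_Arw F_ob F_hom) (simp_all add: S.arr_mr T.arr_mr)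

lemma Fa_one: "X \<in> ob S \<Longrightarrow> X' \<in> ob T \<Longrightarrow> Fa (S.one X) (T.one X') = U.one (Fo X X')"
  by (simp add: Fa_def S.mr_simps T.mr_simps F_idt U.one_def)

lemma Fa_cp:
  assumes "S.arr a" "S.arr b" "dm a = cd b" "T.arr a'" "T.arr b'" "dm a' = cd b'"
  shows "Fa (S.cp a b) (T.cp a' b') = U.cp (Fa a a') (Fa b b')"
  using F_cmp[of "dm b" "cd b" "cd a" "dm b'" "cd b'" "cd a'" "mr b" "mr a" "mr b'" "mr a'"] assms
    S.arr_mr[of a] S.arr_mr[of b] T.arr_mr[of a'] T.arr_mr[of b']
  by (simp add: Fa_def S.mr_simps T.mr_simps U.cp_def)

lemma exact_functor_left:
  assumes X': "X' \<in> ob T"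
  shows "exact_functor S U (\<lambda>X. Fo X X') (\<lambda>f. Fm f (idt T X')) (\<lambda>X. th X X')"
proof unfold_locales
  have i: "idt T X' \<in> hom T X' X'" using T.arr_mr[OF T.arr_one[OF X']] by (simp add: T.mr_simps)
  have ii: "cmp T (idt T X') (idt T X') = idt T X'"
    using T.cp_one(1)[OF T.arr_one[OF X'], of X'] by (simp add: T.cp_def T.one_def)
  fix X Y Z f g
  assume X: "X \<in> ob S"
  show "Fo X X' \<in> ob U" "Fm (idt S X) (idt T X') = idt U (Fo X X')" using X X' F_ob F_idt by blast+
  show "iso_mor U (Fo (sobj S X) X') (sobj U (Fo X X')) (th X X')"
  proof -
    have "\<forall>X\<in>ob S. \<forall>X'\<in>ob T. iso_mor U (Fo (sobj S X) X') (sobj U (Fo X X')) (th X X')"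
      using biex unfolding biexact_def by (elim conjE) assumption
    then show ?thesis using X X' by blast
  qed
  assume Y: "Y \<in> ob S" and f: "f \<in> hom S X Y"
  show "Fm f (idt T X') \<in> hom U (Fo X X') (Fo Y X')" by (rule F_hom[OF X Y X' X' f i])
  assume Z: "Z \<in> ob S" and g: "g \<in> hom S Y Z"
  show "Fm (cmp S g f) (idt T X') = cmp U (Fm g (idt T X')) (Fm f (idt T X'))"
    using F_cmp[OF X Y Z X' X' X' f g i i] ii by simp
next
  fix A B D a b c
  assume t: "(A, B, D, a, b, c) \<in> tri S"
  have "\<forall>X'\<in>ob T. \<forall>A B C a b c. (A,B,C,a,b,c) \<in> tri S \<longrightarrow>
        (Fo A X', Fo B X', Fo C X', Fm a (idt T X'), Fm b (idt T X'),
         cmp U (th A X') (Fm c (idt T X'))) \<in> tri U"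
    using biex unfolding biexact_def by (elim conjE) assumption
  then show "(Fo A X', Fo B X', Fo D X', Fm a (idt T X'), Fm b (idt T X'),
         cmp U (th A X') (Fm c (idt T X'))) \<in> tri U" using X' t by blast
qed

lemma exact_functor_right:
  assumes X: "X \<in> ob S"
  shows "exact_functor T U (\<lambda>X'. Fo X X') (\<lambda>f. Fm (idt S X) f) (\<lambda>X'. ze X X')"
proof unfold_locales
  have i: "idt S X \<in> hom S X X" using S.arr_mr[OF S.arr_one[OF X]] by (simp add: S.mr_simps)
  have ii: "cmp S (idt S X) (idt S X) = idt S X"
    using S.cp_one(1)[OF S.arr_one[OF X], of X] by (simp add: S.cp_def S.one_def)
  fix X' Y' Z' f g
  assume X': "X' \<in> ob T"
  show "Fo X X' \<in> ob U" "Fm (idt S X) (idt T X') = idt U (Fo X X')" using X X' F_ob F_idt by blast+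
  show "iso_mor U (Fo X (sobj T X')) (sobj U (Fo X X')) (ze X X')"
  proof -
    have "\<forall>X\<in>ob S. \<forall>X'\<in>ob T. iso_mor U (Fo X (sobj T X')) (sobj U (Fo X X')) (ze X X')"
      using biex unfolding biexact_def by (elim conjE) assumption
    then show ?thesis using X X' by blast
  qed
  assume Y': "Y' \<in> ob T" and f: "f \<in> hom T X' Y'"
  show "Fm (idt S X) f \<in> hom U (Fo X X') (Fo X Y')" by (rule F_hom[OF X X X' Y' i f])
  assume Z': "Z' \<in> ob T" and g: "g \<in> hom T Y' Z'"
  show "Fm (idt S X) (cmp T g f) = cmp U (Fm (idt S X) g) (Fm (idt S X) f)"
    using F_cmp[OF X X X X' Y' Z' i i f g] ii by simp
next
  fix A B D a b c
  assume t: "(A, B, D, a, b, c) \<in> tri T"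
  have "\<forall>X\<in>ob S. \<forall>A B C a b c. (A,B,C,a,b,c) \<in> tri T \<longrightarrow>
        (Fo X A, Fo X B, Fo X C, Fm (idt S X) a, Fm (idt S X) b,
         cmp U (ze X A) (Fm (idt S X) c)) \<in> tri U"
    using biex unfolding biexact_def by (elim conjE) assumption
  then show "(Fo X A, Fo X B, Fo X D, Fm (idt S X) a, Fm (idt S X) b,
         cmp U (ze X A) (Fm (idt S X) c)) \<in> tri U" using X t by blast
qed

text \<open>One variable at a time: \<open>A'\<close> is built from \<open>X'\<close> with
  \<open>A\<close> fixed, then \<open>A\<close> from \<open>X\<close>.\<close>

lemma Fo_thick1:
  assumes "A \<in> thick1 S X" "A' \<in> thick1 T X'" "X \<in> ob S" "X' \<in> ob T"
  shows "Fo A A' \<in> thick1 U (Fo X X')"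
proof -
  have A: "A \<in> ob S" using S.thick1_ob[OF assms(1)] .
  have "Fo A A' \<in> thick1 U (Fo A X')"
    by (rule exact_functor.Go_thick1[OF exact_functor_right[OF A] assms(2,4)])
  moreover have "Fo A X' \<in> thick1 U (Fo X X')"
    by (rule exact_functor.Go_thick1[OF exact_functor_left[OF assms(4)] assms(1,3)])
  ultimately show ?thesis by (rule U.thick1_trans)
qed

lemma Fo_zero:
  "zero_obj S Y \<Longrightarrow> Y' \<in> ob T \<Longrightarrow> zero_obj U (Fo Y Y')"
  "zero_obj T Y' \<Longrightarrow> Y \<in> ob S \<Longrightarrow> zero_obj U (Fo Y Y')"
  using exact_functor.Go_zero[OF exact_functor_left] exact_functor.Go_zero[OF exact_functor_right]
  by blast+

text \<open>Square (III) makes the Verdier object a homotopy pullback, and \<open>j\<close> compares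
  it with the initial corner \<open>Fo (dm f) (cd f')\<close> of the commutative square given by
  \<open>f\<close> and \<open>g'\<close>. The cone of \<open>j\<close>, namely
  \<open>Fo (cd g) (dm f')\<close>, measures how far that square is from being homotopy
  cartesian.\<close>

lemma verdier_square:
  assumes e: "S.exact f g h" and e': "T.exact f' g' h'"
  obtains i j q q' c where
    "U.hc i q' (Fa f (T.one (cd g'))) (Fa (S.one (cd f)) g')"
    "U.exact j q c" "cd q = Fo (cd g) (dm f')" "dm j = Fo (dm f) (cd f')" "cd j = dm i"
    "U.cp i j = Fa f (T.one (cd f'))" "U.cp q' j = Fa (S.one (dm f)) g'"
proof -
  note d = S.exactD[OF e] T.exactD[OF e']
  have t: "(dm f, cd f, cd g, mr f, mr g, mr h) \<in> tri S"
      "(dm f', cd f', cd g', mr f', mr g', mr h') \<in> tri T"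
    using e e' by (simp_all add: S.exact_def T.exact_def)
  obtain W j q i p j' q' where W: "W \<in> ob U"
    and t1: "(Fo (dm f) (cd f'), W, Fo (cd g) (dm f'), j, q, cmp U (th (dm f) (cd f')) (Fm (mr h) (mr f'))) \<in> tri U"
    and t2: "(W, Fo (cd f) (cd f'), Fo (cd g) (cd g'), i, Fm (mr g) (mr g'), p) \<in> tri U"
    and t3: "(Fo (cd f) (dm f'), W, Fo (dm f) (cd g'), j', q', cmp U (ze (cd f) (dm f')) (Fm (mr f) (mr h'))) \<in> tri U"
    and q1: "cmp U q' j = Fm (idt S (dm f)) (mr g')" "cmp U i j = Fm (mr f) (idt T (cd f'))"
    and III: "hcart U W (Fo (cd f) (cd f')) (Fo (dm f) (cd g')) (Fo (cd f) (cd g'))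
             i q' (Fm (mr f) (idt T (cd g'))) (Fm (idt S (cd f)) (mr g'))"
    using sv[unfolded strong_verdier_def, rule_format, OF conjI, OF t] by (elim exE conjE) (rule that)
  have e1: "U.exact (Arw (Fo (dm f) (cd f')) j W) (Arw W q (Fo (cd g) (dm f')))
     (Arw (Fo (cd g) (dm f')) (cmp U (th (dm f) (cd f')) (Fm (mr h) (mr f'))) (sobj U (Fo (dm f) (cd f'))))"
    using t1 by (simp add: U.exact_def)
  have e2: "U.exact (Arw W i (Fo (cd f) (cd f'))) (Fa g g') (Arw (Fo (cd g) (cd g')) p (sobj U W))"
    using t2 d by (simp add: U.exact_def Fa_def)
  have e3: "U.exact (Arw (Fo (cd f) (dm f')) j' W) (Arw W q' (Fo (dm f) (cd g')))
     (Arw (Fo (dm f) (cd g')) (cmp U (ze (cd f) (dm f')) (Fm (mr f) (mr h'))) (sobj U (Fo (cd f) (dm f'))))"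
    using t3 by (simp add: U.exact_def)
  have E: "Arw (Fo (dm f) (cd g')) (Fm (mr f) (idt T (cd g'))) (Fo (cd f) (cd g')) = Fa f (T.one (cd g'))"
    "Arw (Fo (cd f) (cd f')) (Fm (idt S (cd f)) (mr g')) (Fo (cd f) (cd g')) = Fa (S.one (cd f)) g'"
    "Arw (Fo (dm f) (cd f')) (Fm (mr f) (idt T (cd f'))) (Fo (cd f) (cd f')) = Fa f (T.one (cd f'))"
    "Arw (Fo (dm f) (cd f')) (Fm (idt S (dm f)) (mr g')) (Fo (dm f) (cd g')) = Fa (S.one (dm f)) g'"
    using d by (simp_all add: Fa_def S.mr_simps T.mr_simps)
  have ars: "U.arr (Fa f (T.one (cd g')))" "U.arr (Fa (S.one (cd f)) g')" using d by simp_all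
  have "U.hc (Arw W i (Fo (cd f) (cd f'))) (Arw W q' (Fo (dm f) (cd g')))
      (Arw (Fo (dm f) (cd g')) (Fm (mr f) (idt T (cd g'))) (Fo (cd f) (cd g')))
      (Arw (Fo (cd f) (cd f')) (Fm (idt S (cd f)) (mr g')) (Fo (cd f) (cd g')))"
  proof (rule U.hcart_hc[OF III W])
    show "Fo (cd f) (cd f') \<in> ob U" "Fo (dm f) (cd g') \<in> ob U" "Fo (cd f) (cd g') \<in> ob U"
      using d by (simp_all add: F_ob)
    show "i \<in> hom U W (Fo (cd f) (cd f'))" "q' \<in> hom U W (Fo (dm f) (cd g'))"
      using U.arr_mr[OF U.exactD(1)[OF e2]] U.arr_mr[OF U.exactD(2)[OF e3]] by simp_all
    show "Fm (mr f) (idt T (cd g')) \<in> hom U (Fo (dm f) (cd g')) (Fo (cd f) (cd g'))"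
      "Fm (idt S (cd f)) (mr g') \<in> hom U (Fo (cd f) (cd f')) (Fo (cd f) (cd g'))"
      using U.arr_mr[OF ars(1)] U.arr_mr[OF ars(2)] d
      by (simp_all add: Fa_def S.mr_simps T.mr_simps)
  qed
  then have hc: "U.hc (Arw W i (Fo (cd f) (cd f'))) (Arw W q' (Fo (dm f) (cd g')))
     (Fa f (T.one (cd g'))) (Fa (S.one (cd f)) g')" unfolding E .
  have c: "U.cp (Arw W i (Fo (cd f) (cd f'))) (Arw (Fo (dm f) (cd f')) j W) = Fa f (T.one (cd f'))"
    "U.cp (Arw W q' (Fo (dm f) (cd g'))) (Arw (Fo (dm f) (cd f')) j W) = Fa (S.one (dm f)) g'"
    using q1 E(3,4) by (simp_all add: U.cp_def)
  show ?thesis by (rule that[OF hc e1 _ _ _ c]) simp_all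
qed


text \<open>\<open>\<pi> k\<close> projects the homotopy limit \<open>W k\<close> of the zigzag onto its end \<open>F(Z\<^sub>0, Z' k)\<close>; the next
  column of the filtration is the homotopy pullback along it.\<close>

lemma diagonal_filtration:
  fixes Z' :: "nat \<Rightarrow> 'c"
  assumes T': "\<And>k. T.exact (f' k) (g' k) (h' k)" "\<And>k. cd (f' k) = Z' k" "\<And>k. cd (g' k) = Z' (Suc k)"
      "\<And>k. dm (f' k) \<in> thick1 T X'" "\<forall>k\<ge>n. zero_obj T (Z' k)"
    and n: "0 < n" and X: "X \<in> ob S" "X' \<in> ob T"
  shows "S.tower m X Y \<Longrightarrow> \<exists>W s \<pi>.
     (\<forall>k. U.arr (s k) \<and> dm (s k) = W k \<and> cd (s k) = W (Suc k) \<and>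
        U.arr (\<pi> k) \<and> dm (\<pi> k) = W k \<and> cd (\<pi> k) = Fo Y (Z' k) \<and>
        U.cp (\<pi> (Suc k)) (s k) = U.cp (Fa (S.one Y) (g' k)) (\<pi> k) \<and>
        (\<exists>g h. U.exact (s k) g h \<and> cd g \<in> thick1 U (Fo X X'))) \<and>
     (\<forall>k. m + n \<le> Suc k \<longrightarrow> zero_obj U (W k)) \<and>
     (\<exists>g h. U.exact (\<pi> 0) g h \<and> zero_obj U (cd g))"
proof (induction m arbitrary: Y)
  case 0
  then have Y: "zero_obj S Y" by simp
  then have Yo: "Y \<in> ob S" by simp
  note d' = T.exactD[OF T'(1)]
  have Zo: "Z' k \<in> ob T" for k using T.arr_ob(2)[OF d'(1)[of k]] T'(2)[of k] by simp
  have z: "zero_obj U (Fo Y A)" if "A \<in> ob T" for A using Fo_zero(1)[OF Y that] .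
  \<comment> \<open>For the empty tower all objects \<open>Fo Y (Z' k)\<close> are zero; so are the
    cones, which therefore lie in \<open>thick1\<close> of any generator.\<close>
  show ?case
  proof (rule exI[of _ "\<lambda>k. Fo Y (Z' k)"], rule exI[of _ "\<lambda>k. Fa (S.one Y) (g' k)"],
      rule exI[of _ "\<lambda>k. U.one (Fo Y (Z' k))"], intro conjI allI impI)
    fix k
    show "U.arr (Fa (S.one Y) (g' k))" using Yo d' by simp
    show "dm (Fa (S.one Y) (g' k)) = Fo Y (Z' k)" "cd (Fa (S.one Y) (g' k)) = Fo Y (Z' (Suc k))"
      using d'(4)[of k] T'(2,3) by simp_all
    show "U.arr (U.one (Fo Y (Z' k)))" using Yo Zo by (simp add: F_ob)
    show "U.cp (U.one (Fo Y (Z' (Suc k)))) (Fa (S.one Y) (g' k)) =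
          U.cp (Fa (S.one Y) (g' k)) (U.one (Fo Y (Z' k)))"
      using Yo d' T'(2,3) by simp
    show "zero_obj U (Fo Y (Z' k))" using z Zo .
    show "\<exists>g h. U.exact (Fa (S.one Y) (g' k)) g h \<and> cd g \<in> thick1 U (Fo X X')"
    proof -
      interpret R: exact_functor T U "Fo Y" "Fm (idt S Y)" "ze Y"
        by (rule exact_functor_right[OF Yo])
      have G: "R.Ga a = Fa (S.one Y) a" for a by (simp add: R.Ga_def Fa_def S.one_def)
      have o: "dm (f' k) \<in> ob T" using d'(1) by simp
      from U.exact_rot[OF R.Ga_exact[OF T'(1)[of k]]]
      have "U.exact (Fa (S.one Y) (g' k)) (U.cp (Arw (Fo Y (sobj T (dm (f' k)))) (ze Y (dm (f' k)))
          (sobj U (Fo Y (dm (f' k))))) (Fa (S.one Y) (h' k))) (U.ng (U.sg (Fa (S.one Y) (f' k))))"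
        unfolding G .
      moreover have "sobj U (Fo Y (dm (f' k))) \<in> thick1 U (Fo X X')"
        by (rule thick1.zero[OF U.zero_obj_sobj[OF z[OF o]]])
      ultimately show ?thesis by (metis U.dm_cd_simps(2) arw.sel(3))
    qed
  next
    show "\<exists>g h. U.exact (U.one (Fo Y (Z' 0))) g h \<and> zero_obj U (cd g)"
      using U.exact_triv[OF F_ob[OF Yo Zo] z[OF Zo]] z[OF Zo]
      by (metis U.dm_cd_simps(8))
  qed simp_all
next
  case (Suc m)
  then obtain f g h where e: "S.exact f g h" "cd f = Y" "dm f \<in> thick1 S X" "S.tower m X (cd g)"
    by auto
  define Z where "Z = cd g"
  note d = S.exactD[OF e(1)]
  note d' = T.exactD[OF T'(1)]
  have Zo': "Z' k \<in> ob T" for k using T.arr_ob(2)[OF d'(1)[of k]] T'(2)[of k] by simp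
  have gd: "dm g = Y" "cd g = Z" "S.arr g" using d e(2) by (simp_all add: Z_def)
  have Yo: "Y \<in> ob S" and Zo: "Z \<in> ob S" using gd S.arr_ob by metis+
  have g'd: "dm (g' k) = Z' k" "cd (g' k) = Z' (Suc k)" "T.arr (g' k)" for k
    using d'(2,4)[of k] T'(2,3) by simp_all
  obtain W s \<pi> where IH: "\<And>k. U.arr (s k)" "\<And>k. dm (s k) = W k" "\<And>k. cd (s k) = W (Suc k)"
       "\<And>k. U.arr (\<pi> k)" "\<And>k. dm (\<pi> k) = W k" "\<And>k. cd (\<pi> k) = Fo Z (Z' k)"
       "\<And>k. U.cp (\<pi> (Suc k)) (s k) = U.cp (Fa (S.one Z) (g' k)) (\<pi> k)"
       "\<And>k. \<exists>g h. U.exact (s k) g h \<and> cd g \<in> thick1 U (Fo X X')"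
       "\<And>k. m + n \<le> Suc k \<Longrightarrow> zero_obj U (W k)"
       "\<exists>g h. U.exact (\<pi> 0) g h \<and> zero_obj U (cd g)"
    using Suc.IH[OF e(4)] unfolding Z_def by metis
  define E where "E k = Fa g (T.one (Z' k))" for k
  have E: "U.arr (E k)" "dm (E k) = Fo Y (Z' k)" "cd (E k) = Fo Z (Z' k)" for k
    using gd Zo' by (simp_all add: E_def)
  \<comment> \<open>\<open>dm (bW k)\<close> glues \<open>Fo Y (Z' k)\<close> to \<open>W k\<close>
    over \<open>Fo Z (Z' k)\<close>. For positive \<open>k\<close> it is an intermediate stop
    between two terms of the new tower.\<close>
  have "\<forall>k. \<exists>a b. U.hc a b (E k) (\<pi> k)"
    using U.hc_ex[OF E(1) IH(4)] E(3) IH(6) by metis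
  then obtain bW bE where B: "\<And>k. U.hc (bW k) (bE k) (E k) (\<pi> k)" by metis
  \<comment> \<open>\<open>dm (vW k)\<close> glues \<open>Fo Y (Z' (Suc k))\<close> to
    \<open>W k\<close> over \<open>Fo Z (Z' (Suc k))\<close>. It is term \<open>Suc k\<close> of the
    new tower: passing from \<open>Z\<close> to \<open>Y\<close> lengthens the first tower by one,
    which shifts diagonal \<open>k\<close> to \<open>Suc k\<close>.\<close>
  have "\<forall>k. \<exists>a b. U.hc a b (E (Suc k)) (U.cp (\<pi> (Suc k)) (s k))"
  proof
    fix k
    show "\<exists>a b. U.hc a b (E (Suc k)) (U.cp (\<pi> (Suc k)) (s k))"
      by (rule U.hc_ex[of "E (Suc k)" "U.cp (\<pi> (Suc k)) (s k)"]) (use E IH(1-6) in auto)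
  qed
  then obtain vW vE where V: "\<And>k. U.hc (vW k) (vE k) (E (Suc k)) (U.cp (\<pi> (Suc k)) (s k))" by metis
  note dB = U.hcD[OF B] and dV = U.hcD[OF V]
  have Bt: "U.arr (bW k)" "U.arr (bE k)" "dm (bE k) = dm (bW k)" "cd (bE k) = Fo Y (Z' k)"
     "cd (bW k) = W k" for k
    using dB[of k] E[of k] IH(5)[of k] by simp_all
  have Vt: "U.arr (vW k)" "U.arr (vE k)" "dm (vE k) = dm (vW k)" "cd (vE k) = Fo Y (Z' (Suc k))"
     "cd (vW k) = W k" for k
    using dV[of k] E[of "Suc k"] IH(2)[of k] by simp_all
  \<comment> \<open>\<open>t k\<close> moves \<open>W k\<close> to \<open>W (Suc k)\<close> and
    keeps the entry with \<open>Y\<close>. It is a base change of \<open>s k\<close> and so has the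
    same cone.\<close>
  have "\<forall>k. \<exists>t. U.hc (vW k) t (bW (Suc k)) (s k) \<and> U.cp (bE (Suc k)) t = vE k"
  proof
    fix k
    show "\<exists>t. U.hc (vW k) t (bW (Suc k)) (s k) \<and> U.cp (bE (Suc k)) t = vE k"
      by (rule U.hc_cancel[OF B V]) (use IH in auto)
  qed
  then obtain t where t: "\<And>k. U.hc (vW k) (t k) (bW (Suc k)) (s k)" "\<And>k. U.cp (bE (Suc k)) (t k) = vE k"
    by metis
  have tt: "U.arr (t k)" "dm (t k) = dm (vW k)" "cd (t k) = dm (bW (Suc k))" for k
    using U.hcD[OF t(1)[of k]] by simp_all
  \<comment> \<open>\<open>y k\<close> moves the entry with \<open>Y\<close> from
    \<open>Z' k\<close> to \<open>Z' (Suc k)\<close> and keeps \<open>W k\<close>. Here a new cone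
    enters.\<close>
  have "\<forall>k. \<exists>y. U.arr y \<and> dm y = dm (bW k) \<and> cd y = dm (vW k) \<and> U.cp (vW k) y = bW k \<and>
     U.cp (vE k) y = U.cp (Fa (S.one Y) (g' k)) (bE k) \<and>
     (\<exists>c d. U.exact y c d \<and> cd c \<in> thick1 U (Fo X X'))"
  proof
    fix k
    \<comment> \<open>The triangle is rotated so that the map from \<open>Y\<close> to
      \<open>Z\<close> comes first; its third object is then the suspension of \<open>dm f\<close>,
      which explains the suspension in \<open>cd q\<close>.\<close>
    obtain i j q q' c where v: "U.hc i q' (E (Suc k)) (Fa (S.one Z) (g' k))"
      "U.exact j q c" "cd q = Fo (sobj S (dm f)) (dm (f' k))" "dm j = Fo Y (Z' k)" "cd j = dm i"
      "U.cp i j = E k" "U.cp q' j = Fa (S.one Y) (g' k)"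
      by (rule verdier_square[OF S.exact_rot[OF e(1)] T'(1)[of k]])
        (use d e(2) T'(2,3) in \<open>simp add: E_def Z_def\<close>)
    note dv = U.hcD[OF v(1)] U.exactD[OF v(2)]
    have ci: "cd i = Fo Z (Z' k)" using dv(8) g'd by simp
    have "U.hc (vW k) (vE k) (E (Suc k)) (U.cp (Fa (S.one Z) (g' k)) (\<pi> k))"
      using V[of k] IH(7)[of k] by simp
    \<comment> \<open>By the compatibility of \<open>\<pi>\<close> with \<open>s\<close>, the outer
      square factors through \<open>\<pi> k\<close>. So \<open>dm (vW k)\<close> is the base change
      of the Verdier object along \<open>\<pi> k\<close>.\<close>
    then obtain \<gamma> where \<gamma>: "U.hc (vW k) \<gamma> i (\<pi> k)" "U.cp q' \<gamma> = vE k"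
      by (rule U.hc_cancel[OF v(1)]) (use IH(4-6) g'd ci dv in auto)
    note d\<gamma> = U.hcD[OF \<gamma>(1)]
    have "U.hc (bE k) (bW k) (\<pi> k) (U.cp i j)" using U.hc_sym[OF B[of k]] v(6) by simp
    \<comment> \<open>\<open>E k\<close> is the composite of \<open>j\<close> and \<open>i\<close>.
      Cancelling the base change of \<open>i\<close> leaves \<open>y\<close> as a base change of
      \<open>j\<close>, with the same cone.\<close>
    then obtain y where y: "U.hc (bE k) y \<gamma> j" "U.cp (vW k) y = bW k"
      by (rule U.hc_cancel[OF U.hc_sym[OF \<gamma>(1)]]) (use dv v(5) in auto)
    note dy = U.hcD[OF y(1)]
    have "U.cp (vE k) y = U.cp q' (U.cp \<gamma> y)"
      unfolding \<gamma>(2)[symmetric] using dv d\<gamma> dy by simp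
    also have "\<dots> = U.cp (U.cp q' j) (bE k)"
      unfolding U.hc_commute[OF y(1), symmetric] using dv dy d\<gamma> v(5) by simp
    finally have "U.cp (vE k) y = U.cp (Fa (S.one Y) (g' k)) (bE k)" using v(7) by simp
    moreover obtain w where "U.exact y (U.cp q \<gamma>) w" using U.hc_cone[OF y(1) v(2)] .
    moreover have "cd (U.cp q \<gamma>) \<in> thick1 U (Fo X X')"
      using Fo_thick1[OF thick1.susp[OF e(3)] T'(4)[of k] X] v(3) by simp
    ultimately show "\<exists>y. U.arr y \<and> dm y = dm (bW k) \<and> cd y = dm (vW k) \<and> U.cp (vW k) y = bW k \<and>
     U.cp (vE k) y = U.cp (Fa (S.one Y) (g' k)) (bE k) \<and>
     (\<exists>c d. U.exact y c d \<and> cd c \<in> thick1 U (Fo X X'))"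
      using dy y(2) Bt(3)[of k] d\<gamma> by (intro exI[of _ y]) auto
  qed
  then obtain y where y: "\<And>k. U.arr (y k)" "\<And>k. dm (y k) = dm (bW k)" "\<And>k. cd (y k) = dm (vW k)"
    "\<And>k. U.cp (vW k) (y k) = bW k"
    "\<And>k. U.cp (vE k) (y k) = U.cp (Fa (S.one Y) (g' k)) (bE k)"
    "\<And>k. \<exists>c d. U.exact (y k) c d \<and> cd c \<in> thick1 U (Fo X X')" by metis
  \<comment> \<open>Term 0 has no predecessor on a shorter diagonal: gluing
    \<open>Fo Y (Z' 0)\<close> to \<open>W 0\<close> along the invertible \<open>\<pi> 0\<close>
    changes nothing up to isomorphism, and the first step is \<open>y 0\<close> alone.\<close>
  define W2 where "W2 k = (case k of 0 \<Rightarrow> dm (bW 0) | Suc l \<Rightarrow> dm (vW l))" for k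
  define s2 where "s2 k = (case k of 0 \<Rightarrow> y 0 | Suc l \<Rightarrow> U.cp (y (Suc l)) (t l))" for k
  define p2 where "p2 k = (case k of 0 \<Rightarrow> bE 0 | Suc l \<Rightarrow> vE l)" for k
  have Fg: "U.arr (Fa (S.one Y) (g' k))" "dm (Fa (S.one Y) (g' k)) = Fo Y (Z' k)" for k
    using Yo g'd by simp_all
  show ?case
  proof (rule exI[of _ W2], rule exI[of _ s2], rule exI[of _ p2], intro conjI allI impI)
    fix k
    show "U.arr (s2 k)" "dm (s2 k) = W2 k" "cd (s2 k) = W2 (Suc k)" "U.arr (p2 k)" "dm (p2 k) = W2 k"
      "cd (p2 k) = Fo Y (Z' k)"
      using y(1-3) tt Bt Vt by (simp_all add: s2_def W2_def p2_def split: nat.splits)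
    show "U.cp (p2 (Suc k)) (s2 k) = U.cp (Fa (S.one Y) (g' k)) (p2 k)"
    proof (cases k)
      case 0
      then show ?thesis using y(5)[of 0] by (simp add: p2_def s2_def)
    next
      case (Suc l)
      have "U.cp (vE (Suc l)) (U.cp (y (Suc l)) (t l)) = U.cp (U.cp (vE (Suc l)) (y (Suc l))) (t l)"
        by (rule U.cp_assoc[symmetric]) (use y(1-3) tt Vt in simp_all)
      also have "\<dots> = U.cp (Fa (S.one Y) (g' (Suc l))) (U.cp (bE (Suc l)) (t l))"
        unfolding y(5) by (rule U.cp_assoc) (use Fg Bt tt in simp_all)
      finally show ?thesis using t(2)[of l] Suc by (simp add: p2_def s2_def)
    qed
    show "\<exists>g h. U.exact (s2 k) g h \<and> cd g \<in> thick1 U (Fo X X')"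
    proof (cases k)
      case 0
      then show ?thesis using y(6)[of 0] by (simp add: s2_def)
    next
      case (Suc l)
      obtain u w where u: "U.exact (s l) u w" "cd u \<in> thick1 U (Fo X X')" using IH(8) by blast
      note du = U.exactD[OF u(1)]
      obtain w' where e1: "U.exact (t l) (U.cp u (bW (Suc l))) w'"
        using U.hc_cone[OF t(1)[of l] u(1)] .
      obtain c1 c2 where e2: "U.exact (y (Suc l)) c1 c2" "cd c1 \<in> thick1 U (Fo X X')"
        using y(6) by blast
      have um: "dm u = W (Suc l)" using du IH(3) by simp
      \<comment> \<open>The cone projection of \<open>t l\<close> factors through
        \<open>y (Suc l)\<close>, since \<open>vW\<close> after \<open>y\<close> is
        \<open>bW\<close>. Hence the cone of the composite is a direct sum and stays in
        \<open>thick1\<close>.\<close>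
      have x: "U.cp (U.cp u (vW (Suc l))) (y (Suc l)) = U.cp u (bW (Suc l))"
        unfolding y(4)[symmetric] by (rule U.cp_assoc) (use du um Vt y(1-3) in simp_all)
      obtain h1 h2 where "U.exact (U.cp (y (Suc l)) (t l)) h1 h2" "cd h1 \<in> thick1 U (Fo X X')"
        by (rule U.thick1_cone_comp[OF e1 e2(1) _ _ _ x _ e2(2)])
          (use tt y(1-3) du um Vt u(2) in simp_all)
      then show ?thesis using Suc by (auto simp: s2_def)
    qed
    assume k: "Suc m + n \<le> Suc k"
    \<comment> \<open>Positivity of \<open>n\<close> rules out \<open>k = 0\<close>. For
      \<open>k = Suc l\<close> all three corners vanish: \<open>W l\<close> by induction, the other
      two because \<open>Z' (Suc l)\<close> is zero.\<close>
    then obtain l where l: "k = Suc l" "m + n \<le> Suc l" "n \<le> Suc l" using n by (cases k) auto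
    have "zero_obj U (dm (vW l))"
      by (rule U.hc_zero[OF V[of l]])
        (use IH(9)[OF l(2)] Fo_zero(2)[OF T'(5)[rule_format, OF l(3)] Yo] Fo_zero(2)[OF T'(5)[rule_format, OF l(3)] Zo] Vt E in simp_all)
    then show "zero_obj U (W2 k)" using l by (simp add: W2_def)
  next
    obtain u w where u: "U.exact (\<pi> 0) u w" "zero_obj U (cd u)" using IH(10) by blast
    \<comment> \<open>Having a zero cone is the form of invertibility that passes to base
      changes.\<close>
    obtain w' where "U.exact (bE 0) (U.cp u (E 0)) w'" using U.hc_cone[OF B[of 0] u(1)] .
    then show "\<exists>g h. U.exact (p2 0) g h \<and> zero_obj U (cd g)"
      using u(2) by (auto simp: p2_def)
  qed
qed

section \<open>From towers to the bound on levels\<close>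

lemma Fo_retract:
  assumes "S.retract_of Y Yh" "T.retract_of Y' Yh'"
  shows "U.retract_of (Fo Y Y') (Fo Yh Yh')"
proof -
  obtain r s where r: "S.arr r" "S.arr s" "dm r = Yh" "cd r = Y" "dm s = Y" "cd s = Yh" "S.cp r s = S.one Y"
    using assms(1) unfolding S.retract_of_def by blast
  obtain r' s' where r': "T.arr r'" "T.arr s'" "dm r' = Yh'" "cd r' = Y'" "dm s' = Y'" "cd s' = Yh'"
      "T.cp r' s' = T.one Y'"
    using assms(2) unfolding T.retract_of_def by blast
  have "U.cp (Fa r r') (Fa s s') = U.one (Fo Y Y')"
    using Fa_cp[of r s r' s'] r r' Fa_one S.retract_of_ob(1)[OF assms(1)] T.retract_of_ob(1)[OF assms(2)]
    by simp
  then show ?thesis unfolding U.retract_of_def using r r'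
    by (intro exI[of _ "Fa r r'"] exI[of _ "Fa s s'"]) simp
qed

text \<open>The diagonal tower of lengths \<open>Suc m\<close> and \<open>Suc n\<close> vanishes
  from index \<open>Suc m + Suc n - 1 = Suc (m + n)\<close> on.\<close>

lemma Fo_thick:
  assumes Y: "Y \<in> thick S (Suc m) X" "Y' \<in> thick T (Suc n) X'" and X: "X \<in> ob S" "X' \<in> ob T"
  shows "Fo Y Y' \<in> thick U (Suc (m + n)) (Fo X X')"
proof -
  obtain Yh where Yh: "S.tower (Suc m) X Yh" "S.retract_of Y Yh"
    using S.thick_retract_of_tower[OF Y(1)] by blast
  obtain Yh' where Yh': "T.tower (Suc n) X' Yh'" "T.retract_of Y' Yh'"
    using T.thick_retract_of_tower[OF Y(2)] by blast
  obtain Z' f' g' h' where Z': "Z' 0 = Yh'"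
     "\<And>k. T.exact (f' k) (g' k) (h' k)" "\<And>k. cd (f' k) = Z' k" "\<And>k. cd (g' k) = Z' (Suc k)"
     "\<And>k. dm (f' k) \<in> thick1 T X'" "\<forall>k\<ge>Suc n. zero_obj T (Z' k)"
    using T.tower_sequence[OF Yh'(1)] by metis
  obtain W s \<pi> where Ws: "\<forall>k. U.arr (s k) \<and> dm (s k) = W k \<and> cd (s k) = W (Suc k) \<and>
        U.arr (\<pi> k) \<and> dm (\<pi> k) = W k \<and> cd (\<pi> k) = Fo Yh (Z' k) \<and>
        U.cp (\<pi> (Suc k)) (s k) = U.cp (Fa (S.one Yh) (g' k)) (\<pi> k) \<and>
        (\<exists>g h. U.exact (s k) g h \<and> cd g \<in> thick1 U (Fo X X'))"
      and W0: "\<forall>k. Suc m + Suc n \<le> Suc k \<longrightarrow> zero_obj U (W k)"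
      and \<pi>0: "\<exists>g h. U.exact (\<pi> 0) g h \<and> zero_obj U (cd g)"
    using diagonal_filtration[of f' g' h' Z' X' "Suc n" X "Suc m" Yh, OF Z'(2-6) zero_less_Suc X Yh(1)]
    by blast
  have "U.tower (Suc (m + n)) (Fo X X') (W 0)"
  proof (rule U.sequence_tower[of s])
    show "\<exists>g h. U.exact (s k) g h \<and> dm (s k) = W k \<and> cd (s k) = W (Suc k) \<and> cd g \<in> thick1 U (Fo X X')"
      for k using Ws by blast
    show "zero_obj U (W (Suc (m + n)))" using W0 by simp
  qed
  then have "W 0 \<in> thick U (Suc (m + n)) (Fo X X')" by (rule U.tower_thick)
  moreover have "U.retract_of (Fo Y Y') (W 0)"
  \<comment> \<open>A section of \<open>\<pi> 0\<close>, available since its cone is zero, is all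
    that is needed: the final class is closed under retracts.\<close>
  proof -
    obtain g h where e: "U.exact (\<pi> 0) g h" "zero_obj U (cd g)" using \<pi>0 by blast
    obtain v where "U.arr v" "dm v = cd (\<pi> 0)" "cd v = dm (\<pi> 0)" "U.cp (\<pi> 0) v = U.one (cd (\<pi> 0))"
      using U.exact_zero_section[OF e] .
    then have "U.retract_of (Fo Yh Yh') (W 0)"
      unfolding U.retract_of_def using U.exactD(1)[OF e(1)] Ws Z'(1)
      by (intro exI[of _ "\<pi> 0"] exI[of _ v]) simp
    then show ?thesis using U.retract_of_trans[OF Fo_retract[OF Yh(2) Yh'(2)]] by blast
  qed
  ultimately show ?thesis by (rule U.thick_retract_closed)
qed

end

text \<open>An infimum of a nonempty set of naturals is attained; over the empty set it is
  infinite.\<close>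

lemma level_cases:
  obtains "level C X Y = \<infinity>" | n where "level C X Y = enat n" "Y \<in> thick C n X"
proof (cases "{n. Y \<in> thick C n X} = {}")
  case True
  then have "level C X Y = \<infinity>" unfolding level_def by (simp add: top_enat_def)
  then show ?thesis by (rule that(1))
next
  case False
  then have "level C X Y \<in> enat ` {n. Y \<in> thick C n X}"
    unfolding level_def Inf_enat_def by (simp only: image_is_empty if_False) (metis LeastI ex_in_conv image_is_empty)
  then show ?thesis using that(2) by auto
qed

lemma level_le: "Y \<in> thick C n X \<Longrightarrow> level C X Y \<le> enat n"
  unfolding level_def by (rule INF_lower) simp

theorem theorem3p6:
  fixes S :: "('a,'b) tcat" and T :: "('c,'d) tcat" and U :: "('e,'f) tcat"
    and Fo :: "'a \<Rightarrow> 'c \<Rightarrow> 'e" and Fm :: "'b \<Rightarrow> 'd \<Rightarrow> 'f"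
    and th :: "'a \<Rightarrow> 'c \<Rightarrow> 'f" and ze :: "'a \<Rightarrow> 'c \<Rightarrow> 'f"
  assumes "triangulated S" and "triangulated T" and "triangulated U"
    and "biexact S T U Fo Fm th ze"
    and "strong_verdier S T U Fo Fm th ze"
    and "X \<in> ob S" and "Y \<in> ob S" and "X' \<in> ob T" and "Y' \<in> ob T"
  shows "level U (Fo X X') (Fo Y Y') \<le> level S X Y + level T X' Y' - 1"
proof -
  interpret verdier S T U Fo Fm th ze
    using assms by unfold_locales
  show ?thesis
  proof (cases rule: level_cases[of S X Y])
    \<comment> \<open>On \<open>enat\<close>, infinity minus one is still infinity.\<close>
    case 1
    then show ?thesis by simp
  next
    case (2 m)
    note m = this
    show ?thesis
    proof (cases rule: level_cases[of T X' Y'])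
      case 1
      then show ?thesis by simp
    next
      case (2 n)
      show ?thesis
      proof (cases "m = 0 \<or> n = 0")
        \<comment> \<open>An argument of level 0 is a zero object, so the left side is 0. This also
          covers both levels being 0, where subtraction on \<open>enat\<close> truncates to
          0.\<close>
        case True
        then have "zero_obj S Y \<or> zero_obj T Y'" using m(2) 2(2) by auto
        then have "Fo Y Y' \<in> thick U 0 (Fo X X')" using Fo_zero assms(7,9) by auto
        then have "level U (Fo X X') (Fo Y Y') \<le> enat 0" by (rule level_le)
        then show ?thesis by (simp add: zero_enat_def[symmetric])
      next
        case False
        then obtain k l where kl: "m = Suc k" "n = Suc l" by (cases m; cases n) auto
        have "level U (Fo X X') (Fo Y Y') \<le> enat (Suc (k + l))"
          using Fo_thick[of Y k X Y' l X'] m(2) 2(2) kl assms(6,8) by (intro level_le) simp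
        then show ?thesis using m(1) 2(1) kl by (simp add: one_enat_def)
      qed
    qed
  qed
qed

end
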